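(* Consider a path diagram that has been conditioned on a set of nodes $S$ (all graphical notions and all covariances below refer to the resulting conditioned diagram), let $S'$ be the set of new nodes created by the conditioning, and let $Z = S \cup S'$. Let $X,Y$ be two distinct nodes of the original diagram outside $S$, and let $\Pi_{X:Y}$ denote the set of all $Z$-open paths from $X$ to $Y$. Suppose that no path in $\Pi_{X:Y}$ has colliders. Suppose that there are nodes $X_1,\ldots,X_{m+n}$ (with $m,n\ge 1$) such that all the paths in $\Pi_{X:Y}$ have a subpath $$X_m \leftarrow \cdots \leftarrow X_2 \leftarrow X_1 \rightarrow X_{m+1} \rightarrow \cdots \rightarrow X_{m+n} \quad\text{or}\quad X_1 = X \rightarrow X_2 \rightarrow \cdots \rightarrow X_{m+n}.$$ Suppose that there is no $Z$-open route $X_i \rightarrow A \;\ast\!-\!\ast\; \cdots \;\ast\!-\!\ast\; B \;\ast\!\!\rightarrow X_i$ with $i>1$. Moreover, let $Z_i^i = Z_i\cup Z^i$ and $Z_{1:a}^{1:b} = Z_1 \cup \cdots \cup Z_a \cup Z^1 \cup \cdots \cup Z^b$, where for $i=1,\ldots,m+n$: (i) $Z^i = \{W_1, W_2, \ldots\}$ is a subset of $Z \setminus Z^{1:i-1}_{1:i-1}$ such that each $W_j$ is $(Z^{1:i-1}_{1:i-1} \cup W_{1:j-1})$-connected to $X_i$ through $Pa(X_i) \cup Sp(X_i)$ by a path that does not contain any node that is in some path in $\Pi_{X:Y}$ except $X_i$; (ii) $Z_i = \{W_1, W_2, \ldots\}$ is a subset of $Z \setminus Z^{1:i}_{1:i-1}$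 such that each $W_j$ is $(Z^{1:i}_{1:i-1} \cup W_{1:j-1})$-connected to $X_i$ through $Ch(X_i)$ by a path that does not contain any node that is in some path in $\Pi_{X:Y}$ except $X_i$. Finally, let $Z \setminus Z^{1:m+n}_{1:m+n} = \{W_1, W_2, \ldots\}$ and suppose that, for each $j$, $X \perp W_j \mid Z^{1:m+n}_{1:m+n} \cup W_{1:j-1}$ or $Y \perp W_j \mid Z^{1:m+n}_{1:m+n} \cup W_{1:j-1}$. Then $$\sigma_{X Y \cdot Z} = \sigma_{X Y}\, \frac{\sigma^2_{X_1 \cdot Z_1^1}}{\sigma^2_{X_1}} \prod_{i=2}^{m+n} \frac{\sigma^2_{X_i \cdot Z_{1:i}^{1:i}}}{\sigma^2_{X_i \cdot Z_{1:i-1}^{1:i}}}.$$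
   Context: Path diagrams. A path diagram is a finite graph whose nodes are random variables, with directed edges $A\rightarrow B$ and bidirected edges $A\leftrightarrow B$ between distinct nodes (two nodes may be joined by both a directed and a bidirected edge). It represents a linear structural equation model: each node $B$ satisfies $B=\sum_{A\in Pa(B)}\alpha_{AB}A+\epsilon_B$, with jointly Gaussian errors such that $\mathrm{cov}(\epsilon_A,\epsilon_B)=0$ for distinct $A,B$ not joined by a bidirected edge. The system is assumed to determine the random variables uniquely (as it does in the usual setting where the directed edges form no cycle), and the error covariance matrix is positive definite. $Pa(A)=\{B: B\rightarrow A\}$, $Ch(A)=\{B: A\rightarrow B\}$, $Sp(A)=\{B: A\leftrightarrow B\}$. $A \;\ast\!\!\rightarrow B$ means $A\rightarrow B$ or $A\leftrightarrow B$ (and symmetrically $B \leftarrow\!\!\ast\; A$); $A\;\ast\!-\!\ast\;B$ means any edge ($\rightarrow$, $\leftarrow$ or $\leftrightarrow$). Paths, routes, separation. A route is a sequence of consecutive edges from one node to another, in which nodes may repeat; a path is a route with all nodes different. A node (occurrence) $C$ is a collider if it occurs in a segment $A\;\ast\!\!\rightarrow C\leftarrow\!\!\ast\; B$ (in a route $A$ and $B$ may be the same node); all other occurrences, including endpoints, are non-colliders. A path is $Z$-open if every collider in it is in $Z$ or has some descendant in $Z$, and every non-collider in it is outside $Z$. A route is $Z$-open if every collider in it is in $Z$ and every non-collider in it is outside $Z$. Nodes $U,V$ are $Z$-connected if there is a $Z$-open path between them; $U\perp V\mid Z$ means that there is no such path. "$W$ is $Z$-connected to $R$ through $Pa(R)\cup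 Sp(R)$" means by a $Z$-open path whose edge at $R$ is of the form $\ast\!\!\rightarrow R$; "through $Ch(R)$" means by a $Z$-open path whose edge at $R$ is of the form $R\rightarrow$. Paths in $\Pi_{X:Y}$ are read from $X$ to $Y$. Conditioning. Conditioning a path diagram on a node $A$ means replacing every edge $A\rightarrow B$ with an edge $A_B\rightarrow B$, where $A_B$ is a new node; $A$ is not removed and keeps its incoming and bidirected edges. In the equations: a new equation $A_B=\epsilon_{A_B}$ is added, with $\epsilon_{A_B}$ Gaussian of arbitrary mean and variance and uncorrelated with the other errors, and $A$ is replaced by $A_B$ (with the same coefficient) in the equation of $B$. Afterwards $Ch(A)=\emptyset$, $Pa(A_B)\cup Sp(A_B)=\emptyset$ and $Ch(A_B)=\{B\}$. Conditioning on a set $S$ means conditioning on each node of $S$; $S'$ is the set of all new nodes. Covariances. $\sigma_{UV\cdot Z}$ is the partial covariance of $U$ and $V$ given the set $Z$ (for $U,V\notin Z$), which for Gaussian vectors is the conditional covariance; $\sigma^2_{U\cdot Z}=\sigma_{UU\cdot Z}$; $\sigma_{UV}=\sigma_{UV\cdot\emptyset}$, $\sigma^2_U=\sigma^2_{U\cdot\emptyset}$. Index conventions. $W_{1:j-1}=\{W_1,\ldots,W_{j-1}\}$ (empty for $j=1$), and $Z^{1:0}_{1:0}=\emptyset$, $Z^{1:1}_{1:0}=Z^1$. In (i), (ii) and the final hypothesis the sets are enumerated in some fixed order $W_1,W_2,\ldots$; the sets may be empty.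
   Formalization: For m = 1 the first subpath form is read as requiring that the path starts at X_1 or reaches it by an edge ← X_1, so X_1 is a source; without this the claim fails, e.g. X→A→Y, C→A, S={C}, X_1=A, X_2=Y, Z^1={C_A}. *)

theory Defs
  imports "HOL-Probability.Probability"
begin

record 'v mixed_graph =
  nodes :: "'v set"
  directed :: "('v \<times> 'v) set"
  bidirected :: "('v \<times> 'v) set"

definition mixed_graph :: "('v, 'z) mixed_graph_scheme \<Rightarrow> bool" where
  "mixed_graph G \<longleftrightarrow>
     finite (nodes G) \<and>
     directed G \<subseteq> nodes G \<times> nodes G \<and> irrefl (directed G) \<and>
     bidirected G \<subseteq> nodes G \<times> nodes G \<and> irrefl (bidirected G) \<and> sym (bidirected G)"

text \<open>
  Two nodes may be joined by several edges, so a route is given by its list of nodes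
  \<open>vs\<close> together with the list \<open>es\<close> of the types of the edges traversed, as seen when the
  route is read from left to right.
\<close>

datatype edge_type = Forward | Backward | Bidirected

fun is_edge :: "('v, 'z) mixed_graph_scheme \<Rightarrow> 'v \<Rightarrow> edge_type \<Rightarrow> 'v \<Rightarrow> bool" where
  "is_edge G a Forward b \<longleftrightarrow> (a, b) \<in> directed G"
| "is_edge G a Backward b \<longleftrightarrow> (b, a) \<in> directed G"
| "is_edge G a Bidirected b \<longleftrightarrow> (a, b) \<in> bidirected G"

definition is_route :: "('v, 'z) mixed_graph_scheme \<Rightarrow> 'v list \<Rightarrow> edge_type list \<Rightarrow> bool" where
  "is_route G vs es \<longleftrightarrow>
     es \<noteq> [] \<and> length vs = Suc (length es) \<and> set vs \<subseteq> nodes G \<and>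
     (\<forall>i<length es. is_edge G (vs ! i) (es ! i) (vs ! Suc i))"

definition is_path :: "('v, 'z) mixed_graph_scheme \<Rightarrow> 'v list \<Rightarrow> edge_type list \<Rightarrow> bool" where
  "is_path G vs es \<longleftrightarrow> is_route G vs es \<and> distinct vs"

definition collider_at :: "edge_type list \<Rightarrow> nat \<Rightarrow> bool" where
  "collider_at es i \<longleftrightarrow>
     0 < i \<and> i < length es \<and>
     es ! (i - 1) \<in> {Forward, Bidirected} \<and> es ! i \<in> {Backward, Bidirected}"

definition open_path ::
  "('v, 'z) mixed_graph_scheme \<Rightarrow> 'v set \<Rightarrow> 'v list \<Rightarrow> edge_type list \<Rightarrow> bool" where
  "open_path G Z vs es \<longleftrightarrow>
     is_path G vs es \<and>
     (\<forall>i<length vs.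
        if collider_at es i then \<exists>z\<in>Z. (vs ! i, z) \<in> (directed G)\<^sup>* else vs ! i \<notin> Z)"

definition open_route ::
  "('v, 'z) mixed_graph_scheme \<Rightarrow> 'v set \<Rightarrow> 'v list \<Rightarrow> edge_type list \<Rightarrow> bool" where
  "open_route G Z vs es \<longleftrightarrow>
     is_route G vs es \<and>
     (\<forall>i<length vs. if collider_at es i then vs ! i \<in> Z else vs ! i \<notin> Z)"

definition open_paths ::
  "('v, 'z) mixed_graph_scheme \<Rightarrow> 'v set \<Rightarrow> 'v \<Rightarrow> 'v \<Rightarrow> ('v list \<times> edge_type list) set" where
  "open_paths G Z u v = {(vs, es). open_path G Z vs es \<and> hd vs = u \<and> last vs = v}"

definition separated :: "('v, 'z) mixed_graph_scheme \<Rightarrow> 'v \<Rightarrow> 'v \<Rightarrow> 'v set \<Rightarrow> bool" where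
  "separated G u v Z \<longleftrightarrow> open_paths G Z u v = {}"

definition subpath_at ::
  "nat \<Rightarrow> 'v list \<times> edge_type list \<Rightarrow> 'v list \<times> edge_type list \<Rightarrow> bool" where
  "subpath_at k q p \<longleftrightarrow>
     take (length (fst q)) (drop k (fst p)) = fst q \<and>
     take (length (snd q)) (drop k (snd p)) = snd q"

text \<open>
  The path \<open>p\<close> has the subpath
  \<open>x\<^sub>m \<leftarrow> \<dots> \<leftarrow> x\<^sub>2 \<leftarrow> x\<^sub>1 \<rightarrow> x\<^sub>m\<^sub>+\<^sub>1 \<rightarrow> \<dots> \<rightarrow> x\<^sub>m\<^sub>+\<^sub>n\<close>, where \<open>x\<^sub>1\<close> is the common source of both
  branches, i.e. \<open>p\<close> does not enter \<open>x\<^sub>1\<close> through an arrowhead. For \<open>m \<ge> 2\<close> this is automatic.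
  For \<open>m = 1\<close> the left branch is trivial and \<open>p\<close> has to start at \<open>x\<^sub>1\<close> or to reach it
  through an edge \<open>\<leftarrow> x\<^sub>1\<close>.
\<close>

definition has_trek_subpath ::
  "(nat \<Rightarrow> 'v) \<Rightarrow> nat \<Rightarrow> nat \<Rightarrow> 'v list \<times> edge_type list \<Rightarrow> bool" where
  "has_trek_subpath x m n p \<longleftrightarrow>
     (\<exists>k. subpath_at k
            (map x (rev [1..<m + 1] @ [m + 1..<m + n + 1]),
             replicate (m - 1) Backward @ replicate n Forward) p \<and>
          (m = 1 \<longrightarrow> k = 0 \<or> snd p ! (k - 1) = Backward))"

definition has_directed_subpath ::
  "(nat \<Rightarrow> 'v) \<Rightarrow> nat \<Rightarrow> 'v list \<times> edge_type list \<Rightarrow> bool" where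
  "has_directed_subpath x l p \<longleftrightarrow>
     (\<exists>k. subpath_at k (map x [1..<l + 1], replicate (l - 1) Forward) p)"

definition connected_via_pa_sp ::
  "('v, 'z) mixed_graph_scheme \<Rightarrow> 'v set \<Rightarrow> 'v set \<Rightarrow> 'v \<Rightarrow> 'v \<Rightarrow> bool" where
  "connected_via_pa_sp G N Z w r \<longleftrightarrow>
     (\<exists>(vs, es) \<in> open_paths G Z w r.
        last es \<in> {Forward, Bidirected} \<and> set vs \<inter> N \<subseteq> {r})"

definition connected_via_ch ::
  "('v, 'z) mixed_graph_scheme \<Rightarrow> 'v set \<Rightarrow> 'v set \<Rightarrow> 'v \<Rightarrow> 'v \<Rightarrow> bool" where
  "connected_via_ch G N Z w r \<longleftrightarrow>
     (\<exists>(vs, es) \<in> open_paths G Z w r. last es = Backward \<and> set vs \<inter> N \<subseteq> {r})"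

definition cumulative :: "(nat \<Rightarrow> 'v set) \<Rightarrow> (nat \<Rightarrow> 'v set) \<Rightarrow> nat \<Rightarrow> nat \<Rightarrow> 'v set" where
  "cumulative Zlo Zup a b = (\<Union>i\<in>{1..a}. Zlo i) \<union> (\<Union>i\<in>{1..b}. Zup i)"

text \<open>
  The set \<open>A\<close> has an enumeration \<open>W\<^sub>1, W\<^sub>2, \<dots>\<close> such that \<open>P C W\<^sub>j\<close> holds for each \<open>j\<close>, where
  \<open>C\<close> is \<open>B\<close> together with the elements enumerated before \<open>W\<^sub>j\<close>.
\<close>

definition enumerable_over :: "'v set \<Rightarrow> 'v set \<Rightarrow> ('v set \<Rightarrow> 'v \<Rightarrow> bool) \<Rightarrow> bool" where
  "enumerable_over B A P \<longleftrightarrow>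
     (\<exists>ws. distinct ws \<and> set ws = A \<and>
        (\<forall>j<length ws. P (B \<union> set (take j ws)) (ws ! j)))"

definition cov :: "'a measure \<Rightarrow> ('a \<Rightarrow> real) \<Rightarrow> ('a \<Rightarrow> real) \<Rightarrow> real" where
  "cov M U V =
     (\<integral>\<omega>. (U \<omega> - (\<integral>\<omega>'. U \<omega>' \<partial>M)) * (V \<omega> - (\<integral>\<omega>'. V \<omega>' \<partial>M)) \<partial>M)"

text \<open>
  The residual of the linear regression of \<open>X u\<close> on the variables \<open>X z\<close>, \<open>z \<in> Z\<close>, up to an
  additive constant, which is irrelevant for covariances. The coefficients solve the normal
  equations. For finite \<open>Z\<close> and square integrable variables a solution exists, and any two
  solutions give almost surely the same residual up to a constant.
\<close>

definition residual ::
  "'a measure \<Rightarrow> ('v \<Rightarrow> 'a \<Rightarrow> real) \<Rightarrow> 'v set \<Rightarrow> 'v \<Rightarrow> 'a \<Rightarrow> real" where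
  "residual M X Z u =
     (let \<beta> = (SOME \<beta>. \<forall>w\<in>Z. cov M (\<lambda>\<omega>. X u \<omega> - (\<Sum>z\<in>Z. \<beta> z * X z \<omega>)) (X w) = 0)
      in (\<lambda>\<omega>. X u \<omega> - (\<Sum>z\<in>Z. \<beta> z * X z \<omega>)))"

definition partial_cov ::
  "'a measure \<Rightarrow> ('v \<Rightarrow> 'a \<Rightarrow> real) \<Rightarrow> 'v \<Rightarrow> 'v \<Rightarrow> 'v set \<Rightarrow> real" where
  "partial_cov M X u v Z = cov M (residual M X Z u) (residual M X Z v)"

abbreviation partial_var ::
  "'a measure \<Rightarrow> ('v \<Rightarrow> 'a \<Rightarrow> real) \<Rightarrow> 'v \<Rightarrow> 'v set \<Rightarrow> real" where
  "partial_var M X u Z \<equiv> partial_cov M X u u Z"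

text \<open>Every linear combination is univariate Gaussian, possibly degenerate.\<close>

definition jointly_gaussian :: "'a measure \<Rightarrow> 'v set \<Rightarrow> ('v \<Rightarrow> 'a \<Rightarrow> real) \<Rightarrow> bool" where
  "jointly_gaussian M V \<epsilon> \<longleftrightarrow>
     (\<forall>v\<in>V. \<epsilon> v \<in> borel_measurable M) \<and>
     (\<forall>c :: 'v \<Rightarrow> real.
        (\<exists>\<mu>. AE \<omega> in M. (\<Sum>v\<in>V. c v * \<epsilon> v \<omega>) = \<mu>) \<or>
        (\<exists>\<mu> \<sigma>. \<sigma> > 0 \<and> distributed M lborel (\<lambda>\<omega>. \<Sum>v\<in>V. c v * \<epsilon> v \<omega>) (normal_density \<mu> \<sigma>)))"

definition pos_def_cov :: "'a measure \<Rightarrow> 'v set \<Rightarrow> ('v \<Rightarrow> 'a \<Rightarrow> real) \<Rightarrow> bool" where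
  "pos_def_cov M V \<epsilon> \<longleftrightarrow>
     (\<forall>c :: 'v \<Rightarrow> real. (\<exists>v\<in>V. c v \<noteq> 0) \<longrightarrow>
        (\<Sum>u\<in>V. \<Sum>v\<in>V. c u * c v * cov M (\<epsilon> u) (\<epsilon> v)) > 0)"

record ('v, 'a) path_diagram = "'v mixed_graph" +
  coef :: "'v \<Rightarrow> 'v \<Rightarrow> real"
  err :: "'v \<Rightarrow> 'a \<Rightarrow> real"
  rv :: "'v \<Rightarrow> 'a \<Rightarrow> real"

text \<open>\<open>coef D a b\<close> is the coefficient of \<open>a\<close> in the equation of \<open>b\<close>.\<close>

definition sem_solution ::
  "('v, 'a) path_diagram \<Rightarrow> ('v \<Rightarrow> real) \<Rightarrow> ('v \<Rightarrow> real) \<Rightarrow> bool" where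
  "sem_solution D e x \<longleftrightarrow>
     (\<forall>b\<in>nodes D. x b = (\<Sum>a | (a, b) \<in> directed D. coef D a b * x a) + e b)"

definition path_diagram :: "'a measure \<Rightarrow> ('v, 'a) path_diagram \<Rightarrow> bool" where
  "path_diagram M D \<longleftrightarrow>
     prob_space M \<and> mixed_graph D \<and>
     jointly_gaussian M (nodes D) (err D) \<and>
     pos_def_cov M (nodes D) (err D) \<and>
     (\<forall>a\<in>nodes D. \<forall>b\<in>nodes D.
        a \<noteq> b \<and> (a, b) \<notin> bidirected D \<longrightarrow> cov M (err D a) (err D b) = 0) \<and>
     (\<forall>e. \<exists>!x. x \<in> extensional (nodes D) \<and> sem_solution D e x) \<and>
     (\<forall>v\<in>nodes D. rv D v \<in> borel_measurable M) \<and>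
     (AE \<omega> in M. sem_solution D (\<lambda>v. err D v \<omega>) (\<lambda>v. rv D v \<omega>))"

text \<open>\<open>Copy a b\<close> is the new node usually written \<open>a\<^sub>b\<close>.\<close>

datatype 'v cnode = Orig 'v | Copy 'v 'v

definition new_nodes :: "('v, 'z) mixed_graph_scheme \<Rightarrow> 'v set \<Rightarrow> 'v cnode set" where
  "new_nodes G S = {Copy a b | a b. (a, b) \<in> directed G \<and> a \<in> S}"

text \<open>
  \<open>D'\<close> is the result of conditioning \<open>D\<close> on the nodes in \<open>S\<close>. The errors of the new nodes are
  constrained only by \<open>D'\<close> being a path diagram: they are Gaussian, and uncorrelated with all
  other errors because no bidirected edge of \<open>D'\<close> touches a new node. Their equations are
  \<open>rv D' (Copy a b) = err D' (Copy a b)\<close> because they have no parents.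
\<close>

definition conditioning_of ::
  "'a measure \<Rightarrow> ('v, 'a) path_diagram \<Rightarrow> 'v set \<Rightarrow> ('v cnode, 'a) path_diagram \<Rightarrow> bool" where
  "conditioning_of M D S D' \<longleftrightarrow>
     path_diagram M D \<and> S \<subseteq> nodes D \<and> path_diagram M D' \<and>
     nodes D' = Orig ` nodes D \<union> new_nodes D S \<and>
     directed D' = {(Orig a, Orig b) | a b. (a, b) \<in> directed D \<and> a \<notin> S} \<union>
                   {(Copy a b, Orig b) | a b. (a, b) \<in> directed D \<and> a \<in> S} \<and>
     bidirected D' = {(Orig a, Orig b) | a b. (a, b) \<in> bidirected D} \<and>
     (\<forall>(a, b)\<in>directed D.
        coef D' (if a \<in> S then Copy a b else Orig a) (Orig b) = coef D a b) \<and>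
     (\<forall>v\<in>nodes D. err D' (Orig v) = err D v)"

end

theory Submission
  imports Defs
begin

text \<open>
  After conditioning, a node of \<open>Z\<close> either has no children, or it is a new node, which has a single
  neighbour, its child. Neither kind can be an interior non-collider of a path. Hence, for every
  \<open>C \<subseteq> Z\<close>, a walk from \<open>X\<close> to \<open>Y\<close> whose colliders have descendants in \<open>C\<close> can be shortened to a
  \<open>Z\<close>-open path that uses only edges of the walk (\<open>open_walk_from_walk\<close>). So the paths in \<open>P\<close> govern
  the dependence of \<open>X\<close> and \<open>Y\<close> given every \<open>C \<subseteq> Z\<close>, the empty set included. In particular, if
  \<open>P\<close> is empty then both sides of the claim are zero.

  The proof adds the elements of \<open>Z\<close> to the conditioning set one at a time, in the order
  \<open>Z\<^sup>1, Z\<^sub>1, Z\<^sup>2, Z\<^sub>2, \<dots>\<close> and finally the rest, and follows the partial covariance of \<open>X\<close> and \<open>Y\<close>,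
  which obeys
  \<open>\<sigma>(X, Y | C w) = \<sigma>(X, Y | C) - \<sigma>(X, w | C) \<sigma>(Y, w | C) / \<sigma>(w, w | C)\<close>. Two cases occur.

  \<^item> If \<open>C\<close> separates \<open>w\<close> from \<open>X\<close> or from \<open>Y\<close>, nothing changes (\<open>neutral_step\<close>). For the rest this is
    assumed. It also holds for \<open>w\<close> in \<open>Z\<^sup>i\<close>, \<open>i \<ge> 2\<close>: the edge of the paths in \<open>P\<close> into \<open>x\<^sub>i\<close> and
    the connection from \<open>w\<close> meet in a collider at \<open>x\<^sub>i\<close>, and \<open>x\<^sub>i\<close> has no descendant among the
    nodes treated so far, because such a descendant would close a forbidden route at \<open>x\<^sub>i\<close>.
  \<^item> If \<open>C\<close> together with \<open>t = x\<^sub>i\<close> separates those of \<open>X\<close>, \<open>Y\<close> and \<open>w\<close> pairwise that differ from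
    \<open>t\<close>, the covariance is multiplied by \<open>\<sigma>(t, t | C w) / \<sigma>(t, t | C)\<close> (\<open>relay_step\<close>). This is so for \<open>w\<close> in \<open>Z\<^sub>i\<close> and for \<open>w\<close> in \<open>Z\<^sup>1\<close>.

  Within each set the factors telescope to the quotients in the theorem. The separations are
  turned into vanishing partial covariances by the global Markov property (\<open>global_markov\<close>), which
  is proved for diagrams with directed cycles too.

  The separations from \<open>w\<close> are shown by one device (\<open>shared_entry\<close>). A walk from \<open>X\<close> to \<open>w\<close> that should not
  be open is continued along the connection from \<open>w\<close> to \<open>x\<^sub>i\<close> and then along a path in \<open>P\<close> to \<open>Y\<close>.
  Shortening yields an element of \<open>P\<close>. Its edge into \<open>x\<^sub>i\<close> cannot stem from the connection, which
  avoids the nodes of \<open>P\<close>, so it lies on the given walk, and its direction gives the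
  contradiction.

  The directed form of the subpath is the trek form with trivial left branch, and a trek read
  from \<open>Y\<close> to \<open>X\<close> is again a trek, so only the right branch of a trek has to be analysed.
\<close>

section \<open>Walks as lists of steps\<close>

text \<open>
  A step records an edge as it is traversed from left to right. Repeated nodes and parallel edges
  are then harmless, and concatenating and reversing routes are list operations.
\<close>

type_synonym 'v step = "'v \<times> edge_type \<times> 'v"

abbreviation kind :: "'v step \<Rightarrow> edge_type" where "kind s \<equiv> fst (snd s)"
abbreviation target :: "'v step \<Rightarrow> 'v" where "target s \<equiv> snd (snd s)"

fun walk :: "('v, 'z) mixed_graph_scheme \<Rightarrow> 'v \<Rightarrow> 'v step list \<Rightarrow> 'v \<Rightarrow> bool" where
  "walk G u [] v \<longleftrightarrow> u = v"
| "walk G u ((a, e, b) # ss) v \<longleftrightarrow> a = u \<and> is_edge G a e b \<and> walk G b ss v"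

text \<open>
  The start node is a separate argument because an empty list of steps does not determine it.
\<close>

definition visited :: "'v \<Rightarrow> 'v step list \<Rightarrow> 'v list" where
  "visited u ss = u # map target ss"

text \<open>
  Only interior nodes are constrained: colliders must lie in \<open>A\<close>, non-colliders outside \<open>B\<close>. For paths
  open given \<open>C\<close> one takes the ancestors of \<open>C\<close> and \<open>C\<close>, for open routes \<open>C\<close> and \<open>C\<close>. The pair
  of the ancestors of \<open>Z\<close> and the empty set, which ignores non-colliders, is what survives
  concatenation at a node of \<open>Z\<close>.
\<close>

definition unblocked :: "'v set \<Rightarrow> 'v set \<Rightarrow> 'v step list \<Rightarrow> bool" where
  "unblocked A B = successively (\<lambda>s s'.
     if kind s \<noteq> Backward \<and> kind s' \<noteq> Forward then target s \<in> A else target s \<notin> B)"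

definition anc :: "('v, 'z) mixed_graph_scheme \<Rightarrow> 'v set \<Rightarrow> 'v set" where
  "anc G C = {a. \<exists>c\<in>C. (a, c) \<in> (directed G)\<^sup>*}"

definition parent_closed :: "('v, 'z) mixed_graph_scheme \<Rightarrow> 'v set \<Rightarrow> bool" where
  "parent_closed G A \<longleftrightarrow> (\<forall>a b. (a, b) \<in> directed G \<longrightarrow> b \<in> A \<longrightarrow> a \<in> A)"

fun flip_step :: "'v step \<Rightarrow> 'v step" where
  "flip_step (a, Forward, b) = (b, Backward, a)"
| "flip_step (a, Backward, b) = (b, Forward, a)"
| "flip_step (a, Bidirected, b) = (b, Bidirected, a)"

definition reversed :: "'v step list \<Rightarrow> 'v step list" where
  "reversed ss = rev (map flip_step ss)"

lemma edge_type_not_Backward: "e \<noteq> Backward \<longleftrightarrow> e \<in> {Forward, Bidirected}"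
  by (cases e) auto

lemma edge_type_not_Forward: "e \<noteq> Forward \<longleftrightarrow> e \<in> {Backward, Bidirected}"
  by (cases e) auto

lemma walk_append:
  "walk G u (ss @ ts) v \<longleftrightarrow> (\<exists>w. walk G u ss w \<and> walk G w ts v)"
  by (induction G u ss v rule: walk.induct) auto

lemma walk_ends:
  assumes "walk G u ss v" "ss \<noteq> []"
  shows "fst (hd ss) = u" "target (last ss) = v"
  using assms by (induction G u ss v rule: walk.induct) auto

lemma last_visited: "walk G u ss v \<Longrightarrow> last (visited u ss) = v"
  by (induction G u ss v rule: walk.induct) (auto simp: visited_def)

lemma walk_end_visited: "walk G u ss v \<Longrightarrow> v \<in> set (visited u ss)"
  using last_visited last_in_set[of "visited u ss"] by (fastforce simp: visited_def)

lemma walk_steps: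
  assumes "walk G u ss v" "(a, e, b) \<in> set ss"
  shows "is_edge G a e b" "a \<in> set (visited u ss)" "b \<in> set (visited u ss)"
  using assms by (induction G u ss v rule: walk.induct) (auto simp: visited_def)

lemma visited_append:
  "walk G u ss w \<Longrightarrow> visited u (ss @ ts) = visited u ss @ map target ts"
  by (simp add: visited_def)

lemma walk_split_at:
  assumes "walk G u ss v" "w \<in> set (visited u ss)"
  obtains ps qs where "ss = ps @ qs" "walk G u ps w" "walk G w qs v"
  using assms
proof (induction G u ss v arbitrary: thesis rule: walk.induct)
  case (1 G u v)
  then show ?case by (auto simp: visited_def)
next
  case (2 G u a e b ss v)
  show ?case
  proof (cases "w = u")
    case True
    then show ?thesis using 2(2)[of "[]"] 2(3) by auto
  next
    case False
    then have "w \<in> set (visited b ss)" using 2(4) by (auto simp: visited_def)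
    moreover have "walk G b ss v" using 2(3) by simp
    ultimately obtain ps qs where "ss = ps @ qs" "walk G b ps w" "walk G w qs v"
      using 2(1) by blast
    then show ?thesis using 2(2)[of "(a, e, b) # ps" qs] 2(3) by auto
  qed
qed

lemma walk_repetition:
  assumes "walk G u ss v" "\<not> distinct (visited u ss)"
  obtains ps ls qs w where "ss = ps @ ls @ qs" "ls \<noteq> []"
    "walk G u ps w" "walk G w ls w" "walk G w qs v"
  using assms
proof (induction G u ss v arbitrary: thesis rule: walk.induct)
  case (1 G u v)
  then show ?case by (auto simp: visited_def)
next
  case (2 G u a e b ss v)
  show ?case
  proof (cases "u \<in> set (visited b ss)")
    case True
    then obtain ps qs where "ss = ps @ qs" "walk G b ps u" "walk G u qs v"
      using 2(3) walk_split_at[of G b ss v u] by auto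
    then show ?thesis using 2(2)[of "[]" "(a, e, b) # ps" qs u] 2(3) by auto
  next
    case False
    then have "\<not> distinct (visited b ss)" using 2(4) by (auto simp: visited_def)
    moreover have "walk G b ss v" using 2(3) by simp
    ultimately obtain ps ls qs w where "ss = ps @ ls @ qs" "ls \<noteq> []"
      "walk G b ps w" "walk G w ls w" "walk G w qs v" using 2(1) by blast
    then show ?thesis using 2(2)[of "(a, e, b) # ps" ls qs w] 2(3) by auto
  qed
qed

lemma unblocked_append:
  "unblocked A B (ss @ ts) \<longleftrightarrow> unblocked A B ss \<and> unblocked A B ts \<and>
     (ss = [] \<or> ts = [] \<or>
      (if kind (last ss) \<noteq> Backward \<and> kind (hd ts) \<noteq> Forward
       then target (last ss) \<in> A else target (last ss) \<notin> B))"
  unfolding unblocked_def by (rule successively_append_iff)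

lemma unblocked_Nil [simp]: "unblocked A B []"
  by (simp add: unblocked_def)

lemma unblocked_single [simp]: "unblocked A B [s]"
  by (simp add: unblocked_def)

lemma unblocked_Cons:
  "unblocked A B (s # ss) \<longleftrightarrow> unblocked A B ss \<and>
     (ss = [] \<or> (if kind s \<noteq> Backward \<and> kind (hd ss) \<noteq> Forward
                then target s \<in> A else target s \<notin> B))"
  using unblocked_append[of A B "[s]" ss] by auto

lemma unblocked_mono:
  assumes "unblocked A B ss" "A \<subseteq> A'" "B' \<subseteq> B"
  shows "unblocked A' B' ss"
  using assms(1) unfolding unblocked_def
  by (rule successively_mono) (use assms in \<open>auto split: if_splits\<close>)

lemma anc_mono: "A \<subseteq> B \<Longrightarrow> anc G A \<subseteq> anc G B"
  by (auto simp: anc_def)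

lemma anc_superset: "A \<subseteq> anc G A"
  by (auto simp: anc_def)

lemma parent_closed_anc: "parent_closed G (anc G C)"
  unfolding parent_closed_def anc_def by (blast intro: converse_rtrancl_into_rtrancl)

lemma anc_rtrancl: "(a, b) \<in> (directed G)\<^sup>* \<Longrightarrow> b \<in> anc G C \<Longrightarrow> a \<in> anc G C"
  unfolding anc_def by (blast intro: rtrancl_trans)

lemma walk_all_forward:
  "walk G u ss v \<Longrightarrow> \<forall>s\<in>set ss. kind s = Forward \<Longrightarrow> (u, v) \<in> (directed G)\<^sup>*"
  by (induction G u ss v rule: walk.induct) (auto intro: converse_rtrancl_into_rtrancl)

text \<open>
  Following the arrows from the start, one either reaches the end or arrives at the first collider,
  which lies in \<open>A\<close>. As \<open>A\<close> is closed under parents, the start is then in \<open>A\<close> as well.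
\<close>

lemma forward_walk_meets:
  assumes "walk G u ss v" "ss \<noteq> []" "kind (hd ss) = Forward" "unblocked A B ss" "parent_closed G A"
  shows "u \<in> A \<or> (\<forall>s\<in>set ss. kind s = Forward)"
  using assms
proof (induction G u ss v rule: walk.induct)
  case (2 G u a e b ss v)
  show ?case
  proof (cases "ss = []")
    case False
    have e: "e = Forward" "(u, b) \<in> directed G" "walk G b ss v"
      using 2(2,4) by auto
    have ss: "unblocked A B ss"
      and j: "kind (hd ss) \<noteq> Forward \<Longrightarrow> b \<in> A"
      using 2(5) False e(1) by (simp_all add: unblocked_Cons)
    have "b \<in> A \<or> (\<forall>s\<in>set ss. kind s = Forward)"
      using 2(1)[OF e(3) False _ ss 2(6)] j by blast
    moreover have "u \<in> A" if "b \<in> A"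
      using that e(2) 2(6) unfolding parent_closed_def by blast
    ultimately show ?thesis using e(1) by auto
  qed (use 2 in auto)
qed simp

text \<open>
  Removing a loop at \<open>w\<close> may turn \<open>w\<close> into a collider. If the loop left \<open>w\<close> through an arrowhead at \<open>w\<close>,
  then \<open>w\<close> was a collider before. Otherwise the loop leaves \<open>w\<close> along an arrow, and as the walk
  comes back to \<open>w\<close> and goes on against an arrowhead, that arrow leads to a collider below \<open>w\<close>.
\<close>

lemma cut_loop:
  assumes "walk G u ps w" "walk G w ls w" "walk G w qs v" "ls \<noteq> []"
    and ok: "unblocked A B (ps @ ls @ qs)" and A: "parent_closed G A"
  shows "unblocked A B (ps @ qs)"
proof (cases "ps = [] \<or> qs = []")
  case False
  let ?e = "last ps" let ?f = "hd qs" let ?g = "hd ls" let ?h = "last ls"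
  have tg: "target ?e = w" "target ?h = w" using walk_ends(2)[OF assms(1)] walk_ends(2)[OF assms(2)] False assms(4) by simp_all
  have hd_f: "[?f] @ tl qs = qs" using False by simp
  have o1: "unblocked A B ps" "unblocked A B (ls @ qs)"
    and j1: "if kind ?e \<noteq> Backward \<and> kind ?g \<noteq> Forward then w \<in> A else w \<notin> B"
    using ok False \<open>ls \<noteq> []\<close> unfolding unblocked_append[of A B ps] tg by simp_all
  have o2: "unblocked A B ls" "unblocked A B qs"
    and j2: "if kind ?h \<noteq> Backward \<and> kind ?f \<noteq> Forward then w \<in> A else w \<notin> B"
    using o1(2) False \<open>ls \<noteq> []\<close> unfolding unblocked_append[of A B ls] tg by simp_all
  have ls: "unblocked A B (ls @ [?f])"
    unfolding unblocked_append[of A B ls] tg using o2(1) j2 by simp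
  have "if kind ?e \<noteq> Backward \<and> kind ?f \<noteq> Forward then w \<in> A else w \<notin> B"
  proof (cases "kind ?e \<noteq> Backward \<and> kind ?f \<noteq> Forward")
    case True
    have "w \<in> A"
    proof (cases "kind ?g = Forward")
      case gf: True
      obtain x where "walk G w [?f] x"
        using assms(3) walk_append[of G w "[?f]" "tl qs" v] unfolding hd_f by blast
      then have "walk G w (ls @ [?f]) x" unfolding walk_append using assms(2) by blast
      from forward_walk_meets[OF this _ _ ls A] gf \<open>ls \<noteq> []\<close> True show ?thesis by auto
    qed (use j1 True in simp)
    then show ?thesis using True by simp
  next
    case nc: False
    then have "w \<notin> B"
    proof (cases "kind ?e = Backward")
      case True
      then show ?thesis using j1 by simp
    next
      case False
      then have "kind ?f = Forward" using nc by blast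
      then show ?thesis using j2 by simp
    qed
    then show ?thesis using nc by argo
  qed
  then show ?thesis unfolding unblocked_append[of A B ps] tg using o1(1) o2(2) by simp
qed (use ok in \<open>auto simp: unblocked_append\<close>)

text \<open>
  Keeping track of the steps used is essential later: from the edges of the path, conclusions are
  drawn about the walk.
\<close>

lemma walk_to_path:
  assumes "walk G u ss v" "unblocked A B ss" "parent_closed G A"
  obtains ts where "walk G u ts v" "unblocked A B ts" "distinct (visited u ts)" "set ts \<subseteq> set ss"
  using assms(1,2)
proof (induction "length ss" arbitrary: ss thesis rule: less_induct)
  case less
  show ?case
  proof (cases "distinct (visited u ss)")
    case False
    then obtain ps ls qs w where d: "ss = ps @ ls @ qs" "ls \<noteq> []"
      "walk G u ps w" "walk G w ls w" "walk G w qs v" using walk_repetition less(3) by metis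
    have "walk G u (ps @ qs) v" unfolding walk_append using d by blast
    moreover have "unblocked A B (ps @ qs)" using cut_loop d less(4) assms(3) by metis
    moreover have "length (ps @ qs) < length ss" using d by simp
    ultimately obtain ts where "walk G u ts v" "unblocked A B ts" "distinct (visited u ts)"
      "set ts \<subseteq> set (ps @ qs)" using less(1) by metis
    then show ?thesis using less(2) d by fastforce
  qed (use less in blast)
qed

lemma directed_walk:
  assumes "(a, b) \<in> (directed G)\<^sup>*"
  obtains ss where "walk G a ss b" "\<And>s. s \<in> set ss \<Longrightarrow> kind s = Forward \<and> fst s \<noteq> b"
proof -
  have "\<exists>ss. walk G a ss b \<and> (\<forall>s\<in>set ss. kind s = Forward \<and> fst s \<noteq> b)"
    using assms
  proof (induction rule: converse_rtrancl_induct)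
    case base
    show ?case by (rule exI[of _ "[]"]) simp
  next
    case (step y z)
    then obtain ss where ss: "walk G z ss b" "\<forall>s\<in>set ss. kind s = Forward \<and> fst s \<noteq> b" by blast
    show ?case
    proof (cases "y = b")
      case True
      then show ?thesis by (intro exI[of _ "[]"]) simp
    next
      case False
      then show ?thesis using ss step(1) by (intro exI[of _ "(y, Forward, z) # ss"]) simp
    qed
  qed
  then show ?thesis using that by blast
qed

lemma unblocked_forward:
  assumes "\<forall>s\<in>set ss. kind s = Forward" "\<forall>s\<in>set ss. target s \<notin> B"
  shows "unblocked A B ss"
  using assms
proof (induction ss)
  case (Cons s ss)
  then have "ss = [] \<or> kind (hd ss) = Forward" by (cases ss) auto
  then show ?case using Cons by (auto simp: unblocked_Cons)
qed simp

lemma forward_walk_nodes: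
  assumes "walk G a ss b" "\<forall>s\<in>set ss. kind s = Forward" "s \<in> set ss"
  shows "(a, fst s) \<in> (directed G)\<^sup>*" "(a, target s) \<in> (directed G)\<^sup>*"
    "(fst s, b) \<in> (directed G)\<^sup>*" "(target s, b) \<in> (directed G)\<^sup>*"
    "(fst s, target s) \<in> directed G"
proof -
  obtain ps qs where "ss = ps @ s # qs" using split_list assms(3) by metis
  moreover obtain c e d where "s = (c, e, d)" by (cases s)
  ultimately have "walk G a ps c" "(c, d) \<in> directed G" "walk G d qs b" "s = (c, Forward, d)"
    "\<forall>s\<in>set ps. kind s = Forward" "\<forall>s\<in>set qs. kind s = Forward"
    using assms by (auto simp: walk_append)
  then show "(a, fst s) \<in> (directed G)\<^sup>*" "(a, target s) \<in> (directed G)\<^sup>*"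
    "(fst s, b) \<in> (directed G)\<^sup>*" "(target s, b) \<in> (directed G)\<^sup>*"
    "(fst s, target s) \<in> directed G"
    using walk_all_forward[of G a ps c] walk_all_forward[of G d qs b] by auto
qed

lemma flip_step_simps [simp]:
  "fst (flip_step s) = target s" "target (flip_step s) = fst s" "flip_step (flip_step s) = s"
  "kind (flip_step s) = Forward \<longleftrightarrow> kind s = Backward"
  "kind (flip_step s) = Backward \<longleftrightarrow> kind s = Forward"
  by (cases s rule: flip_step.cases; simp)+

lemma walk_reversed:
  assumes "sym (bidirected G)" "walk G u ss v"
  shows "walk G v (reversed ss) u"
  using assms(2)
proof (induction G\<equiv>G u ss v rule: walk.induct)
  case (2 u a e b ss v)
  have "walk G b [flip_step (a, e, b)] a"
    using 2(2) assms(1) by (cases e) (auto dest: symD)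
  then show ?case using 2 by (auto simp: reversed_def walk_append)
qed (simp add: reversed_def)

lemma reversed_Nil_iff [simp]: "reversed ss = [] \<longleftrightarrow> ss = []"
  by (simp add: reversed_def)

lemma set_reversed [simp]: "set (reversed ss) = flip_step ` set ss"
  by (simp add: reversed_def)

lemma last_reversed [simp]: "ss \<noteq> [] \<Longrightarrow> last (reversed ss) = flip_step (hd ss)"
  by (simp add: reversed_def last_rev hd_map)

lemma hd_reversed [simp]: "ss \<noteq> [] \<Longrightarrow> hd (reversed ss) = flip_step (last ss)"
  by (simp add: reversed_def hd_rev last_map)

lemma reversed_reversed [simp]: "reversed (reversed ss) = ss"
  by (simp add: reversed_def rev_map[symmetric] o_def)

lemma visited_reversed: "walk G u ss v \<Longrightarrow> visited v (reversed ss) = rev (visited u ss)"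
proof (induction G u ss v rule: walk.induct)
  case (2 G u a e b ss v)
  then have "visited v (reversed ss) = rev (visited b ss)" by simp
  then show ?case using 2(2) by (auto simp: visited_def reversed_def)
qed (simp add: visited_def reversed_def)

lemma unblocked_reversed:
  assumes "walk G u ss v"
  shows "unblocked A B (reversed ss) \<longleftrightarrow> unblocked A B ss"
  using assms
proof (induction G u ss v rule: walk.induct)
  case (2 G u a e b ss v)
  show ?case
  proof (cases "ss = []")
    case False
    have "fst (hd ss) = b" using walk_ends(1)[of G b ss v] 2(2) False by simp
    then show ?thesis using 2 False
      unfolding reversed_def by (auto simp: unblocked_append unblocked_Cons last_rev hd_map)
  qed (simp add: reversed_def)
qed (simp add: reversed_def)

section \<open>Partial covariances of a positive definite form\<close>

text \<open>
  Gaussian elimination: solve the equation at \<open>w\<close> for the unknown \<open>p\<close> and substitute.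
\<close>

lemma underdetermined_system_has_solution:
  fixes h :: "'i \<Rightarrow> 'w \<Rightarrow> real"
  assumes "finite A" "finite I" "card A < card I"
  shows "\<exists>\<gamma>. (\<exists>i\<in>I. \<gamma> i \<noteq> 0) \<and> (\<forall>w\<in>A. (\<Sum>i\<in>I. \<gamma> i * h i w) = 0)"
  using assms
proof (induction A arbitrary: I h rule: finite_induct)
  case empty
  then have "I \<noteq> {}" by auto
  then show ?case by (intro exI[of _ "\<lambda>_. 1"]) auto
next
  case (insert w A)
  show ?case
  proof (cases "\<forall>i\<in>I. h i w = 0")
    case True
    have "card A < card I" using insert by simp
    then obtain \<gamma> where "\<exists>i\<in>I. \<gamma> i \<noteq> 0" "\<forall>w\<in>A. (\<Sum>i\<in>I. \<gamma> i * h i w) = 0"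
      using insert.IH[of I h] insert.prems(1) by blast
    then show ?thesis using True by (intro exI[of _ \<gamma>]) auto
  next
    case False
    then obtain p where p: "p \<in> I" "h p w \<noteq> 0" by blast
    define h' where "h' i x = h i x - (h i w / h p w) * h p x" for i x
    have "card A < card (I - {p})" using insert p by (simp add: card_Diff_singleton)
    then obtain \<gamma> where \<gamma>: "\<exists>i\<in>I - {p}. \<gamma> i \<noteq> 0"
      "\<forall>x\<in>A. (\<Sum>i\<in>I - {p}. \<gamma> i * h' i x) = 0"
      using insert.IH[of "I - {p}" h'] insert.prems(1) by blast
    define g where "g = - (\<Sum>i\<in>I - {p}. \<gamma> i * h i w) / h p w"
    define \<delta> where "\<delta> = \<gamma>(p := g)"
    have expand: "(\<Sum>i\<in>I. \<delta> i * h i x) = g * h p x + (\<Sum>i\<in>I - {p}. \<gamma> i * h i x)" for x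
    proof -
      have "(\<Sum>i\<in>I. \<delta> i * h i x) = \<delta> p * h p x + (\<Sum>i\<in>I - {p}. \<delta> i * h i x)"
        using p(1) insert(4) by (rule sum.remove[rotated])
      also have "(\<Sum>i\<in>I - {p}. \<delta> i * h i x) = (\<Sum>i\<in>I - {p}. \<gamma> i * h i x)"
        by (rule sum.cong) (auto simp: \<delta>_def)
      finally show ?thesis by (simp add: \<delta>_def)
    qed
    have "(\<Sum>i\<in>I. \<delta> i * h i w) = 0" using p(2) by (simp add: expand g_def)
    moreover have "(\<Sum>i\<in>I. \<delta> i * h i x) = 0" if "x \<in> A" for x
    proof -
      have "0 = (\<Sum>i\<in>I - {p}. \<gamma> i * h' i x)" using \<gamma>(2) that by simp
      also have "\<dots> = (\<Sum>i\<in>I - {p}. \<gamma> i * h i x - \<gamma> i * h i w * (h p x / h p w))"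
        by (rule sum.cong) (auto simp: h'_def algebra_simps)
      also have "\<dots> = (\<Sum>i\<in>I - {p}. \<gamma> i * h i x) + g * h p x"
        by (simp add: sum_subtractf g_def sum_distrib_right sum_divide_distrib)
      finally show ?thesis by (simp add: expand)
    qed
    moreover have "\<exists>i\<in>I. \<delta> i \<noteq> 0" using \<gamma>(1) by (auto simp: \<delta>_def)
    ultimately show ?thesis by (intro exI[of _ \<delta>]) auto
  qed
qed

text \<open>
  Adding any \<open>r\<close> to a linearly independent family of full size makes it dependent, and in the dependence
  the coefficient of \<open>r\<close> is not zero. Finite dimension is needed: for the infinite system
  \<open>h d = e\<^sub>d - e\<^sub>d\<^sub>+\<^sub>1\<close> it fails.
\<close>

lemma independent_family_spans:
  fixes h :: "'w \<Rightarrow> 'w \<Rightarrow> real"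
  assumes "finite A"
    and independent: "\<And>\<gamma>. \<exists>d\<in>A. \<gamma> d \<noteq> 0 \<Longrightarrow> \<exists>w\<in>A. (\<Sum>d\<in>A. \<gamma> d * h d w) \<noteq> 0"
  shows "\<exists>\<gamma>. \<forall>w\<in>A. r w = (\<Sum>d\<in>A. \<gamma> d * h d w)"
proof -
  define I where "I = insert None (Some ` A)"
  define k where "k i = (case i of None \<Rightarrow> r | Some d \<Rightarrow> h d)" for i
  have "card I = Suc (card A)"
    using assms(1) by (simp add: I_def card_image)
  then obtain \<gamma> where \<gamma>: "\<exists>i\<in>I. \<gamma> i \<noteq> 0" "\<forall>w\<in>A. (\<Sum>i\<in>I. \<gamma> i * k i w) = 0"
    using underdetermined_system_has_solution[of A I k] assms(1) by (auto simp: I_def)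
  have sum: "(\<Sum>i\<in>I. \<gamma> i * k i w) = \<gamma> None * r w + (\<Sum>d\<in>A. \<gamma> (Some d) * h d w)" for w
    using assms(1) by (simp add: I_def k_def sum.reindex)
  have "\<gamma> None \<noteq> 0"
  proof
    assume 0: "\<gamma> None = 0"
    then have "\<exists>d\<in>A. \<gamma> (Some d) \<noteq> 0" using \<gamma>(1) by (auto simp: I_def)
    from independent[OF this] show False using \<gamma>(2) 0 by (auto simp: sum)
  qed
  have "r w = (\<Sum>d\<in>A. (- \<gamma> (Some d) / \<gamma> None) * h d w)" if "w \<in> A" for w
  proof -
    have "(\<Sum>d\<in>A. (- \<gamma> (Some d) / \<gamma> None) * h d w) = - (\<Sum>d\<in>A. \<gamma> (Some d) * h d w) / \<gamma> None"
      by (simp add: sum_negf sum_divide_distrib)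
    moreover have "- (\<Sum>d\<in>A. \<gamma> (Some d) * h d w) = r w * \<gamma> None"
    proof -
      have "\<gamma> None * r w + (\<Sum>d\<in>A. \<gamma> (Some d) * h d w) = 0" using \<gamma>(2) that by (simp add: sum)
      then show ?thesis by (simp add: mult.commute[of "r w"] eq_neg_iff_add_eq_0 neg_eq_iff_add_eq_0 add.commute)
    qed
    ultimately show ?thesis using \<open>\<gamma> None \<noteq> 0\<close> by simp
  qed
  then show ?thesis by (intro exI[of _ "\<lambda>d. - \<gamma> (Some d) / \<gamma> None"]) blast
qed

definition coord :: "'v \<Rightarrow> 'v \<Rightarrow> real" where
  "coord u x = (if x = u then 1 else 0)"

text \<open>
  A linear combination of variables is represented by its coefficients, a function on all nodes of which
  only the values on \<open>V\<close> count for the form below.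
\<close>

locale covariance_table =
  fixes V :: "'v set" and \<sigma> :: "'v \<Rightarrow> 'v \<Rightarrow> real"
  assumes finite_V: "finite V" and \<sigma>_sym: "\<sigma> u v = \<sigma> v u"
begin

definition form :: "('v \<Rightarrow> real) \<Rightarrow> ('v \<Rightarrow> real) \<Rightarrow> real" where
  "form a b = (\<Sum>u\<in>V. \<Sum>v\<in>V. a u * b v * \<sigma> u v)"

lemma form_sym: "form a b = form b a"
  unfolding form_def by (subst sum.swap) (simp add: mult.commute \<sigma>_sym mult.left_commute)

lemma form_cong:
  assumes "\<And>x. x \<in> V \<Longrightarrow> a x = a' x" "\<And>x. x \<in> V \<Longrightarrow> b x = b' x"
  shows "form a b = form a' b'"
  unfolding form_def using assms by (intro sum.cong refl) simp

lemma form_add_left: "form (\<lambda>x. a x + b x) c = form a c + form b c"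
  by (simp add: form_def algebra_simps sum.distrib)

lemma form_diff_left: "form (\<lambda>x. a x - b x) c = form a c - form b c"
  by (simp add: form_def algebra_simps sum_subtractf)

lemma form_scale_left: "form (\<lambda>x. k * a x) c = k * form a c"
  by (simp add: form_def sum_distrib_left mult.assoc)

lemma form_add_right: "form c (\<lambda>x. a x + b x) = form c a + form c b"
  using form_add_left form_sym by metis

lemma form_diff_right: "form c (\<lambda>x. a x - b x) = form c a - form c b"
  using form_diff_left form_sym by metis

lemma form_scale_right: "form c (\<lambda>x. k * a x) = k * form c a"
  using form_scale_left form_sym by metis

lemma form_zero_left: "form (\<lambda>x. 0) c = 0"
  by (simp add: form_def)

lemma form_sum_left: "finite I \<Longrightarrow> form (\<lambda>x. \<Sum>i\<in>I. k i * a i x) c = (\<Sum>i\<in>I. k i * form (a i) c)"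
  by (induction I rule: finite_induct)
    (simp_all add: form_zero_left form_add_left form_scale_left)

lemma form_sum_right: "finite I \<Longrightarrow> form c (\<lambda>x. \<Sum>i\<in>I. k i * a i x) = (\<Sum>i\<in>I. k i * form c (a i))"
  by (subst form_sym) (simp add: form_sum_left form_sym[of c])

lemma form_coord_right:
  assumes "v \<in> V"
  shows "form a (coord v) = (\<Sum>u\<in>V. a u * \<sigma> u v)"
  unfolding form_def
proof (rule sum.cong[OF refl])
  fix u
  have "(\<Sum>w\<in>V. a u * coord v w * \<sigma> u w) = (\<Sum>w\<in>V. if w = v then a u * \<sigma> u w else 0)"
    by (rule sum.cong) (auto simp: coord_def)
  then show "(\<Sum>w\<in>V. a u * coord v w * \<sigma> u w) = a u * \<sigma> u v"
    using finite_V assms by simp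
qed

lemma form_expand_right: "form a b = (\<Sum>v\<in>V. b v * form a (coord v))"
proof -
  have "form a b = (\<Sum>v\<in>V. \<Sum>u\<in>V. a u * b v * \<sigma> u v)"
    unfolding form_def by (rule sum.swap)
  also have "\<dots> = (\<Sum>v\<in>V. b v * form a (coord v))"
    by (intro sum.cong refl) (simp add: form_coord_right sum_distrib_left mult_ac)
  finally show ?thesis .
qed

text \<open>
  The coefficients of a regression residual: the variable \<open>u\<close> minus a combination of the variables in \<open>C\<close>,
  orthogonal to all of them. Fixing the coefficients outside \<open>C\<close>, also outside \<open>V\<close>, makes the residual
  unique as a function.
\<close>

definition is_residual :: "'v set \<Rightarrow> 'v \<Rightarrow> ('v \<Rightarrow> real) \<Rightarrow> bool" where
  "is_residual C u r \<longleftrightarrow> (\<forall>x. x \<notin> C \<longrightarrow> r x = coord u x) \<and> (\<forall>w\<in>C. form r (coord w) = 0)"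

lemma orthogonal_to_conditioning:
  assumes "\<forall>w\<in>C. form r (coord w) = 0" "\<forall>x\<in>V - C. b x = 0"
  shows "form r b = 0"
  unfolding form_expand_right[of r b] using assms by (intro sum.neutral) auto

definition res :: "'v set \<Rightarrow> 'v \<Rightarrow> 'v \<Rightarrow> real" where
  "res C u = (SOME r. is_residual C u r)"

definition pcov :: "'v set \<Rightarrow> 'v \<Rightarrow> 'v \<Rightarrow> real" where
  "pcov C u v = form (res C u) (res C v)"

lemma pcov_sym: "pcov C u v = pcov C v u"
  by (simp add: pcov_def form_sym)

end

locale pos_def_table = covariance_table V \<sigma> for V :: "'v set" and \<sigma> +
  assumes pos_def: "\<exists>v\<in>V. a v \<noteq> 0 \<Longrightarrow> form a a > 0"
begin

lemma residual_unique:
  assumes "is_residual C u r" "is_residual C u r'" "C \<subseteq> V"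
  shows "r = r'"
proof -
  define d where "d x = r x - r' x" for x
  have out: "d x = 0" if "x \<notin> C" for x using that assms by (simp add: d_def is_residual_def)
  have "\<forall>w\<in>C. form d (coord w) = 0"
    using assms unfolding d_def by (simp add: form_diff_left is_residual_def)
  then have "form d d = 0" using out by (intro orthogonal_to_conditioning) auto
  then have "\<forall>v\<in>V. d v = 0" using pos_def[of d] by fastforce
  then have "d x = 0" for x using out assms(3) by blast
  then show ?thesis by (auto simp: d_def)
qed

text \<open>
  One step of Gram-Schmidt orthogonalisation.
\<close>

lemma residual_insert:
  assumes C: "C \<subseteq> V" and w: "w \<in> V" "w \<notin> C"
    and u: "is_residual C u ru" and rw: "is_residual C w rw"
  shows "form rw rw > 0"
    and "is_residual (insert w C) u (\<lambda>x. ru x - (form ru rw / form rw rw) * rw x)"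
proof -
  have "rw w = 1" using rw w by (simp add: is_residual_def coord_def)
  then show pos: "form rw rw > 0" using w pos_def[of rw] by force
  define k where "k = form ru rw / form rw rw"
  have rww: "form r (coord w) = form r rw" if "is_residual C v r" for r v
  proof -
    have "form r (\<lambda>x. rw x - coord w x) = 0"
      using that rw by (intro orthogonal_to_conditioning[where C = C]) (auto simp: is_residual_def)
    then show ?thesis by (simp add: form_diff_right)
  qed
  have "form (\<lambda>x. ru x - k * rw x) (coord w) = 0"
    unfolding form_diff_left form_scale_left rww[OF u] rww[OF rw] k_def using pos by simp
  moreover have "form (\<lambda>x. ru x - k * rw x) (coord v) = 0" if "v \<in> C" for v
    using that u rw by (simp add: form_diff_left form_scale_left is_residual_def)
  moreover have "ru x - k * rw x = coord u x" if "x \<notin> insert w C" for x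
    using that u rw by (simp add: is_residual_def coord_def)
  ultimately show "is_residual (insert w C) u (\<lambda>x. ru x - (form ru rw / form rw rw) * rw x)"
    unfolding k_def[symmetric] by (auto simp: is_residual_def)
qed

lemma residual_exists:
  assumes "C \<subseteq> V"
  shows "\<exists>r. is_residual C u r"
proof -
  have "finite C" using assms finite_V by (rule finite_subset)
  then show ?thesis using assms
  proof (induction C arbitrary: u rule: finite_induct)
    case empty
    show ?case by (rule exI[of _ "coord u"]) (simp add: is_residual_def)
  next
    case (insert w C)
    then obtain ru rw where "is_residual C u ru" "is_residual C w rw" by blast
    then show ?case using residual_insert(2)[of C w u ru rw] insert by blast
  qed
qed

lemma res: "C \<subseteq> V \<Longrightarrow> is_residual C u (res C u)"
  unfolding res_def using residual_exists by (metis someI_ex)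

lemma res_eqI: "C \<subseteq> V \<Longrightarrow> is_residual C u r \<Longrightarrow> res C u = r"
  using residual_unique res by metis

lemma pcov_pos: "C \<subseteq> V \<Longrightarrow> w \<in> V \<Longrightarrow> w \<notin> C \<Longrightarrow> pcov C w w > 0"
  unfolding pcov_def using residual_insert(1) res by blast

lemma pcov_insert:
  assumes "C \<subseteq> V" "w \<in> V" "w \<notin> C"
  shows "pcov (insert w C) u v = pcov C u v - pcov C u w * pcov C v w / pcov C w w"
proof -
  have eq: "res (insert w C) y = (\<lambda>x. res C y x - (pcov C y w / pcov C w w) * res C w x)" for y
    unfolding pcov_def using assms res residual_insert(2) by (intro res_eqI) auto
  have pos: "pcov C w w > 0" using pcov_pos assms by blast
  have "pcov (insert w C) u v = pcov C u v - (pcov C v w / pcov C w w) * pcov C u w -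
      (pcov C u w / pcov C w w) * (pcov C w v - (pcov C v w / pcov C w w) * pcov C w w)"
    unfolding pcov_def[of "insert w C"] eq form_diff_left form_scale_left form_diff_right
      form_scale_right pcov_def[symmetric] by (simp only: algebra_simps)
  moreover have "pcov C w v = pcov C v w" by (rule pcov_sym)
  ultimately show ?thesis using pos by simp
qed

text \<open>
  This is the linear algebra behind a density that factorises as \<open>f (R, C) g (Q, C)\<close>. The \<open>\<eta> d\<close> play the
  role of the errors. They fall into two orthogonal groups, one built from \<open>R\<close> and \<open>C\<close>, the other
  from \<open>Q\<close> and \<open>C\<close>. Split the residuals \<open>r\<close> of \<open>u\<close> and \<open>q\<close> of \<open>v\<close> accordingly into \<open>r1 + r2\<close> and
  \<open>q1 + q2\<close>. Then \<open>r2\<close> and \<open>q1\<close> involve only \<open>C\<close>, to which both residuals are orthogonal.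
\<close>

lemma factorisation_orthogonality:
  assumes A: "A = R \<union> C \<union> Q" "A \<subseteq> V" and disj: "R \<inter> Q = {}" "R \<inter> C = {}" "Q \<inter> C = {}"
    and E: "E \<subseteq> A"
    and supp1: "\<And>d x. d \<in> E \<Longrightarrow> x \<notin> R \<union> C \<Longrightarrow> \<eta> d x = 0"
    and supp2: "\<And>d x. d \<in> A - E \<Longrightarrow> x \<notin> Q \<union> C \<Longrightarrow> \<eta> d x = 0"
    and cross: "\<And>d e. d \<in> E \<Longrightarrow> e \<in> A - E \<Longrightarrow> form (\<eta> d) (\<eta> e) = 0"
    and span: "\<And>r. \<exists>\<gamma>. \<forall>w\<in>A. r w = (\<Sum>d\<in>A. \<gamma> d * \<eta> d w)"
    and u: "u \<in> R" and v: "v \<in> Q"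
  shows "pcov C u v = 0"
proof -
  have fin: "finite A" "finite E" "finite (A - E)"
    using finite_subset[OF A(2) finite_V] finite_subset[OF E] by simp_all
  have C: "C \<subseteq> V" using A by blast
  let ?r = "res C u" let ?q = "res C v"
  have vanish: "\<And>x. x \<notin> R \<union> C \<Longrightarrow> ?r x = 0" "\<And>x. x \<notin> Q \<union> C \<Longrightarrow> ?q x = 0"
    using res[OF C] u v by (auto simp: is_residual_def coord_def)
  have orth: "form (res C y) b = 0" if "\<forall>x\<in>V - C. b x = 0" for y b
    by (rule orthogonal_to_conditioning[OF _ that]) (use res[OF C, of y] in \<open>simp add: is_residual_def\<close>)
  have out: "\<forall>x. x \<notin> A \<longrightarrow> ?r x = 0" "\<forall>x. x \<notin> A \<longrightarrow> ?q x = 0"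
    using vanish A(1) by auto
  define T where "T F \<gamma> w = (\<Sum>d\<in>F. \<gamma> d * \<eta> d w)" for F and \<gamma> :: "'v \<Rightarrow> real" and w
  have split: "\<exists>f1\<in>range (T E). \<exists>f2\<in>range (T (A - E)). (\<forall>x. f x = f1 x + f2 x) \<and>
      (\<forall>x. x \<notin> R \<union> C \<longrightarrow> f1 x = 0) \<and> (\<forall>x. x \<notin> Q \<union> C \<longrightarrow> f2 x = 0)"
    if f: "\<forall>x. x \<notin> A \<longrightarrow> f x = 0" for f
  proof -
    obtain \<gamma> where \<gamma>: "\<forall>w\<in>A. f w = (\<Sum>d\<in>A. \<gamma> d * \<eta> d w)" using span by blast
    define f1 where "f1 = T E \<gamma>"
    define f2 where "f2 = T (A - E) \<gamma>"
    have s: "\<forall>x. x \<notin> R \<union> C \<longrightarrow> f1 x = 0" "\<forall>x. x \<notin> Q \<union> C \<longrightarrow> f2 x = 0"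
      unfolding f1_def f2_def T_def using supp1 supp2 by (simp_all add: sum.neutral)
    have "f w = f1 w + f2 w" for w
    proof (cases "w \<in> A")
      case True
      then show ?thesis
        using \<gamma> sum.subset_diff[OF E fin(1), of "\<lambda>d. \<gamma> d * \<eta> d w"] by (simp add: f1_def f2_def T_def)
    next
      case False
      then show ?thesis using f s A by auto
    qed
    moreover have "f1 \<in> range (T E)" "f2 \<in> range (T (A - E))" by (simp_all add: f1_def f2_def)
    ultimately show ?thesis using s by blast
  qed
  obtain r1 r2 where r: "r1 \<in> range (T E)" "r2 \<in> range (T (A - E))"
    "\<forall>x. ?r x = r1 x + r2 x" "\<forall>x. x \<notin> R \<union> C \<longrightarrow> r1 x = 0" "\<forall>x. x \<notin> Q \<union> C \<longrightarrow> r2 x = 0"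
    using split[of ?r, OF out(1)] by blast
  obtain q1 q2 where q: "q1 \<in> range (T E)" "q2 \<in> range (T (A - E))"
    "\<forall>x. ?q x = q1 x + q2 x" "\<forall>x. x \<notin> R \<union> C \<longrightarrow> q1 x = 0" "\<forall>x. x \<notin> Q \<union> C \<longrightarrow> q2 x = 0"
    using split[of ?q, OF out(2)] by blast
  have rq: "?r = (\<lambda>x. r1 x + r2 x)" "?q = (\<lambda>x. q1 x + q2 x)" using r(3) q(3) by auto
  \<comment> \<open>Outside \<open>R\<close> and \<open>C\<close> both \<open>r\<close> and \<open>r1\<close> vanish, outside \<open>Q\<close> and \<open>C\<close> so does \<open>r2\<close>.\<close>
  have "r2 x = 0" if "x \<in> V - C" for x
  proof (cases "x \<in> Q")
    case True
    then have "x \<notin> R \<union> C" using disj by blast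
    then show ?thesis using vanish(1)[of x] r(3,4) by simp
  qed (use that r(5) in blast)
  then have qr2: "form ?q r2 = 0" by (intro orth) simp
  have "q1 x = 0" if "x \<in> V - C" for x
  proof (cases "x \<in> R")
    case True
    then have "x \<notin> Q \<union> C" using disj by blast
    then show ?thesis using vanish(2)[of x] q(3,5) by simp
  qed (use that q(4) in blast)
  then have rq1: "form ?r q1 = 0" by (intro orth) simp
  have "form (T E a) (T (A - E) b) = 0" for a b
    unfolding T_def using cross fin by (simp add: form_sum_left form_sum_right sum.neutral)
  then have x: "form r1 q2 = 0" "form q1 r2 = 0" using r(1,2) q(1,2) by auto
  have "form ?r ?q = form r1 q1 + form r1 q2 + form r2 q1 + form r2 q2"
    unfolding rq by (simp add: form_add_left form_add_right)
  moreover have "form ?r q1 = form r1 q1 + form r2 q1" unfolding rq by (rule form_add_left)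
  moreover have "form ?q r2 = form q1 r2 + form q2 r2" unfolding rq by (rule form_add_left)
  moreover have "form r2 q2 = form q2 r2" by (rule form_sym)
  ultimately show ?thesis using rq1 qr2 x by (simp add: pcov_def)
qed

end

section \<open>Covariances in a linear structural equation model\<close>

lemma cov_sym: "cov M f g = cov M g f"
  unfolding cov_def by (simp add: mult.commute)

lemma cov_cong_AE:
  assumes "AE \<omega> in M. f \<omega> = f' \<omega>" "AE \<omega> in M. g \<omega> = g' \<omega>"
    and "f \<in> borel_measurable M" "f' \<in> borel_measurable M"
    and "g \<in> borel_measurable M" "g' \<in> borel_measurable M"
  shows "cov M f g = cov M f' g'"
proof -
  have "(\<integral>\<omega>. f \<omega> \<partial>M) = (\<integral>\<omega>. f' \<omega> \<partial>M)" "(\<integral>\<omega>. g \<omega> \<partial>M) = (\<integral>\<omega>. g' \<omega> \<partial>M)"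
    using assms by (auto intro: integral_cong_AE)
  then show ?thesis unfolding cov_def
    using assms by (intro integral_cong_AE) (auto elim: eventually_elim2)
qed

definition square_integrable :: "'a measure \<Rightarrow> ('a \<Rightarrow> real) \<Rightarrow> bool" where
  "square_integrable M f \<longleftrightarrow> f \<in> borel_measurable M \<and> integrable M (\<lambda>\<omega>. (f \<omega>)\<^sup>2)"

lemma square_integrable_mult:
  assumes "square_integrable M f" "square_integrable M g"
  shows "integrable M (\<lambda>\<omega>. f \<omega> * g \<omega>)"
proof (rule Bochner_Integration.integrable_bound)
  show "integrable M (\<lambda>\<omega>. (f \<omega>)\<^sup>2 + (g \<omega>)\<^sup>2)"
    using assms by (auto simp: square_integrable_def)
  show "(\<lambda>\<omega>. f \<omega> * g \<omega>) \<in> borel_measurable M"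
    using assms by (auto simp: square_integrable_def)
  show "AE \<omega> in M. norm (f \<omega> * g \<omega>) \<le> norm ((f \<omega>)\<^sup>2 + (g \<omega>)\<^sup>2)"
  proof (rule AE_I2)
    fix \<omega>
    have "2 * \<bar>f \<omega> * g \<omega>\<bar> \<le> (f \<omega>)\<^sup>2 + (g \<omega>)\<^sup>2"
      using sum_squares_bound[of "\<bar>f \<omega>\<bar>" "\<bar>g \<omega>\<bar>"] by (simp add: abs_mult)
    moreover have "0 \<le> (f \<omega>)\<^sup>2 + (g \<omega>)\<^sup>2" by simp
    ultimately show "norm (f \<omega> * g \<omega>) \<le> norm ((f \<omega>)\<^sup>2 + (g \<omega>)\<^sup>2)"
      unfolding real_norm_def by linarith
  qed
qed

lemma square_integrable_scale:
  "square_integrable M f \<Longrightarrow> square_integrable M (\<lambda>\<omega>. k * f \<omega>)"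
  by (auto simp: square_integrable_def power_mult_distrib)

lemma square_integrable_add:
  assumes "square_integrable M f" "square_integrable M g"
  shows "square_integrable M (\<lambda>\<omega>. f \<omega> + g \<omega>)"
proof -
  have "integrable M (\<lambda>\<omega>. (f \<omega>)\<^sup>2 + (g \<omega>)\<^sup>2 + 2 * (f \<omega> * g \<omega>))"
    using assms square_integrable_mult[OF assms] by (auto simp: square_integrable_def)
  then show ?thesis using assms by (auto simp: square_integrable_def power2_sum mult.assoc)
qed

lemma square_integrable_sum:
  "finite I \<Longrightarrow> (\<And>i. i \<in> I \<Longrightarrow> square_integrable M (f i)) \<Longrightarrow>
   square_integrable M (\<lambda>\<omega>. \<Sum>i\<in>I. k i * f i \<omega>)"
proof (induction I rule: finite_induct)
  case empty
  then show ?case by (simp add: square_integrable_def)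
next
  case (insert i I)
  then show ?case by (simp add: square_integrable_add square_integrable_scale)
qed

lemma square_integrable_cong_AE:
  assumes "square_integrable M f" "g \<in> borel_measurable M" "AE \<omega> in M. g \<omega> = f \<omega>"
  shows "square_integrable M g"
proof -
  have "integrable M (\<lambda>\<omega>. (g \<omega>)\<^sup>2) \<longleftrightarrow> integrable M (\<lambda>\<omega>. (f \<omega>)\<^sup>2)"
    using assms by (intro integrable_cong_AE) (auto simp: square_integrable_def)
  then show ?thesis using assms by (simp add: square_integrable_def)
qed

context prob_space
begin

lemma square_integrable_integrable: "square_integrable M f \<Longrightarrow> integrable M f"
  using square_integrable_imp_integrable by (auto simp: square_integrable_def)

lemma cov_eq:
  assumes "square_integrable M f" "square_integrable M g"
  shows "cov M f g = expectation (\<lambda>\<omega>. f \<omega> * g \<omega>) - expectation f * expectation g"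
proof -
  note int = square_integrable_integrable[OF assms(1)] square_integrable_integrable[OF assms(2)]
    square_integrable_mult[OF assms]
  let ?a = "expectation f" let ?b = "expectation g"
  have "cov M f g = expectation (\<lambda>\<omega>. f \<omega> * g \<omega> - ?b * f \<omega> - ?a * g \<omega> + ?a * ?b)"
    unfolding cov_def by (simp add: algebra_simps)
  also have "\<dots> = expectation (\<lambda>\<omega>. f \<omega> * g \<omega>) - ?b * ?a - ?a * ?b + ?a * ?b"
    using int by (simp add: prob_space)
  finally show ?thesis by simp
qed

lemma cov_sum_left:
  assumes "finite I" "\<And>i. i \<in> I \<Longrightarrow> square_integrable M (f i)" "square_integrable M g"
  shows "cov M (\<lambda>\<omega>. \<Sum>i\<in>I. k i * f i \<omega>) g = (\<Sum>i\<in>I. k i * cov M (f i) g)"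
proof -
  have int: "integrable M (f i)" "integrable M (\<lambda>\<omega>. f i \<omega> * g \<omega>)" if "i \<in> I" for i
    using that assms square_integrable_integrable square_integrable_mult by blast+
  have "cov M (\<lambda>\<omega>. \<Sum>i\<in>I. k i * f i \<omega>) g =
      expectation (\<lambda>\<omega>. \<Sum>i\<in>I. k i * (f i \<omega> * g \<omega>)) -
      expectation (\<lambda>\<omega>. \<Sum>i\<in>I. k i * f i \<omega>) * expectation g"
    using assms by (simp add: cov_eq square_integrable_sum sum_distrib_right mult.assoc)
  also have "expectation (\<lambda>\<omega>. \<Sum>i\<in>I. k i * (f i \<omega> * g \<omega>)) =
      (\<Sum>i\<in>I. k i * expectation (\<lambda>\<omega>. f i \<omega> * g \<omega>))"
    using int by (simp add: Bochner_Integration.integral_sum)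
  also have "expectation (\<lambda>\<omega>. \<Sum>i\<in>I. k i * f i \<omega>) = (\<Sum>i\<in>I. k i * expectation (f i))"
    using int by (simp add: Bochner_Integration.integral_sum)
  also have "(\<Sum>i\<in>I. k i * expectation (\<lambda>\<omega>. f i \<omega> * g \<omega>)) -
      (\<Sum>i\<in>I. k i * expectation (f i)) * expectation g =
      (\<Sum>i\<in>I. k i * (expectation (\<lambda>\<omega>. f i \<omega> * g \<omega>) - expectation (f i) * expectation g))"
    by (simp add: right_diff_distrib sum_subtractf sum_distrib_right mult.assoc)
  also have "\<dots> = (\<Sum>i\<in>I. k i * cov M (f i) g)"
    using assms by (intro sum.cong refl) (simp add: cov_eq)
  finally show ?thesis .
qed

lemma cov_sum_sum:
  assumes "finite I" "\<And>i. i \<in> I \<Longrightarrow> square_integrable M (f i)"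
    and "finite J" "\<And>j. j \<in> J \<Longrightarrow> square_integrable M (g j)"
  shows "cov M (\<lambda>\<omega>. \<Sum>i\<in>I. a i * f i \<omega>) (\<lambda>\<omega>. \<Sum>j\<in>J. b j * g j \<omega>) =
    (\<Sum>i\<in>I. \<Sum>j\<in>J. a i * b j * cov M (f i) (g j))"
proof -
  have "cov M (f i) (\<lambda>\<omega>. \<Sum>j\<in>J. b j * g j \<omega>) = (\<Sum>j\<in>J. b j * cov M (f i) (g j))" if "i \<in> I" for i
    using assms that by (subst cov_sym) (simp add: cov_sum_left cov_sym[of M "f i"])
  then show ?thesis
    using assms by (simp add: cov_sum_left square_integrable_sum sum_distrib_left mult.assoc)
qed

end

lemma normal_square_integrable:
  assumes "distributed M lborel f (normal_density \<mu> s)" "s > 0" "f \<in> borel_measurable M" "prob_space M"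
  shows "square_integrable M f"
proof -
  interpret prob_space M by fact
  have "integrable M (\<lambda>\<omega>. (f \<omega> - \<mu>) ^ k)" for k
    using distributed_integrable[OF assms(1), of "\<lambda>x. (x - \<mu>) ^ k"]
      integrable_normal_moment[of s \<mu> k] assms(2) by simp
  from this[of 2] have "square_integrable M (\<lambda>\<omega>. f \<omega> - \<mu>)"
    using assms(3) by (simp add: square_integrable_def)
  moreover have "square_integrable M (\<lambda>\<omega>. \<mu>)" by (simp add: square_integrable_def)
  ultimately have "square_integrable M (\<lambda>\<omega>. (f \<omega> - \<mu>) + \<mu>)" by (rule square_integrable_add)
  then show ?thesis by simp
qed

lemma jointly_gaussian_square_integrable:
  assumes "jointly_gaussian M V \<epsilon>" "prob_space M" "finite V" "v \<in> V"
  shows "square_integrable M (\<epsilon> v)"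
proof -
  interpret prob_space M by fact
  have m: "\<epsilon> v \<in> borel_measurable M" using assms by (simp add: jointly_gaussian_def)
  have s: "(\<lambda>\<omega>. \<Sum>w\<in>V. coord v w * \<epsilon> w \<omega>) = \<epsilon> v"
  proof
    fix \<omega>
    have "(\<Sum>w\<in>V. coord v w * \<epsilon> w \<omega>) = (\<Sum>w\<in>V. if w = v then \<epsilon> w \<omega> else 0)"
      by (rule sum.cong) (auto simp: coord_def)
    then show "(\<Sum>w\<in>V. coord v w * \<epsilon> w \<omega>) = \<epsilon> v \<omega>" using assms by simp
  qed
  have "(\<exists>\<mu>. AE \<omega> in M. (\<Sum>w\<in>V. coord v w * \<epsilon> w \<omega>) = \<mu>) \<or>
        (\<exists>\<mu> \<sigma>. \<sigma> > 0 \<and> distributed M lborel (\<lambda>\<omega>. \<Sum>w\<in>V. coord v w * \<epsilon> w \<omega>) (normal_density \<mu> \<sigma>))"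
    using assms(1) unfolding jointly_gaussian_def by blast
  moreover have "square_integrable M (\<epsilon> v)" if "AE \<omega> in M. \<epsilon> v \<omega> = \<mu>" for \<mu>
    using square_integrable_cong_AE[of M "\<lambda>_. \<mu>" "\<epsilon> v"] m that by (simp add: square_integrable_def)
  ultimately show ?thesis using normal_square_integrable[OF _ _ m assms(2)]
    unfolding s s[THEN fun_cong] by blast
qed

text \<open>
  The coefficients of \<open>d\<close> minus its regression on its parents, the combination that equals the error of \<open>d\<close>.
\<close>

definition equation :: "('v, 'a) path_diagram \<Rightarrow> 'v \<Rightarrow> 'v \<Rightarrow> real" where
  "equation D d w = coord d w - (if (w, d) \<in> directed D then coef D w d else 0)"

locale sem =
  fixes M :: "'a measure" and D :: "('v, 'a) path_diagram"
  assumes diagram: "path_diagram M D"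
begin

abbreviation "V \<equiv> nodes D"

sublocale prob_space M using diagram by (simp add: path_diagram_def)

lemma finite_nodes: "finite V" and edges_in_nodes: "directed D \<subseteq> V \<times> V" "bidirected D \<subseteq> V \<times> V"
  and sym_bidirected: "sym (bidirected D)"
  using diagram by (auto simp: path_diagram_def mixed_graph_def)

lemma err_square_integrable: "v \<in> V \<Longrightarrow> square_integrable M (err D v)"
  using jointly_gaussian_square_integrable[OF _ prob_space_axioms finite_nodes] diagram
  by (simp add: path_diagram_def)

lemma rv_measurable: "v \<in> V \<Longrightarrow> rv D v \<in> borel_measurable M"
  using diagram by (simp add: path_diagram_def)

text \<open>
  Superposing the solutions for the unit errors solves the system for arbitrary errors, and solutions are
  unique.
\<close>

lemma solution_linear:
  "\<exists>g. \<forall>e x. sem_solution D e x \<longrightarrow> (\<forall>v\<in>V. x v = (\<Sum>d\<in>V. g d v * e d))"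
proof -
  have ex1: "\<And>e. \<exists>!x. x \<in> extensional V \<and> sem_solution D e x"
    using diagram by (simp add: path_diagram_def)
  then have "\<forall>d. \<exists>x. sem_solution D (coord d) x" by blast
  then obtain g where g: "\<And>d. sem_solution D (coord d) (g d)" by metis
  have "x v = (\<Sum>d\<in>V. g d v * e d)" if x: "sem_solution D e x" and v: "v \<in> V" for e x v
  proof -
    define y where "y w = (\<Sum>d\<in>V. g d w * e d)" for w
    have restrict: "sem_solution D e (restrict z V)" if "sem_solution D e z" for z
      unfolding sem_solution_def
    proof
      fix b assume "b \<in> V"
      moreover have "(\<Sum>a | (a, b) \<in> directed D. coef D a b * restrict z V a) =
          (\<Sum>a | (a, b) \<in> directed D. coef D a b * z a)"
        using edges_in_nodes by (intro sum.cong refl) auto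
      ultimately show "restrict z V b =
          (\<Sum>a | (a, b) \<in> directed D. coef D a b * restrict z V a) + e b"
        using that by (simp add: sem_solution_def)
    qed
    have "sem_solution D e y" unfolding sem_solution_def
    proof
      fix b assume b: "b \<in> V"
      have "(\<Sum>a | (a, b) \<in> directed D. coef D a b * y a) =
          (\<Sum>a | (a, b) \<in> directed D. \<Sum>d\<in>V. coef D a b * g d a * e d)"
        by (simp add: y_def sum_distrib_left mult.assoc)
      also have "\<dots> = (\<Sum>d\<in>V. \<Sum>a | (a, b) \<in> directed D. coef D a b * g d a * e d)"
        by (rule sum.swap)
      also have "\<dots> = (\<Sum>d\<in>V. (\<Sum>a | (a, b) \<in> directed D. coef D a b * g d a) * e d)"
        by (simp add: sum_distrib_right)
      also have "\<dots> = (\<Sum>d\<in>V. (g d b - coord d b) * e d)"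
        using g b by (intro sum.cong refl) (simp add: sem_solution_def)
      also have "\<dots> = y b - (\<Sum>d\<in>V. coord d b * e d)"
        by (simp add: y_def left_diff_distrib sum_subtractf)
      also have "(\<Sum>d\<in>V. coord d b * e d) = (\<Sum>d\<in>V. if d = b then e d else 0)"
        by (rule sum.cong) (auto simp: coord_def)
      also have "\<dots> = e b" using b finite_nodes by simp
      finally show "y b = (\<Sum>a | (a, b) \<in> directed D. coef D a b * y a) + e b" by simp
    qed
    then have sol: "sem_solution D e (restrict y V)" "sem_solution D e (restrict x V)"
      using restrict x by simp_all
    obtain z where z: "\<And>w. w \<in> extensional V \<and> sem_solution D e w \<Longrightarrow> w = z"
      using ex1[of e] by (elim ex1E) blast
    have "restrict y V = z" "restrict x V = z" using z sol by simp_all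
    then have "restrict y V v = restrict x V v" by simp
    then have "y v = x v" using v by simp
    then show ?thesis by (simp add: y_def)
  qed
  then show ?thesis by blast
qed

lemma rv_square_integrable:
  assumes "v \<in> V"
  shows "square_integrable M (rv D v)"
proof -
  obtain g where g: "\<forall>e x. sem_solution D e x \<longrightarrow> (\<forall>v\<in>V. x v = (\<Sum>d\<in>V. g d v * e d))"
    using solution_linear by blast
  have "AE \<omega> in M. sem_solution D (\<lambda>v. err D v \<omega>) (\<lambda>v. rv D v \<omega>)"
    using diagram by (simp add: path_diagram_def)
  then have "AE \<omega> in M. rv D v \<omega> = (\<Sum>d\<in>V. g d v * err D d \<omega>)"
    by eventually_elim (use g assms in blast)
  then show ?thesis
    by (rule square_integrable_cong_AE[OF square_integrable_sum[OF finite_nodes err_square_integrable]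
          rv_measurable[OF assms], rotated])
qed

lemma equation_err:
  assumes "d \<in> V"
  shows "AE \<omega> in M. (\<Sum>w\<in>V. equation D d w * rv D w \<omega>) = err D d \<omega>"
proof -
  have "AE \<omega> in M. sem_solution D (\<lambda>v. err D v \<omega>) (\<lambda>v. rv D v \<omega>)"
    using diagram by (simp add: path_diagram_def)
  then show ?thesis
  proof eventually_elim
    case (elim \<omega>)
    have "(\<Sum>w\<in>V. equation D d w * rv D w \<omega>) =
        (\<Sum>w\<in>V. if w = d then rv D w \<omega> else 0) -
        (\<Sum>w\<in>V. if (w, d) \<in> directed D then coef D w d * rv D w \<omega> else 0)"
      unfolding sum_subtractf[symmetric]
      by (rule sum.cong) (auto simp: equation_def coord_def algebra_simps)
    also have "(\<Sum>w\<in>V. if (w, d) \<in> directed D then coef D w d * rv D w \<omega> else 0) =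
        (\<Sum>w | (w, d) \<in> directed D. coef D w d * rv D w \<omega>)"
      using finite_nodes edges_in_nodes
      by (subst sum.inter_filter[symmetric]) (auto intro!: sum.cong)
    also have "(\<Sum>w\<in>V. if w = d then rv D w \<omega> else 0) = rv D d \<omega>"
      using assms finite_nodes by simp
    finally show ?case using elim assms by (simp add: sem_solution_def)
  qed
qed

sublocale covariance_table V "\<lambda>u v. cov M (rv D u) (rv D v)"
  by unfold_locales (simp_all add: finite_nodes cov_sym)

lemma form_eq_cov:
  "form a b = cov M (\<lambda>\<omega>. \<Sum>v\<in>V. a v * rv D v \<omega>) (\<lambda>\<omega>. \<Sum>v\<in>V. b v * rv D v \<omega>)"
  using cov_sum_sum[OF finite_nodes rv_square_integrable finite_nodes rv_square_integrable]
  by (simp add: form_def)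

lemma form_equation:
  assumes "d \<in> V" "e \<in> V"
  shows "form (equation D d) (equation D e) = cov M (err D d) (err D e)"
proof -
  have m: "square_integrable M (\<lambda>\<omega>. \<Sum>v\<in>V. equation D d v * rv D v \<omega>)" for d
    using square_integrable_sum[OF finite_nodes rv_square_integrable] .
  show ?thesis unfolding form_eq_cov
    using equation_err assms m err_square_integrable
    by (intro cov_cong_AE) (auto simp: square_integrable_def)
qed

text \<open>
  A combination of the equations has the variance of the same combination of the errors, which is
  positive.
\<close>

lemma equation_combination_pos:
  assumes "A \<subseteq> V" "\<exists>d\<in>A. \<gamma> d \<noteq> 0"
  shows "form (\<lambda>w. \<Sum>d\<in>A. \<gamma> d * equation D d w) (\<lambda>w. \<Sum>d\<in>A. \<gamma> d * equation D d w) > 0"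
proof -
  have fin: "finite A" by (rule finite_subset[OF assms(1) finite_nodes])
  define c where "c d = (if d \<in> A then \<gamma> d else 0)" for d
  have "\<exists>d\<in>V. c d \<noteq> 0" using assms by (auto simp: c_def)
  then have "0 < (\<Sum>u\<in>V. \<Sum>v\<in>V. c u * c v * cov M (err D u) (err D v))"
    using diagram by (simp add: path_diagram_def pos_def_cov_def)
  also have "\<dots> = (\<Sum>u\<in>A. \<Sum>v\<in>A. c u * c v * cov M (err D u) (err D v))"
  proof -
    have "(\<Sum>u\<in>V. \<Sum>v\<in>V. c u * c v * cov M (err D u) (err D v)) =
      (\<Sum>u\<in>A. \<Sum>v\<in>V. c u * c v * cov M (err D u) (err D v))"
      using assms finite_nodes by (intro sum.mono_neutral_right) (auto simp: c_def)
    also have "\<dots> = (\<Sum>u\<in>A. \<Sum>v\<in>A. c u * c v * cov M (err D u) (err D v))"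
      using assms finite_nodes by (intro sum.cong refl sum.mono_neutral_right) (auto simp: c_def)
    finally show ?thesis .
  qed
  also have "\<dots> = (\<Sum>u\<in>A. \<Sum>v\<in>A. \<gamma> u * (\<gamma> v * form (equation D u) (equation D v)))"
    using assms by (intro sum.cong refl) (auto simp: c_def form_equation subset_iff)
  also have "\<dots> = form (\<lambda>w. \<Sum>d\<in>A. \<gamma> d * equation D d w) (\<lambda>w. \<Sum>d\<in>A. \<gamma> d * equation D d w)"
    using fin by (simp add: form_sum_left form_sum_right sum_distrib_left)
  finally show ?thesis .
qed

text \<open>
  On a set closed under parents the equations involve only variables of the set, and there are as many of
  them as variables. So the variables of such a set are combinations of its errors, even if the directed
  edges form cycles.
\<close>

lemma equations_span:
  assumes "A \<subseteq> V" "parent_closed D A"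
  shows "\<exists>\<gamma>. \<forall>w\<in>A. r w = (\<Sum>d\<in>A. \<gamma> d * equation D d w)"
proof (rule independent_family_spans)
  show fin: "finite A" by (rule finite_subset[OF assms(1) finite_nodes])
  fix \<gamma> :: "'v \<Rightarrow> real" assume "\<exists>d\<in>A. \<gamma> d \<noteq> 0"
  note pos = equation_combination_pos[OF assms(1) this]
  show "\<exists>w\<in>A. (\<Sum>d\<in>A. \<gamma> d * equation D d w) \<noteq> 0"
  proof (rule ccontr)
    assume "\<not> ?thesis"
    moreover have "(\<Sum>d\<in>A. \<gamma> d * equation D d w) = 0" if "w \<notin> A" for w
      using that assms(2)
      by (intro sum.neutral) (auto simp: equation_def coord_def parent_closed_def)
    ultimately have "(\<lambda>w. \<Sum>d\<in>A. \<gamma> d * equation D d w) = (\<lambda>w. 0)" by blast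
    then show False using pos by (simp add: form_zero_left)
  qed
qed

sublocale pos_def_table V "\<lambda>u v. cov M (rv D u) (rv D v)"
proof unfold_locales
  fix a :: "'v \<Rightarrow> real" assume a: "\<exists>v\<in>V. a v \<noteq> 0"
  have "parent_closed D V" using edges_in_nodes by (auto simp: parent_closed_def)
  then obtain \<gamma> where \<gamma>: "\<forall>w\<in>V. a w = (\<Sum>d\<in>V. \<gamma> d * equation D d w)"
    using equations_span[OF order_refl] by blast
  have "\<exists>d\<in>V. \<gamma> d \<noteq> 0"
  proof (rule ccontr)
    assume "\<not> ?thesis"
    then show False using a \<gamma> by simp
  qed
  from equation_combination_pos[OF _ this] \<gamma> show "form a a > 0"
    using form_cong[of a "\<lambda>w. \<Sum>d\<in>V. \<gamma> d * equation D d w" a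
        "\<lambda>w. \<Sum>d\<in>V. \<gamma> d * equation D d w"] by simp
qed

lemma partial_cov_eq_pcov:
  assumes "C \<subseteq> V" "u \<in> V" "v \<in> V"
  shows "partial_cov M (rv D) u v C = pcov C u v"
proof -
  define r where "r u \<beta> x = coord u x - (if x \<in> C then \<beta> x else 0)" for u :: 'v and \<beta> x
  \<comment> \<open>Turn a regression residual into a combination of all variables, to which the form applies.\<close>
  have comb: "(\<lambda>\<omega>. rv D u \<omega> - (\<Sum>z\<in>C. \<beta> z * rv D z \<omega>)) = (\<lambda>\<omega>. \<Sum>w\<in>V. r u \<beta> w * rv D w \<omega>)"
    if "u \<in> V" for u \<beta>
  proof
    fix \<omega>
    have "(\<Sum>w\<in>V. r u \<beta> w * rv D w \<omega>) = (\<Sum>w\<in>V. if w = u then rv D w \<omega> else 0) -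
        (\<Sum>w\<in>V. if w \<in> C then \<beta> w * rv D w \<omega> else 0)"
      unfolding sum_subtractf[symmetric]
      by (rule sum.cong) (auto simp: r_def coord_def algebra_simps)
    also have "(\<Sum>w\<in>V. if w \<in> C then \<beta> w * rv D w \<omega> else 0) = (\<Sum>z\<in>C. \<beta> z * rv D z \<omega>)"
      using assms(1) finite_nodes by (simp add: sum.inter_restrict[symmetric] Int_absorb1)
    finally show "rv D u \<omega> - (\<Sum>z\<in>C. \<beta> z * rv D z \<omega>) = (\<Sum>w\<in>V. r u \<beta> w * rv D w \<omega>)"
      using that finite_nodes by simp
  qed
  have single: "(\<lambda>\<omega>. \<Sum>v\<in>V. coord w v * rv D v \<omega>) = rv D w" if "w \<in> V" for w
  proof
    fix \<omega>
    have "(\<Sum>v\<in>V. coord w v * rv D v \<omega>) = (\<Sum>v\<in>V. if v = w then rv D v \<omega> else 0)"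
      by (rule sum.cong) (auto simp: coord_def)
    then show "(\<Sum>v\<in>V. coord w v * rv D v \<omega>) = rv D w \<omega>" using that finite_nodes by simp
  qed
  have normal: "(\<forall>w\<in>C. cov M (\<lambda>\<omega>. rv D u \<omega> - (\<Sum>z\<in>C. \<beta> z * rv D z \<omega>)) (rv D w) = 0) \<longleftrightarrow>
      is_residual C u (r u \<beta>)" if u: "u \<in> V" for u \<beta>
  proof -
    have "cov M (\<lambda>\<omega>. rv D u \<omega> - (\<Sum>z\<in>C. \<beta> z * rv D z \<omega>)) (rv D w) = form (r u \<beta>) (coord w)"
      if "w \<in> C" for w
      using that assms(1) single[of w] by (auto simp: form_eq_cov comb[OF u])
    then show ?thesis by (auto simp: is_residual_def r_def)
  qed
  have "residual M (rv D) C u = (\<lambda>\<omega>. \<Sum>w\<in>V. res C u w * rv D w \<omega>)" if u: "u \<in> V" for u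
  proof -
    let ?P = "\<lambda>\<beta>. \<forall>w\<in>C. cov M (\<lambda>\<omega>. rv D u \<omega> - (\<Sum>z\<in>C. \<beta> z * rv D z \<omega>)) (rv D w) = 0"
    have "r u (\<lambda>x. coord u x - res C u x) = res C u"
      using res[OF assms(1), of u] by (auto simp: r_def is_residual_def)
    then have "?P (\<lambda>x. coord u x - res C u x)"
      unfolding normal[OF u] using res[OF assms(1)] by simp
    then have "?P (SOME \<beta>. ?P \<beta>)" by (rule someI[where P = ?P])
    then have "r u (SOME \<beta>. ?P \<beta>) = res C u"
      unfolding normal[OF u] using res_eqI[OF assms(1)] by metis
    then show ?thesis unfolding residual_def Let_def comb[OF u] by simp
  qed
  then show ?thesis using assms by (simp add: partial_cov_def pcov_def form_eq_cov)
qed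

end

section \<open>The global Markov property\<close>

text \<open>
  It suffices that the colliders are ancestors of \<open>u\<close>, \<open>v\<close> or \<open>C\<close>. A collider \<open>b\<close> that is not an ancestor of \<open>C\<close>
  can be bypassed: if \<open>b\<close> is an ancestor of \<open>u\<close>, start afresh against the arrows from \<open>u\<close> to \<open>b\<close>, and if
  it is an ancestor of \<open>v\<close>, go straight to \<open>v\<close>. No node on such a directed path is in \<open>C\<close>. The last step is
  preserved so that the induction knows whether the walk arrives with an arrowhead.
\<close>

lemma ancestral_colliders_reduce:
  assumes "sym (bidirected G)" "walk G u ss r" "ss \<noteq> []"
    and "unblocked (anc G (insert u (insert v C))) C ss"
  shows "(\<exists>ts. ts \<noteq> [] \<and> walk G u ts v \<and> unblocked (anc G C) C ts) \<or>
    (\<exists>ts. ts \<noteq> [] \<and> walk G u ts r \<and> unblocked (anc G C) C ts \<and> last ts = last ss)"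
  using assms(2-)
proof (induction ss arbitrary: r rule: rev_induct)
  case (snoc s ss)
  obtain b e where s: "s = (b, e, r)" and b: "walk G u ss b" and e: "is_edge G b e r"
    using snoc(2) unfolding walk_append by (cases s) auto
  show ?case
  proof (cases "ss = []")
    case True
    then show ?thesis using s b e by (intro disjI2 exI[of _ "[s]"]) simp
  next
    case False
    have tb: "target (last ss) = b" by (rule walk_ends(2)[OF b False])
    have ok: "unblocked (anc G (insert u (insert v C))) C ss"
      and j: "if kind (last ss) \<noteq> Backward \<and> e \<noteq> Forward
        then b \<in> anc G (insert u (insert v C)) else b \<notin> C"
      using snoc(4) False unfolding unblocked_append[of _ _ ss] tb s by simp_all
    from snoc.IH[OF b False ok] show ?thesis
    proof (elim disjE exE conjE)
      fix ts assume "ts \<noteq> []" "walk G u ts v" "unblocked (anc G C) C ts"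
      then show ?thesis by blast
    next
      fix ts assume ts: "ts \<noteq> []" "walk G u ts b" "unblocked (anc G C) C ts" "last ts = last ss"
      have step: "walk G b [s] r" using s e by simp
      have extend: "unblocked (anc G C) C (ts @ [s])"
        if "if kind (last ss) \<noteq> Backward \<and> e \<noteq> Forward then b \<in> anc G C else b \<notin> C"
        unfolding unblocked_append[of _ _ ts] ts(4) tb using that ts s by simp
      have walk: "walk G u (ts @ [s]) r" unfolding walk_append using ts(2) step by blast
      show ?thesis
      proof (cases "if kind (last ss) \<noteq> Backward \<and> e \<noteq> Forward then b \<in> anc G C else b \<notin> C")
        case True
        then show ?thesis using extend walk by (intro disjI2 exI[of _ "ts @ [s]"]) simp
      next
        case False
        then have bC: "b \<notin> anc G C" and "b \<in> anc G (insert u (insert v C))"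
          using j by (auto split: if_splits)
        then consider "(b, u) \<in> (directed G)\<^sup>*" | "(b, v) \<in> (directed G)\<^sup>*"
          by (auto simp: anc_def)
        then show ?thesis
        proof cases
          case 1
          obtain ds where ds: "walk G b ds u" "\<And>s. s \<in> set ds \<Longrightarrow> kind s = Forward \<and> fst s \<noteq> u"
            by (rule directed_walk[OF 1]) blast
          have fw: "\<forall>s\<in>set ds. kind s = Forward" using ds(2) by blast
          have "\<forall>s\<in>set ds. target s \<notin> C"
            using forward_walk_nodes(2)[OF ds(1) fw] bC by (auto simp: anc_def)
          then have "unblocked (anc G C) C ds" by (rule unblocked_forward[OF fw])
          then have r: "unblocked (anc G C) C (reversed ds)" using unblocked_reversed[OF ds(1)] by simp
          have w: "walk G u (reversed ds) b" by (rule walk_reversed[OF assms(1) ds(1)])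
          have "b \<notin> C" using bC by (auto simp: anc_def)
          have "unblocked (anc G C) C (reversed ds @ [s])"
          proof (cases "ds = []")
            case True
            then show ?thesis by (simp add: reversed_def)
          next
            case False
            have "kind (last (reversed ds)) = Backward" using fw False by simp
            moreover have "target (last (reversed ds)) = b"
              using walk_ends(2)[OF w] False by simp
            ultimately show ?thesis
              unfolding unblocked_append[of _ _ "reversed ds"] using r \<open>b \<notin> C\<close> by simp
          qed
          moreover have "walk G u (reversed ds @ [s]) r" unfolding walk_append using w step by blast
          ultimately show ?thesis by (intro disjI2 exI[of _ "reversed ds @ [s]"]) simp
        next
          case 2
          obtain ds where ds: "walk G b ds v" "\<And>s. s \<in> set ds \<Longrightarrow> kind s = Forward \<and> fst s \<noteq> v"
            by (rule directed_walk[OF 2]) blast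
          have fw: "\<forall>s\<in>set ds. kind s = Forward" using ds(2) by blast
          have "\<forall>s\<in>set ds. target s \<notin> C"
            using forward_walk_nodes(2)[OF ds(1) fw] bC by (auto simp: anc_def)
          then have r: "unblocked (anc G C) C ds" by (rule unblocked_forward[OF fw])
          have "b \<notin> C" using bC by (auto simp: anc_def)
          moreover have "ds \<noteq> [] \<Longrightarrow> kind (hd ds) = Forward" using fw by simp
          ultimately have "unblocked (anc G C) C (ts @ ds)"
            unfolding unblocked_append[of _ _ ts] ts(4) tb using r ts by auto
          moreover have "walk G u (ts @ ds) v" unfolding walk_append using ts(2) ds(1) by blast
          ultimately show ?thesis using ts(1) by (intro disjI1 exI[of _ "ts @ ds"]) simp
        qed
      qed
    qed
  qed
qed simp

context sem
begin

lemma anc_subset_nodes: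
  assumes "C \<subseteq> V"
  shows "anc D C \<subseteq> V"
proof
  fix a assume "a \<in> anc D C"
  then obtain c where "(a, c) \<in> (directed D)\<^sup>*" "c \<in> V" using assms by (auto simp: anc_def)
  then show "a \<in> V"
    by (induction rule: converse_rtrancl_induct) (use edges_in_nodes in auto)
qed

text \<open>
  Restrict the equations to the ancestors \<open>A\<close> of \<open>u\<close>, \<open>v\<close> and \<open>C\<close>. Let \<open>R\<close> be the set of nodes of \<open>A\<close> outside \<open>C\<close>
  that can be reached from \<open>u\<close> and \<open>Q\<close> the remaining ones, and let \<open>E\<close> consist of the equations of the
  nodes in \<open>R\<close> and of those reached with an arrowhead. By the rule for colliders, the equations in \<open>E\<close>
  involve only \<open>R\<close> and \<open>C\<close>, the others only \<open>Q\<close> and \<open>C\<close>, and no bidirected edge joins the two groups.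
\<close>

lemma global_markov:
  assumes C: "C \<subseteq> V" and u: "u \<in> V - C" and v: "v \<in> V - C" and uv: "u \<noteq> v"
    and sep: "\<And>ss. walk D u ss v \<Longrightarrow> \<not> unblocked (anc D C) C ss"
  shows "pcov C u v = 0"
proof -
  define A where "A = anc D (insert u (insert v C))"
  have A: "A \<subseteq> V" "parent_closed D A" "u \<in> A" "v \<in> A" "C \<subseteq> A"
    unfolding A_def using anc_subset_nodes[of "insert u (insert v C)"] C u v parent_closed_anc
      anc_superset[of "insert u (insert v C)" D] by auto
  define reach where "reach d ss \<longleftrightarrow> ss \<noteq> [] \<and> walk D u ss d \<and> unblocked A C ss" for d ss
  define R where "R = {r \<in> A - C. r = u \<or> (\<exists>ss. reach r ss)}"
  define Q where "Q = A - C - R"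
  define E where "E = {d \<in> A. d \<in> R \<or> (\<exists>ss. reach d ss \<and> kind (last ss) \<noteq> Backward)}"
  have RE: "\<exists>ts. reach f ts \<and> last ts = (d, e, f)" if d: "d \<in> R" and e: "is_edge D d e f" for d e f
  proof (cases "d = u")
    case True
    then show ?thesis using e by (intro exI[of _ "[(d, e, f)]"]) (simp add: reach_def)
  next
    case False
    then obtain ss where ss: "reach d ss" and "d \<in> A" "d \<notin> C" using d by (auto simp: R_def)
    then have "unblocked A C (ss @ [(d, e, f)])"
      using walk_ends(2)[of D u ss d] unfolding unblocked_append[of _ _ ss] reach_def by simp
    then have "reach f (ss @ [(d, e, f)])" using ss e unfolding reach_def walk_append by auto
    then show ?thesis by (intro exI[of _ "ss @ [(d, e, f)]"]) simp
  qed
  have EE: "\<exists>ts. reach f ts \<and> last ts = (d, e, f)"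
    if d: "d \<in> E" and e: "is_edge D d e f" "e \<noteq> Forward" for d e f
  proof (cases "d \<in> R")
    case True
    then show ?thesis using RE e(1) by blast
  next
    case False
    then obtain ss where ss: "reach d ss" "kind (last ss) \<noteq> Backward" "d \<in> A"
      using d by (auto simp: E_def)
    then have "unblocked A C (ss @ [(d, e, f)])"
      using walk_ends(2)[of D u ss d] e(2) unfolding unblocked_append[of _ _ ss] reach_def by simp
    then have "reach f (ss @ [(d, e, f)])" using ss e unfolding reach_def walk_append by auto
    then show ?thesis by (intro exI[of _ "ss @ [(d, e, f)]"]) simp
  qed
  have "u \<in> R" using A u by (simp add: R_def)
  have "v \<notin> R"
  proof
    assume "v \<in> R"
    then obtain ss where ss: "ss \<noteq> []" "walk D u ss v" "unblocked A C ss"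
      using uv by (auto simp: R_def reach_def)
    from ancestral_colliders_reduce[OF sym_bidirected ss(2,1) ss(3)[unfolded A_def]] sep
    show False by blast
  qed
  then have "v \<in> Q" using A v by (simp add: Q_def)
  show ?thesis
  proof (rule factorisation_orthogonality[of A R C Q E "equation D"])
    show "A = R \<union> C \<union> Q" using A by (auto simp: Q_def R_def)
    show "A \<subseteq> V" by fact
    show "R \<inter> Q = {}" "R \<inter> C = {}" "Q \<inter> C = {}" by (auto simp: Q_def R_def)
    show "E \<subseteq> A" by (auto simp: E_def)
    show "u \<in> R" "v \<in> Q" by fact+
    show "\<exists>\<gamma>. \<forall>w\<in>A. r w = (\<Sum>d\<in>A. \<gamma> d * equation D d w)" for r
      by (rule equations_span) fact+
    show "equation D d x = 0" if d: "d \<in> E" and x: "x \<notin> R \<union> C" for d x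
    proof -
      have "x \<noteq> d"
      proof
        assume "x = d"
        then have "d \<notin> C" "d \<notin> R" using x by auto
        moreover obtain ss where "reach d ss" "d \<in> A" using d \<open>d \<notin> R\<close> by (auto simp: E_def)
        ultimately show False by (auto simp: R_def)
      qed
      moreover have "(x, d) \<notin> directed D"
      proof
        assume e: "(x, d) \<in> directed D"
        have "d \<in> A" using d by (simp add: E_def)
        then have "x \<in> A" using e A(2) unfolding parent_closed_def by blast
        obtain ts where "reach x ts" using EE[OF d, of Backward x] e by auto
        then show False using \<open>x \<in> A\<close> x by (auto simp: R_def)
      qed
      ultimately show ?thesis by (simp add: equation_def coord_def)
    qed
    show "equation D d x = 0" if d: "d \<in> A - E" and x: "x \<notin> Q \<union> C" for d x
    proof -
      have "d \<notin> R" using d by (auto simp: E_def)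
      have xR: "x \<in> R" if "x \<in> A" using that x by (auto simp: Q_def)
      then have "x \<noteq> d" using d \<open>d \<notin> R\<close> by auto
      moreover have "(x, d) \<notin> directed D"
      proof
        assume e: "(x, d) \<in> directed D"
        then have "x \<in> A" using d A(2) unfolding parent_closed_def by blast
        then obtain ts where "reach d ts" "last ts = (x, Forward, d)"
          using RE[OF xR, of Forward d] e by auto
        then have "d \<in> E" using d by (auto simp: E_def)
        then show False using d by blast
      qed
      ultimately show ?thesis by (simp add: equation_def coord_def)
    qed
    show "form (equation D d) (equation D e) = 0" if d: "d \<in> E" and e: "e \<in> A - E" for d e
    proof -
      have "(d, e) \<notin> bidirected D"
      proof
        assume b: "(d, e) \<in> bidirected D"
        then obtain ts where "reach e ts" "last ts = (d, Bidirected, e)"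
          using EE[OF d, of Bidirected e] by auto
        then have "e \<in> E" using e by (auto simp: E_def)
        then show False using e by blast
      qed
      moreover have "d \<in> V" "e \<in> V" "d \<noteq> e" using d e A(1) by (auto simp: E_def)
      ultimately have "cov M (err D d) (err D e) = 0"
        using diagram by (simp add: path_diagram_def)
      then show ?thesis using \<open>d \<in> V\<close> \<open>e \<in> V\<close> by (simp add: form_equation)
    qed
  qed
qed

end

section \<open>Open paths in conditioned graphs\<close>

lemma successively_iff_nth:
  "successively P xs \<longleftrightarrow> (\<forall>i. Suc i < length xs \<longrightarrow> P (xs ! i) (xs ! Suc i))"
proof (induction P xs rule: successively.induct)
  case (3 P x y xs)
  show ?case
  proof
    assume "successively P (x # y # xs)"
    then show "\<forall>i. Suc i < length (x # y # xs) \<longrightarrow> P ((x # y # xs) ! i) ((x # y # xs) ! Suc i)"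
      using 3 by (auto simp: nth_Cons split: nat.split)
  next
    assume a: "\<forall>i. Suc i < length (x # y # xs) \<longrightarrow> P ((x # y # xs) ! i) ((x # y # xs) ! Suc i)"
    have "P ((y # xs) ! i) ((y # xs) ! Suc i)" if "Suc i < length (y # xs)" for i
      using a[rule_format, of "Suc i"] that by simp
    moreover have "P x y" using a[rule_format, of 0] by simp
    ultimately show "successively P (x # y # xs)" using 3 by simp
  qed
qed simp_all

definition steps_of :: "'v list \<Rightarrow> edge_type list \<Rightarrow> 'v step list" where
  "steps_of vs es = zip vs (zip es (tl vs))"

lemma steps_of_walk:
  assumes "length vs = Suc (length es)"
    "\<forall>i<length es. is_edge G (vs ! i) (es ! i) (vs ! Suc i)"
  shows "walk G (hd vs) (steps_of vs es) (last vs)" "visited (hd vs) (steps_of vs es) = vs"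
    "map kind (steps_of vs es) = es"
proof -
  have "walk G (hd vs) (steps_of vs es) (last vs) \<and> visited (hd vs) (steps_of vs es) = vs \<and>
    map kind (steps_of vs es) = es"
    using assms
  proof (induction es arbitrary: vs)
    case Nil
    then obtain a where "vs = [a]" by (cases vs) auto
    then show ?case by (simp add: steps_of_def visited_def)
  next
    case (Cons e es)
    then obtain a b vs' where vs: "vs = a # b # vs'" by (cases vs; cases "tl vs") auto
    have "walk G (hd (b # vs')) (steps_of (b # vs') es) (last (b # vs')) \<and>
      visited (hd (b # vs')) (steps_of (b # vs') es) = b # vs' \<and>
      map kind (steps_of (b # vs') es) = es"
      using Cons.prems unfolding vs by (intro Cons.IH) (auto simp: All_less_Suc2)
    moreover have "is_edge G a e b" using Cons.prems unfolding vs by (auto simp: All_less_Suc2)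
    ultimately show ?case unfolding vs by (simp add: steps_of_def visited_def)
  qed
  then show "walk G (hd vs) (steps_of vs es) (last vs)" "visited (hd vs) (steps_of vs es) = vs"
    "map kind (steps_of vs es) = es" by simp_all
qed

lemma walk_edges:
  assumes "walk G u ss v"
  shows "\<forall>i<length ss. is_edge G (visited u ss ! i) (map kind ss ! i) (visited u ss ! Suc i)"
  using assms by (induction G u ss v rule: walk.induct) (auto simp: visited_def All_less_Suc2)

lemma is_edge_nodes: "mixed_graph G \<Longrightarrow> is_edge G a e b \<Longrightarrow> a \<in> nodes G \<and> b \<in> nodes G"
  by (cases e) (auto simp: mixed_graph_def)

lemma walk_is_route:
  assumes "mixed_graph G" "walk G u ss v" "ss \<noteq> []"
  shows "is_route G (visited u ss) (map kind ss)"
proof -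
  have "set (visited u ss) \<subseteq> nodes G"
    using assms(2,3)
  proof (induction G\<equiv>G u ss v rule: walk.induct)
    case (2 u a e b ss v)
    then have "u \<in> nodes G" "b \<in> nodes G" using is_edge_nodes[OF assms(1)] by auto
    then show ?case using 2 by (cases "ss = []") (auto simp: visited_def)
  qed simp
  then show ?thesis using assms walk_edges[OF assms(2)] by (simp add: is_route_def visited_def)
qed

text \<open>
  The two end nodes are never colliders, which explains their separate treatment.
\<close>

lemma openness_iff:
  assumes "walk G u ss v" "ss \<noteq> []"
  shows "(\<forall>i<length (visited u ss). if collider_at (map kind ss) i then visited u ss ! i \<in> A
      else visited u ss ! i \<notin> Z) \<longleftrightarrow> u \<notin> Z \<and> v \<notin> Z \<and> unblocked A Z ss"
    (is "(\<forall>i<_. ?P i) \<longleftrightarrow> _")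
proof -
  let ?Q = "\<lambda>i. if kind (ss ! i) \<noteq> Backward \<and> kind (ss ! Suc i) \<noteq> Forward
    then target (ss ! i) \<in> A else target (ss ! i) \<notin> Z"
  have v: "visited u ss ! length ss = v"
    using last_visited[OF assms(1)] last_conv_nth[of "visited u ss"] by (simp add: visited_def)
  have 0: "?P 0 \<longleftrightarrow> u \<notin> Z" by (simp add: collider_at_def visited_def)
  have l: "?P (length ss) \<longleftrightarrow> v \<notin> Z" using v by (simp add: collider_at_def)
  have S: "?P (Suc i) \<longleftrightarrow> ?Q i" if "Suc i < length ss" for i
    using that by (simp add: collider_at_def visited_def edge_type_not_Backward edge_type_not_Forward)
  have ub: "unblocked A Z ss \<longleftrightarrow> (\<forall>i. Suc i < length ss \<longrightarrow> ?Q i)"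
    by (simp add: unblocked_def successively_iff_nth)
  have len: "length (visited u ss) = Suc (length ss)" by (simp add: visited_def)
  show ?thesis
  proof
    assume a: "\<forall>i<length (visited u ss). ?P i"
    have "?Q i" if "Suc i < length ss" for i
      using a[rule_format, of "Suc i"] that len unfolding S[OF that] by simp
    then show "u \<notin> Z \<and> v \<notin> Z \<and> unblocked A Z ss"
      using a[rule_format, of 0] a[rule_format, of "length ss"] len 0 l ub by simp
  next
    assume a: "u \<notin> Z \<and> v \<notin> Z \<and> unblocked A Z ss"
    show "\<forall>i<length (visited u ss). ?P i"
    proof (intro allI impI)
      fix i assume i: "i < length (visited u ss)"
      show "?P i"
      proof (cases i)
        case 0
        then show ?thesis using \<open>?P 0 \<longleftrightarrow> u \<notin> Z\<close> a by simp
      next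
        case (Suc j)
        show ?thesis
        proof (cases "i = length ss")
          case True
          then show ?thesis using l a by simp
        next
          case False
          then have "Suc j < length ss" using i len Suc by simp
          then have "?Q j" using a ub by blast
          then show ?thesis unfolding Suc S[OF \<open>Suc j < length ss\<close>] .
        qed
      qed
    qed
  qed
qed

text \<open>
  The open paths, in the representation as lists of steps.
\<close>

definition open_walks :: "('v, 'z) mixed_graph_scheme \<Rightarrow> 'v set \<Rightarrow> 'v \<Rightarrow> 'v \<Rightarrow> 'v step list set" where
  "open_walks G Z u v = {ss. ss \<noteq> [] \<and> walk G u ss v \<and> distinct (visited u ss) \<and>
     u \<notin> Z \<and> v \<notin> Z \<and> unblocked (anc G Z) Z ss}"

lemma open_paths_eq:
  assumes "mixed_graph G"
  shows "open_paths G Z u v = (\<lambda>ss. (visited u ss, map kind ss)) ` open_walks G Z u v"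
proof (intro set_eqI iffI)
  fix q assume q: "q \<in> open_paths G Z u v"
  obtain vs es where [simp]: "q = (vs, es)" by (cases q)
  have op: "open_path G Z vs es" and ends: "hd vs = u" "last vs = v"
    using q by (auto simp: open_paths_def)
  then have r: "length vs = Suc (length es)" "es \<noteq> []" "distinct vs"
    "\<forall>i<length es. is_edge G (vs ! i) (es ! i) (vs ! Suc i)"
    by (auto simp: open_path_def is_path_def is_route_def)
  let ?ss = "steps_of vs es"
  note s = steps_of_walk[OF r(1,4), unfolded ends]
  have ne: "?ss \<noteq> []" using s(3) r(2) by auto
  have "(\<forall>i<length (visited u ?ss). if collider_at (map kind ?ss) i
      then visited u ?ss ! i \<in> anc G Z else visited u ?ss ! i \<notin> Z)"
    using op unfolding s open_path_def by (simp add: anc_def)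
  then have "?ss \<in> open_walks G Z u v"
    unfolding openness_iff[OF s(1) ne] using s ne r(3) by (simp add: open_walks_def)
  then show "q \<in> (\<lambda>ss. (visited u ss, map kind ss)) ` open_walks G Z u v"
    using s(2,3) by (intro image_eqI[of _ _ ?ss]) simp_all
next
  fix q assume "q \<in> (\<lambda>ss. (visited u ss, map kind ss)) ` open_walks G Z u v"
  then obtain ss where ss: "q = (visited u ss, map kind ss)" "ss \<noteq> []" "walk G u ss v"
    "distinct (visited u ss)" "u \<notin> Z" "v \<notin> Z" "unblocked (anc G Z) Z ss"
    by (auto simp: open_walks_def)
  have "\<forall>i<length (visited u ss). if collider_at (map kind ss) i
      then visited u ss ! i \<in> anc G Z else visited u ss ! i \<notin> Z"
    unfolding openness_iff[OF ss(3,2)] using ss by simp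
  then have "\<forall>i<length (visited u ss). if collider_at (map kind ss) i
      then \<exists>z\<in>Z. (visited u ss ! i, z) \<in> (directed G)\<^sup>* else visited u ss ! i \<notin> Z"
    by (simp only: anc_def mem_Collect_eq)
  then have "open_path G Z (visited u ss) (map kind ss)"
    using walk_is_route[OF assms ss(3,2)] ss(4) by (simp only: open_path_def is_path_def simp_thms)
  then show "q \<in> open_paths G Z u v"
    using last_visited[OF ss(3)] ss(1) by (simp add: open_paths_def visited_def)
qed

lemma open_walks_reversed:
  assumes "sym (bidirected G)" "p \<in> open_walks G Z u v"
  shows "reversed p \<in> open_walks G Z v u"
  using assms(2) walk_reversed[OF assms(1), of u p v] visited_reversed[of G u p v]
    unblocked_reversed[of G u p v]
  by (simp add: open_walks_def)

lemma open_walk_exists: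
  assumes "walk G u ss v" "unblocked (anc G C) C ss" "u \<noteq> v" "u \<notin> C" "v \<notin> C"
  shows "\<exists>p\<in>open_walks G C u v. set p \<subseteq> set ss"
proof -
  obtain p where p: "walk G u p v" "unblocked (anc G C) C p" "distinct (visited u p)" "set p \<subseteq> set ss"
    by (rule walk_to_path[OF assms(1,2) parent_closed_anc])
  then have "p \<noteq> []" using assms(3) by auto
  then show ?thesis using p assms by (intro bexI[of _ p]) (simp_all add: open_walks_def)
qed

lemma first_blocked_junction:
  assumes "unblocked A B ss" "\<not> unblocked A' B' ss"
  obtains ps s s' qs where "ss = ps @ s # s' # qs" "unblocked A' B' (ps @ [s])"
    "\<not> (if kind s \<noteq> Backward \<and> kind s' \<noteq> Forward then target s \<in> A' else target s \<notin> B')"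
proof -
  have "\<exists>ps s s' qs. ss = ps @ s # s' # qs \<and> unblocked A' B' (ps @ [s]) \<and>
    \<not> (if kind s \<noteq> Backward \<and> kind s' \<noteq> Forward then target s \<in> A' else target s \<notin> B')"
    using assms
  proof (induction ss rule: rev_induct)
    case (snoc x ss)
    have ss: "unblocked A B ss" using snoc(2) by (simp add: unblocked_append)
    show ?case
    proof (cases "unblocked A' B' ss")
      case False
      then obtain ps s s' qs where "ss = ps @ s # s' # qs \<and> unblocked A' B' (ps @ [s]) \<and>
        \<not> (if kind s \<noteq> Backward \<and> kind s' \<noteq> Forward then target s \<in> A' else target s \<notin> B')"
        using snoc.IH ss by blast
      then show ?thesis by (intro exI[of _ ps] exI[of _ s] exI[of _ s'] exI[of _ "qs @ [x]"]) simp
    next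
      case True
      then have ne: "ss \<noteq> []" using snoc(3) by auto
      then have "ss = butlast ss @ [last ss]" by simp
      then show ?thesis using snoc(3) True ne unfolding unblocked_append[of _ _ ss]
        by (intro exI[of _ "butlast ss"] exI[of _ "last ss"] exI[of _ x] exI[of _ "[]"]) auto
    qed
  qed simp
  then show ?thesis using that by blast
qed

lemma directed_walk_into:
  assumes "b \<in> anc G Z"
  shows "\<exists>ds z. z \<in> Z \<and> walk G b ds z \<and> (\<forall>s\<in>set ds. kind s = Forward \<and> fst s \<notin> Z)"
proof -
  obtain z where z: "z \<in> Z" "(b, z) \<in> (directed G)\<^sup>*" using assms by (auto simp: anc_def)
  from z(2) show ?thesis
  proof (induction rule: converse_rtrancl_induct)
    case base
    then show ?case using z(1) by (intro exI[of _ "[]"] exI[of _ z]) simp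
  next
    case (step c d)
    then obtain ds z' where ds: "z' \<in> Z" "walk G d ds z'" "\<forall>s\<in>set ds. kind s = Forward \<and> fst s \<notin> Z"
      by blast
    show ?case
    proof (cases "c \<in> Z")
      case True
      then show ?thesis by (intro exI[of _ "[]"] exI[of _ c]) simp
    next
      case False
      then show ?thesis using ds step(1) by (intro exI[of _ "(c, Forward, d) # ds"] exI[of _ z']) simp
    qed
  qed
qed

text \<open>
  A collider that is only an ancestor of \<open>Z\<close> is replaced by the way down to the first node of \<open>Z\<close> and back. In a
  route, where nodes may repeat, this node is then a collider in \<open>Z\<close>.
\<close>

lemma detour_colliders:
  assumes "sym (bidirected G)" "walk G u ss v" "ss \<noteq> []" "unblocked (anc G Z) Z ss"
  shows "\<exists>ts. ts \<noteq> [] \<and> walk G u ts v \<and> unblocked Z Z ts \<and> hd ts = hd ss \<and> last ts = last ss"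
  using assms(2-)
proof (induction ss arbitrary: u)
  case (Cons s ss)
  obtain e b where s: "s = (u, e, b)" and e: "is_edge G u e b" and w: "walk G b ss v"
    using Cons(2) by (cases s) auto
  show ?case
  proof (cases "ss = []")
    case True
    then show ?thesis using Cons(2) by (intro exI[of _ "[s]"]) simp
  next
    case False
    have ok: "unblocked (anc G Z) Z ss"
      and j: "if e \<noteq> Backward \<and> kind (hd ss) \<noteq> Forward then b \<in> anc G Z else b \<notin> Z"
      using Cons(4) False unfolding unblocked_Cons s by auto
    obtain ts where ts: "ts \<noteq> []" "walk G b ts v" "unblocked Z Z ts" "hd ts = hd ss" "last ts = last ss"
      using Cons.IH[OF w False ok] by blast
    show ?thesis
    proof (cases "if e \<noteq> Backward \<and> kind (hd ss) \<noteq> Forward then b \<in> Z else b \<notin> Z")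
      case True
      then have "unblocked Z Z (s # ts)" unfolding unblocked_Cons using ts s by simp
      moreover have "walk G u (s # ts) v" using s e ts(2) by simp
      ultimately show ?thesis using False ts by (intro exI[of _ "s # ts"]) simp
    next
      case notZ: False
      then have b: "b \<in> anc G Z" "b \<notin> Z" "e \<noteq> Backward" "kind (hd ss) \<noteq> Forward"
        using j by (auto split: if_splits)
      obtain ds z where ds: "z \<in> Z" "walk G b ds z" "\<forall>s\<in>set ds. kind s = Forward \<and> fst s \<notin> Z"
        using directed_walk_into[OF b(1)] by blast
      have ne: "ds \<noteq> []" using ds b(2) by auto
      have d: "unblocked Z Z ds"
        using ds(2,3)
      proof (induction G\<equiv>G b ds z rule: walk.induct)
        case (2 u a e b ss v)
        show ?case
        proof (cases "ss = []")
          case False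
          then have "fst (hd ss) = b" using walk_ends(1)[of G b ss v] 2(2) by simp
          then have "b \<notin> Z" using 2(3) False by (metis hd_in_set list.set_intros(2))
          moreover have "kind (hd ss) = Forward" using 2(3) False by simp
          ultimately show ?thesis using 2 unfolding unblocked_Cons by simp
        qed simp
      qed simp
      have d': "unblocked Z Z (reversed ds)" using unblocked_reversed[OF ds(2)] d by simp
      have kinds: "kind (hd ds) = Forward" "kind (last ds) = Forward" "fst (hd ds) = b"
        "target (last ds) = z"
        using ds ne walk_ends[OF ds(2) ne] by simp_all
      have "unblocked Z Z (reversed ds @ ts)"
        unfolding unblocked_append[of _ _ "reversed ds"] using d' ts ne kinds b by simp
      then have "unblocked Z Z (ds @ reversed ds @ ts)"
        unfolding unblocked_append[of _ _ ds] using d ne kinds ds(1) by simp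
      then have "unblocked Z Z (s # ds @ reversed ds @ ts)"
        unfolding unblocked_Cons s using ne kinds b by simp
      moreover have "walk G u (s # ds @ reversed ds @ ts) v"
        using s e ds(2) walk_reversed[OF assms(1) ds(2)] ts(2) by (auto simp: walk_append)
      ultimately show ?thesis using False ts by (intro exI[of _ "s # ds @ reversed ds @ ts"]) simp
    qed
  qed
qed simp

lemma distinct_targets:
  assumes "distinct (visited u p)" "(a, e, b) \<in> set p"
  shows "b \<noteq> u" "(a', e', b) \<in> set p \<Longrightarrow> a' = a \<and> e' = e"
proof -
  have d: "distinct (map target p)" "u \<notin> set (map target p)" using assms(1) by (simp_all add: visited_def)
  show "b \<noteq> u" using d(2) assms(2) by force
  assume "(a', e', b) \<in> set p"
  then have "(a', e', b) = (a, e, b)"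
    using d(1) assms(2) inj_onD[of target "set p" "(a', e', b)" "(a, e, b)"]
    by (simp add: distinct_map)
  then show "a' = a \<and> e' = e" by simp
qed

text \<open>
  What conditioning means for the graphical arguments: a node of \<open>Z\<close> is childless, or
  its child is its only neighbour.
\<close>

locale conditioned_graph =
  fixes G :: "('v, 'z) mixed_graph_scheme" and Z :: "'v set"
  assumes mixed: "mixed_graph G"
    and sink_or_pendant: "z \<in> Z \<Longrightarrow> (\<forall>b. (z, b) \<notin> directed G) \<or>
      ((\<forall>a. (a, z) \<notin> directed G \<and> (a, z) \<notin> bidirected G) \<and>
       (\<exists>b. \<forall>c. (z, c) \<in> directed G \<longrightarrow> c = b))"
begin

lemma sym_edges: "sym (bidirected G)"
  using mixed by (simp add: mixed_graph_def)

lemma no_proper_children: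
  assumes "z \<in> Z" "(a, z) \<in> directed G"
  shows "(z, b) \<notin> directed G"
  using sink_or_pendant[OF assms(1)] assms(2) by blast

text \<open>
  If a node of \<open>Z\<close> is passed as a non-collider, it has a child. So it is a new node, and the walk turns back at
  it.
\<close>

lemma pendant:
  assumes "z \<in> Z" "is_edge G a e z" "is_edge G z f c" "\<not> (e \<noteq> Backward \<and> f \<noteq> Forward)"
  shows "e = Backward \<and> f = Forward \<and> a = c"
proof -
  have "\<exists>b. (z, b) \<in> directed G" using assms(2-4) by auto
  then have p: "\<And>a. (a, z) \<notin> directed G \<and> (a, z) \<notin> bidirected G"
    "\<exists>b. \<forall>c. (z, c) \<in> directed G \<longrightarrow> c = b"
    using sink_or_pendant[OF assms(1)] by blast+
  have e: "e = Backward" using assms(2) p(1) by (cases e) auto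
  have f: "f = Forward" using assms(3) p(1) sym_edges by (cases f) (auto dest: symD)
  show ?thesis using e f assms(2,3) p(2) by auto
qed

lemma path_avoids_Z:
  assumes "walk G u ss v" "distinct (visited u ss)" "unblocked A {} ss"
  shows "unblocked A Z ss"
  using assms
proof (induction G\<equiv>G u ss v rule: walk.induct)
  case (2 u a e b ss v)
  have IH: "unblocked A Z ss" using 2 by (simp add: visited_def unblocked_Cons)
  show ?case
  proof (cases ss)
    case (Cons s ts)
    then obtain f c where s: "s = (b, f, c)" using 2(2) by (cases s) auto
    have "a \<noteq> c" using 2(2,3) Cons s by (auto simp: visited_def)
    then have "\<not> (e \<noteq> Backward \<and> f \<noteq> Forward) \<Longrightarrow> b \<notin> Z"
      using pendant[of b a e f c] 2(2) Cons s by auto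
    then show ?thesis using IH 2(4) unfolding unblocked_Cons[of _ _ "(a, e, b)"] Cons s by auto
  qed simp
qed simp

text \<open>
  This frees later arguments from checking non-colliders: only the colliders of a walk matter.
\<close>

lemma open_walk_from_walk:
  assumes "walk G u ss v" "unblocked (anc G Z) {} ss" "u \<noteq> v" "u \<notin> Z" "v \<notin> Z"
  shows "\<exists>p\<in>open_walks G Z u v. set p \<subseteq> set ss"
proof -
  obtain p where p: "walk G u p v" "unblocked (anc G Z) {} p" "distinct (visited u p)" "set p \<subseteq> set ss"
    by (rule walk_to_path[OF assms(1,2) parent_closed_anc])
  then have "p \<noteq> []" using assms(3) by auto
  then show ?thesis using p path_avoids_Z[OF p(1,3,2)] assms
    by (intro bexI[of _ p]) (simp_all add: open_walks_def)
qed

text \<open>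
  The hypothesis of the theorem that excludes open routes from a node to itself, together with the fact that the
  node is not conditioned on.
\<close>

definition no_return :: "'v \<Rightarrow> bool" where
  "no_return t \<longleftrightarrow> t \<notin> Z \<and> \<not> (\<exists>vs es. open_route G Z vs es \<and> hd vs = t \<and> last vs = t \<and>
     hd es = Forward \<and> last es \<in> {Forward, Bidirected})"

text \<open>
  Excursions to a new node and back are cut out. Such an excursion leaves its starting node through
  an arrowhead at that node, which therefore was a collider already if it becomes one. The last premise excludes that
  the walk ends with the second half of an excursion, whose removal would change the last edge.
\<close>

lemma remove_pendants:
  assumes "walk G t ss t" "ss \<noteq> []" "kind (hd ss) = Forward" "unblocked (anc G Z) {} ss"
    "kind (last ss) = Forward \<longrightarrow> fst (last ss) \<notin> Z"
  shows "\<exists>ts. walk G t ts t \<and> ts \<noteq> [] \<and> hd ts = hd ss \<and> last ts = last ss \<and> unblocked (anc G Z) Z ts"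
  using assms
proof (induction "length ss" arbitrary: ss rule: less_induct)
  case less
  show ?case
  proof (cases "unblocked (anc G Z) Z ss")
    case True
    then show ?thesis using less by blast
  next
    case False
    obtain ps s s' qs where d: "ss = ps @ s # s' # qs"
      "\<not> (if kind s \<noteq> Backward \<and> kind s' \<noteq> Forward then target s \<in> anc G Z else target s \<notin> Z)"
      using first_blocked_junction[OF less(5) False] by metis
    obtain b e z f c where s: "s = (b, e, z)" "s' = (z, f, c)" "is_edge G b e z" "is_edge G z f c"
      "walk G t ps b" "walk G c qs t"
      using less(2) unfolding d by (cases s; cases s') (auto simp: walk_append)
    have "unblocked (anc G Z) {} (s # s' # qs)"
      using less(5) unfolding d unblocked_append[of _ _ ps] by blast
    then have "\<not> (e \<noteq> Backward \<and> f \<noteq> Forward)" "z \<in> Z"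
      using d(2) s by (auto simp: unblocked_Cons split: if_splits)
    then have p: "e = Backward" "f = Forward" "b = c" using pendant s by blast+
    have ps: "ps \<noteq> []" using less(4) d s p by auto
    have qs: "qs \<noteq> []" using less(6) d s p \<open>z \<in> Z\<close> by auto
    have tp: "target (last ps) = b" using walk_ends(2)[OF s(5) ps] .
    have "unblocked (anc G Z) {} (ps @ qs)"
      using less(5) qs ps unfolding d unblocked_append[of _ _ ps] tp
      by (auto simp: unblocked_Cons s p split: if_splits)
    moreover have "walk G t (ps @ qs) t" using s p by (auto simp: walk_append)
    moreover have "hd (ps @ qs) = hd ss" "last (ps @ qs) = last ss" using ps qs d by simp_all
    moreover have "length (ps @ qs) < length ss" using d by simp
    ultimately show ?thesis using less(1)[of "ps @ qs"] less(4,6) ps by auto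
  qed
qed

text \<open>
  To contradict the hypothesis on routes it is enough to control the colliders and the two edges at the end
  points.
\<close>

lemma no_returnD:
  assumes "no_return t" "walk G t ss t" "ss \<noteq> []" "kind (hd ss) = Forward" "kind (last ss) \<noteq> Backward"
    "unblocked (anc G Z) {} ss" "kind (last ss) = Forward \<longrightarrow> fst (last ss) \<notin> Z"
  shows False
proof -
  obtain ts where ts: "walk G t ts t" "ts \<noteq> []" "hd ts = hd ss" "last ts = last ss" "unblocked (anc G Z) Z ts"
    using remove_pendants[OF assms(2,3,4,6,7)] by blast
  obtain rs where rs: "rs \<noteq> []" "walk G t rs t" "unblocked Z Z rs" "hd rs = hd ts" "last rs = last ts"
    using detour_colliders[OF sym_edges ts(1,2,5)] by blast
  have "t \<notin> Z" using assms(1) by (simp add: no_return_def)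
  then have "\<forall>i<length (visited t rs). if collider_at (map kind rs) i
      then visited t rs ! i \<in> Z else visited t rs ! i \<notin> Z"
    unfolding openness_iff[OF rs(2,1)] using rs(3) by simp
  then have "open_route G Z (visited t rs) (map kind rs)"
    using walk_is_route[OF mixed rs(2,1)] by (simp add: open_route_def)
  moreover have "hd (visited t rs) = t" by (simp add: visited_def)
  moreover have "last (visited t rs) = t" by (rule last_visited[OF rs(2)])
  moreover have "hd (map kind rs) = Forward" using rs ts assms(4) by (simp add: hd_map)
  moreover have "last (map kind rs) \<in> {Forward, Bidirected}"
    using rs ts assms(5) edge_type_not_Backward[of "kind (last ss)"] by (simp add: last_map)
  ultimately show False using assms(1) unfolding no_return_def by blast
qed

end

section \<open>Separation by a node that all open paths visit\<close>

lemma distinct_sources: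
  assumes "sym (bidirected G)" "walk G u p v" "distinct (visited u p)" "(a, e, b) \<in> set p"
  shows "a \<noteq> v" "(a, e', b') \<in> set p \<Longrightarrow> e' = e \<and> b' = b"
proof -
  have d: "distinct (visited v (reversed p))"
    using assms(3) visited_reversed[OF assms(2)] by simp
  have flip: "flip_step s = (target s, kind (flip_step s), fst s)" for s :: "'a step"
    using flip_step_simps(1,2)[of s] by (metis prod.collapse)
  have mem: "(y, kind (flip_step (x, k, y)), x) \<in> set (reversed p)" if "(x, k, y) \<in> set p" for x k y
    using that flip[of "(x, k, y)"] by (metis fst_conv image_eqI set_reversed snd_conv)
  show "a \<noteq> v" using distinct_targets(1)[OF d mem[OF assms(4)]] .
  assume "(a, e', b') \<in> set p"
  from distinct_targets(2)[OF d mem[OF assms(4)] mem[OF this]]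
  show "e' = e \<and> b' = b" by (cases e; cases e') auto
qed

lemma anc_insert_subset:
  assumes "t \<in> anc G Z" "C \<subseteq> Z"
  shows "anc G (insert t C) \<subseteq> anc G Z"
proof
  fix a assume "a \<in> anc G (insert t C)"
  then have "(a, t) \<in> (directed G)\<^sup>* \<or> a \<in> anc G C" by (auto simp: anc_def)
  then show "a \<in> anc G Z" using anc_rtrancl[OF _ assms(1)] anc_mono[OF assms(2), of G] by auto
qed

text \<open>
  An arrow leaving \<open>t\<close> makes \<open>t\<close> a non-collider, which is blocked unless \<open>t\<close> is an end of the walk.
\<close>

lemma blocked_departure:
  assumes "walk G u ss v" "unblocked A B ss" "t \<in> B"
  shows "(a, Backward, t) \<in> set ss \<Longrightarrow> v = t" "(t, Forward, b) \<in> set ss \<Longrightarrow> u = t"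
proof -
  assume "(a, Backward, t) \<in> set ss"
  then obtain ps qs where d: "ss = ps @ (a, Backward, t) # qs" using split_list by metis
  have "walk G t qs v" using assms(1) unfolding d by (auto simp: walk_append)
  moreover have "unblocked A B ((a, Backward, t) # qs)"
    using assms(2) unfolding d unblocked_append[of _ _ ps] by blast
  ultimately show "v = t" using assms(3) by (cases qs) (auto simp: unblocked_Cons)
next
  assume "(t, Forward, b) \<in> set ss"
  then obtain ps qs where d: "ss = ps @ (t, Forward, b) # qs" using split_list by metis
  have w: "walk G u ps t" using assms(1) unfolding d by (auto simp: walk_append)
  show "u = t"
  proof (cases "ps = []")
    case False
    then have "target (last ps) = t" using walk_ends(2)[OF w] by simp
    then show ?thesis using assms(2,3) False unfolding d unblocked_append[of _ _ ps] by simp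
  qed (use w in simp)
qed

lemma collider_free_avoids:
  assumes "walk G u ss v" "unblocked {} {} ss" "unblocked A Z ss" "u \<notin> Z" "v \<notin> Z"
  shows "set (visited u ss) \<inter> Z = {}"
  using assms
proof (induction G u ss v rule: walk.induct)
  case (2 G u a e b ss v)
  have "b \<notin> Z"
  proof (cases "ss = []")
    case False
    then show ?thesis using 2 by (auto simp: unblocked_Cons split: if_splits)
  qed (use 2 in simp)
  moreover have "set (visited b ss) \<inter> Z = {}"
    using 2 \<open>b \<notin> Z\<close> by (simp add: unblocked_Cons)
  ultimately show ?case using 2 by (auto simp: visited_def)
qed (simp add: visited_def)

text \<open>
  In the theorem, the nodes that the connections of the elements of \<open>Z\<close> must avoid.
\<close>

definition path_nodes :: "('v, 'z) mixed_graph_scheme \<Rightarrow> 'v set \<Rightarrow> 'v \<Rightarrow> 'v \<Rightarrow> 'v set" where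
  "path_nodes G Z u v = (\<Union>p\<in>open_walks G Z u v. set (visited u p))"

text \<open>
  A node \<open>t\<close> that all open paths between \<open>E\<close> and \<open>F\<close> visit. The ends carry neutral names because the lemmas
  below are applied with \<open>E\<close> and \<open>F\<close> as \<open>X\<close> and \<open>Y\<close> and the other way round.
\<close>

locale relay = conditioned_graph G Z for G :: "('v, 'z) mixed_graph_scheme" and Z +
  fixes E F t :: 'v
  assumes ends: "E \<noteq> F" "E \<notin> Z" "F \<notin> Z"
    and connected: "open_walks G Z E F \<noteq> {}"
    and no_colliders: "p \<in> open_walks G Z E F \<Longrightarrow> unblocked {} {} p"
    and visits: "p \<in> open_walks G Z E F \<Longrightarrow> t \<in> set (visited E p)"
begin

abbreviation "P \<equiv> open_walks G Z E F"

abbreviation "on_paths \<equiv> path_nodes G Z E F"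

definition "enters k \<longleftrightarrow> (\<forall>p\<in>P. \<exists>a. (a, k, t) \<in> set p)"

definition "leaves k \<longleftrightarrow> (\<forall>p\<in>P. \<exists>b. (t, k, b) \<in> set p)"

lemma P_walk: "p \<in> P \<Longrightarrow> walk G E p F" "p \<in> P \<Longrightarrow> distinct (visited E p)"
  by (simp_all add: open_walks_def)

lemma t_notin_Z: "t \<notin> Z"
proof -
  obtain p where p: "p \<in> P" using connected by blast
  then have "set (visited E p) \<inter> Z = {}"
    using collider_free_avoids[OF P_walk(1)[OF p] no_colliders[OF p]] ends
    by (auto simp: open_walks_def)
  then show ?thesis using visits[OF p] by blast
qed

lemma in_P_if_connected:
  assumes "walk G E ss F" "unblocked (anc G Z) {} ss"
  obtains p where "p \<in> P" "set p \<subseteq> set ss"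
  using open_walk_from_walk[OF assms ends] by blast

lemma visited_in_P:
  assumes "p \<in> P" "(a, e, b) \<in> set p"
  shows "a \<in> on_paths" "b \<in> on_paths"
  using walk_steps(2,3)[OF P_walk(1)[OF assms(1)] assms(2)] assms(1) by (auto simp: path_nodes_def)

lemma tail:
  obtains ts where "walk G t ts F" "unblocked {} {} ts" "t \<notin> set (map target ts)"
    "leaves k \<Longrightarrow> ts \<noteq> [] \<Longrightarrow> kind (hd ts) = k" "t = F \<Longrightarrow> ts = []"
proof -
  obtain p where p: "p \<in> P" using connected by blast
  obtain ps ts where d: "p = ps @ ts" "walk G E ps t" "walk G t ts F"
    using walk_split_at[OF P_walk(1)[OF p] visits[OF p]] by metis
  have nt: "t \<notin> set (map target ts)"
    using P_walk(2)[OF p] walk_end_visited[OF d(2)] unfolding d(1) visited_append[OF d(2)] by auto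
  have "kind (hd ts) = k" if "leaves k" "ts \<noteq> []"
  proof -
    obtain b where b: "(t, k, b) \<in> set p" using \<open>leaves k\<close> p by (auto simp: leaves_def)
    have "hd ts \<in> set p" "fst (hd ts) = t" using that(2) d walk_ends(1)[OF d(3)] by simp_all
    then have "(t, kind (hd ts), target (hd ts)) \<in> set p" by (metis prod.collapse)
    then show ?thesis
      using distinct_sources(2)[OF sym_edges P_walk[OF p] b] by blast
  qed
  moreover have "ts = []" if "t = F"
  proof (rule ccontr)
    assume "ts \<noteq> []"
    then have "F \<in> set (map target ts)" using walk_ends(2)[OF d(3)] last_in_set[of ts] by force
    then show False using nt that by simp
  qed
  moreover have "unblocked {} {} ts"
    using no_colliders[OF p] unfolding d(1) unblocked_append[of _ _ ps] by blast
  ultimately show ?thesis using that d(3) nt by blast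
qed

lemma open_walkD:
  assumes "r \<in> open_walks G C w s" "C \<subseteq> Z"
  shows "walk G w r s" "unblocked (anc G Z) {} r" "distinct (visited w r)" "r \<noteq> []"
    "w \<notin> C" "s \<notin> C"
  using assms unblocked_mono[of "anc G C" C r "anc G Z" "{}"] anc_mono[OF assms(2)]
  by (auto simp: open_walks_def)

text \<open>
  Concatenate \<open>q\<close>, the connection \<open>r\<close> from \<open>w\<close> to \<open>t\<close>, and a path in \<open>P\<close> from \<open>t\<close> onwards. The node \<open>w\<close> may
  become a collider, as it is in \<open>Z\<close>, and \<open>t\<close> does not become one by the last premise. Shorten the result to an
  element of \<open>P\<close>. The tail does not return to \<open>t\<close> and \<open>r\<close> has no other node of \<open>P\<close>, so the edge into \<open>t\<close> comes
  from \<open>q\<close>.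
\<close>

lemma shared_entry:
  assumes "E \<noteq> t" "w \<in> Z" and q: "walk G E q w" "unblocked (anc G Z) {} q"
    and r: "walk G w r t" "unblocked (anc G Z) {} r" "r \<noteq> []" "set (visited w r) \<inter> on_paths \<subseteq> {t}"
    and out: "kind (last r) = Backward \<or> t = F \<or> leaves Forward"
  obtains p a e where "p \<in> P" "(a, e, t) \<in> set p" "(a, e, t) \<in> set q"
proof -
  obtain ts where ts: "walk G t ts F" "unblocked {} {} ts" "t \<notin> set (map target ts)"
    "leaves Forward \<Longrightarrow> ts \<noteq> [] \<Longrightarrow> kind (hd ts) = Forward" "t = F \<Longrightarrow> ts = []"
    using tail[of Forward] by metis
  have ts': "unblocked (anc G Z) {} ts" by (rule unblocked_mono[OF ts(2)]) simp_all
  have "q \<noteq> []" using q(1) ends(2) assms(2) by auto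
  have t: "target (last q) = w" "target (last r) = t"
    using walk_ends(2)[OF q(1) \<open>q \<noteq> []\<close>] walk_ends(2)[OF r(1) r(3)] by simp_all
  have "w \<in> anc G Z" using assms(2) by (auto simp: anc_def)
  have "kind (last r) = Backward \<or> ts = [] \<or> kind (hd ts) = Forward" using out ts(4,5) by blast
  then have "unblocked (anc G Z) {} (r @ ts)"
    unfolding unblocked_append[of _ _ r] t using r(2) ts' by auto
  then have "unblocked (anc G Z) {} (q @ r @ ts)"
    unfolding unblocked_append[of _ _ q] t using q(2) \<open>w \<in> anc G Z\<close> by auto
  moreover have "walk G E (q @ r @ ts) F" using q(1) r(1) ts(1) by (auto simp: walk_append)
  ultimately obtain p where p: "p \<in> P" "set p \<subseteq> set (q @ r @ ts)" using in_P_if_connected by metis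
  have "t \<in> target ` set p" using visits[OF p(1)] assms(1) by (auto simp: visited_def)
  then obtain a e where s: "(a, e, t) \<in> set p" by force
  have "a \<noteq> t"
  proof -
    obtain ps qs where d: "p = ps @ (a, e, t) # qs" using split_list[OF s] by blast
    have w: "walk G E ps a" using P_walk(1)[OF p(1)] unfolding d by (auto simp: walk_append)
    show ?thesis using P_walk(2)[OF p(1)] walk_end_visited[OF w]
      unfolding d visited_append[OF w] by auto
  qed
  then have "(a, e, t) \<notin> set r"
    using r(4) visited_in_P(1)[OF p(1) s] walk_steps(2)[OF r(1)] by blast
  moreover have "(a, e, t) \<notin> set ts" using ts(3) by force
  ultimately show ?thesis using that p s by auto
qed

text \<open>
  As \<open>t\<close> has a descendant in \<open>Z\<close>, conditioning on it opens no collider that was closed given \<open>Z\<close>. So an open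
  walk would contain an element of \<open>P\<close>, hence an arrow leaving \<open>t\<close>.
\<close>

lemma relay_with_descendant_separates_ends:
  assumes "E \<noteq> t" "C \<subseteq> Z" and t: "t \<in> anc G Z"
    and out: "enters Backward \<or> leaves Forward"
    and q: "walk G E q F" "unblocked (anc G (insert t C)) (insert t C) q" and "t \<noteq> F"
  shows False
proof -
  have "unblocked (anc G Z) {} q"
    by (rule unblocked_mono[OF q(2) anc_insert_subset[OF t assms(2)]]) simp
  then obtain p where p: "p \<in> P" "set p \<subseteq> set q" using q(1) in_P_if_connected by metis
  from out show False
  proof
    assume "enters Backward"
    then obtain a where "(a, Backward, t) \<in> set p" using p(1) by (auto simp: enters_def)
    then show False using blocked_departure(1)[OF q insertI1] p(2) assms(7) by blast
  next
    assume "leaves Forward"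
    then obtain b where "(t, Forward, b) \<in> set p" using p(1) by (auto simp: leaves_def)
    then show False using blocked_departure(2)[OF q insertI1] p(2) assms(1) by blast
  qed
qed

text \<open>
  Here \<open>w\<close> is connected to \<open>t\<close> through a child of \<open>t\<close>. By \<open>shared_entry\<close> the walk \<open>q\<close> uses the edge by which the
  paths in \<open>P\<close> enter \<open>t\<close>. If this edge leaves \<open>t\<close>, then \<open>t\<close> blocks \<open>q\<close>. If it enters \<open>t\<close>, then \<open>t\<close> is a collider on
  \<open>q\<close>, and going from \<open>t\<close> down to \<open>w\<close> along \<open>r\<close> and back along \<open>q\<close> is a forbidden return to \<open>t\<close>.
\<close>

lemma relay_separates_lower_attachment:
  assumes "E \<noteq> t" "C \<subseteq> Z" and t: "t \<in> anc G Z"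
    and dir: "enters Backward \<or> enters Forward \<and> no_return t"
    and w: "w \<in> Z" and r: "r \<in> open_walks G C w t" "set (visited w r) \<inter> on_paths \<subseteq> {t}"
      "kind (last r) = Backward"
    and q: "walk G E q w" "unblocked (anc G (insert t C)) (insert t C) q"
  shows False
proof -
  note r' = open_walkD[OF r(1) assms(2)]
  have "t \<noteq> w" using t_notin_Z w by blast
  obtain q' where q': "walk G E q' w" "unblocked (anc G (insert t C)) (insert t C) q'"
    "distinct (visited E q')" by (rule walk_to_path[OF q parent_closed_anc])
  have ok: "unblocked (anc G Z) {} q'" by (rule unblocked_mono[OF q'(2) anc_insert_subset[OF t assms(2)]]) simp
  obtain p a e where p: "p \<in> P" "(a, e, t) \<in> set p" "(a, e, t) \<in> set q'"
    using shared_entry[OF assms(1) w q'(1) ok r'(1,2,4) r(2)] r(3) by metis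
  have nb: "e \<noteq> Backward" using blocked_departure(1)[OF q'(1,2) insertI1] p(3) \<open>t \<noteq> w\<close> by blast
  show False
  proof (cases "enters Backward")
    case True
    then obtain a' where "(a', Backward, t) \<in> set p" using p(1) by (auto simp: enters_def)
    then show False using distinct_targets(2)[OF P_walk(2)[OF p(1)] p(2)] nb by blast
  next
    case False
    then have nr: "no_return t" using dir by blast
    obtain ps qs where d: "q' = ps @ (a, e, t) # qs" using split_list[OF p(3)] by blast
    have wq: "walk G t qs w" using q'(1) unfolding d by (auto simp: walk_append)
    have ne: "qs \<noteq> []" using wq \<open>t \<noteq> w\<close> by auto
    have uq: "unblocked (anc G (insert t C)) (insert t C) ((a, e, t) # qs)"
      using q'(2) unfolding d unblocked_append[of _ _ ps] by blast
    then have hdq: "kind (hd qs) \<noteq> Forward" using ne by (auto simp: unblocked_Cons split: if_splits)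
    have okq: "unblocked (anc G Z) {} qs"
      using ok unfolding d unblocked_append[of _ _ ps] by (auto simp: unblocked_Cons)
    let ?c = "reversed r @ reversed qs"
    have wr: "walk G t (reversed r) w" "walk G w (reversed qs) t"
      using walk_reversed[OF sym_edges] r'(1) wq by blast+
    have tl: "target (last (reversed r)) = w" using walk_ends(2)[OF wr(1)] r'(4) by simp
    have "w \<in> anc G Z" using w by (auto simp: anc_def)
    have "walk G t ?c t" using wr by (auto simp: walk_append)
    moreover have "?c \<noteq> []" "kind (hd ?c) = Forward" using r'(4) r(3) by simp_all
    moreover have "kind (last ?c) \<noteq> Backward" using ne hdq by simp
    moreover have "unblocked (anc G Z) {} ?c"
      unfolding unblocked_append[of _ _ "reversed r"] tl
      using unblocked_reversed[OF r'(1)] unblocked_reversed[OF wq] r'(2) okq \<open>w \<in> anc G Z\<close> by simp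
    moreover have "fst (last ?c) \<notin> Z" if forward: "kind (last ?c) = Forward"
    proof
      \<comment> \<open>If the return ended with the arrow from a new node \<open>c\<close>, this node would be \<open>w\<close> or visited between two
        visits of \<open>t\<close>. In the first case \<open>r\<close> would be the arrow from \<open>w\<close> to \<open>t\<close> and not reach \<open>t\<close> through a
        child.\<close>
      have kb: "kind (hd qs) = Backward" using forward ne by simp
      assume zc: "fst (last ?c) \<in> Z"
      obtain c qs' where qs: "qs = (t, Backward, c) # qs'" "(c, t) \<in> directed G" "walk G c qs' w"
        using wq ne kb by (cases qs) auto
      have "c \<in> Z" using zc qs by simp
      show False
      proof (cases qs')
        case Nil
        then have "c = w" using qs by simp
        obtain f b r2 where rr: "r = (w, f, b) # r2" "is_edge G w f b" "walk G b r2 t"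
          using r'(1,4) by (cases r) auto
        have "f = Forward \<and> t = b"
          using pendant[OF w _ rr(2), of t Backward] qs \<open>c = w\<close> by simp
        then have "r2 = [] \<or> False"
          using r'(3) rr walk_ends(2)[of G t r2 t] last_in_set[of r2]
          by (cases "r2 = []") (force simp: visited_def)+
        then show False using rr r(3) \<open>f = Forward \<and> t = b\<close> by simp
      next
        case (Cons s qs2)
        obtain f b where s: "s = (c, f, b)" "is_edge G c f b" using qs(3) Cons by (cases s) auto
        have "t = b" using pendant[OF \<open>c \<in> Z\<close> _ s(2), of t Backward] qs by simp
        moreover have "distinct (visited t qs)"
        proof -
          have "walk G E (ps @ [(a, e, t)]) t" using q'(1) unfolding d by (auto simp: walk_append)
          from visited_append[OF this, of qs] show ?thesis
            using q'(3) walk_end_visited[OF \<open>walk G E (ps @ [(a, e, t)]) t\<close>] unfolding d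
            by (auto simp: visited_def)
        qed
        ultimately show False using qs Cons s by (simp add: visited_def)
      qed
    qed
    ultimately show False using no_returnD[OF nr, of ?c] by blast
  qed
qed

text \<open>
  Nothing is known here about descendants of \<open>t\<close>, so conditioning on \<open>t\<close> might open colliders. At the first one
  that is no ancestor of \<open>Z\<close>, leave the walk and follow the arrows to \<open>t\<close> and then a path in \<open>P\<close> to \<open>F\<close>. All
  elements of \<open>P\<close> enter \<open>t\<close> from the side of \<open>E\<close> against an arrow out of \<open>t\<close>, but the one obtained in this way
  does not.
\<close>

lemma conditioned_source_opens_no_collider:
  assumes "E \<noteq> t" "enters Backward" "t = F \<or> leaves Forward" "C \<subseteq> Z" "t \<noteq> w"
    and q: "walk G E q w" "unblocked (anc G (insert t C)) (insert t C) q"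
  shows "unblocked (anc G Z) {} q"
proof (rule ccontr)
  assume "\<not> ?thesis"
  then obtain ps s s' qs where d: "q = ps @ s # s' # qs" "unblocked (anc G Z) {} (ps @ [s])"
    "\<not> (if kind s \<noteq> Backward \<and> kind s' \<noteq> Forward then target s \<in> anc G Z else target s \<notin> {})"
    using first_blocked_junction[OF q(2)] by metis
  have s: "kind s \<noteq> Backward" "kind s' \<noteq> Forward" "target s \<notin> anc G Z"
    using d(3) by (auto split: if_splits)
  have "unblocked (anc G (insert t C)) (insert t C) (s # s' # qs)"
    using q(2) unfolding d(1) unblocked_append[of _ _ ps] by blast
  then have "target s \<in> anc G (insert t C)" using s by (auto simp: unblocked_Cons)
  then have "(target s, t) \<in> (directed G)\<^sup>*"
    using s(3) assms(4) by (auto simp: anc_def)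
  then obtain ds where ds: "walk G (target s) ds t" "\<And>s. s \<in> set ds \<Longrightarrow> kind s = Forward \<and> fst s \<noteq> t"
    by (rule directed_walk) blast
  have fw: "\<forall>s\<in>set ds. kind s = Forward" using ds(2) by blast
  have uds: "unblocked (anc G Z) {} ds" by (rule unblocked_forward[OF fw]) simp
  obtain ts where ts: "walk G t ts F" "unblocked {} {} ts" "t \<notin> set (map target ts)"
    "leaves Forward \<Longrightarrow> ts \<noteq> [] \<Longrightarrow> kind (hd ts) = Forward" "t = F \<Longrightarrow> ts = []"
    using tail[of Forward] by metis
  have ts': "unblocked (anc G Z) {} ts" by (rule unblocked_mono[OF ts(2)]) simp_all
  have hd_ts: "ts = [] \<or> kind (hd ts) = Forward" using ts(4,5) assms(3) by blast
  have dts: "unblocked (anc G Z) {} (ds @ ts)"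
    unfolding unblocked_append[of _ _ ds] using uds ts' hd_ts by auto
  have "ds @ ts = [] \<or> kind (hd (ds @ ts)) = Forward"
    using hd_ts fw by (cases ds) auto
  then have "unblocked (anc G Z) {} ((ps @ [s]) @ ds @ ts)"
    unfolding unblocked_append[of _ _ "ps @ [s]"] using d(2) dts by auto
  moreover have "walk G E ((ps @ [s]) @ ds @ ts) F"
  proof -
    have "walk G E (ps @ [s]) (target s)" using q(1) unfolding d(1)
      by (cases s) (auto simp: walk_append)
    then show ?thesis using ds(1) ts(1) unfolding walk_append by blast
  qed
  ultimately obtain p where p: "p \<in> P" "set p \<subseteq> set ((ps @ [s]) @ ds @ ts)"
    using in_P_if_connected by metis
  obtain a where a: "(a, Backward, t) \<in> set p" using assms(2) p(1) by (auto simp: enters_def)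
  moreover have "(a, Backward, t) \<notin> set q"
    using blocked_departure(1)[OF q insertI1] assms(5) by blast
  moreover have "(a, Backward, t) \<notin> set ds" using fw by auto
  moreover have "(a, Backward, t) \<notin> set ts" using ts(3) by force
  ultimately show False using p(2) d(1) by auto
qed

lemma source_separates_ends:
  assumes "E \<noteq> t" "enters Backward" "leaves Forward" "C \<subseteq> Z" "t \<noteq> F"
    and q: "walk G E q F" "unblocked (anc G (insert t C)) (insert t C) q"
  shows False
proof -
  have "unblocked (anc G Z) {} q"
    by (rule conditioned_source_opens_no_collider[OF assms(1,2) _ assms(4,5) q]) (use assms(3) in blast)
  then obtain p where p: "p \<in> P" "set p \<subseteq> set q" using q(1) in_P_if_connected by metis
  obtain a where "(a, Backward, t) \<in> set p" using p(1) assms(2) by (auto simp: enters_def)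
  then show False using blocked_departure(1)[OF q insertI1] p(2) assms(5) by blast
qed

lemma source_separates_attachment:
  assumes "E \<noteq> t" "enters Backward" "t = F \<or> leaves Forward" "C \<subseteq> Z"
    and w: "w \<in> Z" and r: "r \<in> open_walks G C w t" "set (visited w r) \<inter> on_paths \<subseteq> {t}"
    and q: "walk G E q w" "unblocked (anc G (insert t C)) (insert t C) q"
  shows False
proof -
  have "t \<noteq> w" using t_notin_Z w by blast
  note r' = open_walkD[OF r(1) assms(4)]
  have "unblocked (anc G Z) {} q" by (rule conditioned_source_opens_no_collider[OF assms(1-4) \<open>t \<noteq> w\<close> q])
  then obtain p a e where p: "p \<in> P" "(a, e, t) \<in> set p" "(a, e, t) \<in> set q"
    using shared_entry[OF assms(1) w q(1) _ r'(1,2,4) r(2)] assms(3) by metis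
  obtain a' where "(a', Backward, t) \<in> set p" using p(1) assms(2) by (auto simp: enters_def)
  then have "e = Backward" using distinct_targets(2)[OF P_walk(2)[OF p(1)] p(2)] by blast
  then show False using blocked_departure(1)[OF q insertI1] p(3) \<open>t \<noteq> w\<close> by blast
qed

text \<open>
  Here the paths in \<open>P\<close> enter \<open>t\<close> with an arrow from the side of \<open>E\<close>. By \<open>shared_entry\<close>, \<open>q\<close> uses this arrow. After
  it, \<open>q\<close> either has a collider at \<open>t\<close> or follows the arrows from \<open>t\<close> to a collider or to \<open>w\<close>. In each case \<open>t\<close> has
  a descendant in \<open>C\<close> or is an ancestor of \<open>w\<close>.
\<close>

lemma collider_separates_upper_attachment:
  assumes "enters Forward" "t = F \<or> leaves Forward" "C \<subseteq> Z"
    and w: "w \<in> Z" and r: "r \<in> open_walks G C w t" "set (visited w r) \<inter> on_paths \<subseteq> {t}"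
    and t: "t \<notin> anc G (insert w C)"
    and q: "walk G E q w" "unblocked (anc G C) C q"
  shows False
proof -
  have "t \<noteq> w" using t_notin_Z w by blast
  note r' = open_walkD[OF r(1) assms(3)]
  obtain p0 where "p0 \<in> P" using connected by blast
  then obtain a0 where "p0 \<in> P" "(a0, Forward, t) \<in> set p0"
    using assms(1) by (auto simp: enters_def)
  then have "E \<noteq> t" using distinct_targets(1)[OF P_walk(2)] by blast
  have "unblocked (anc G Z) {} q" by (rule unblocked_mono[OF q(2) anc_mono[OF assms(3)]]) simp
  then obtain p a e where p: "p \<in> P" "(a, e, t) \<in> set p" "(a, e, t) \<in> set q"
    using shared_entry[OF \<open>E \<noteq> t\<close> w q(1) _ r'(1,2,4) r(2)] assms(2) by metis
  obtain a' where "(a', Forward, t) \<in> set p" using p(1) assms(1) by (auto simp: enters_def)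
  then have e: "e = Forward" using distinct_targets(2)[OF P_walk(2)[OF p(1)] p(2)] by blast
  obtain ps qs where d: "q = ps @ (a, e, t) # qs" using split_list[OF p(3)] by blast
  have wq: "walk G t qs w" using q(1) unfolding d by (auto simp: walk_append)
  have ne: "qs \<noteq> []" using wq \<open>t \<noteq> w\<close> by auto
  have "unblocked (anc G C) C ((a, e, t) # qs)"
    using q(2) unfolding d unblocked_append[of _ _ ps] by blast
  then have uq: "unblocked (anc G C) C qs" "kind (hd qs) \<noteq> Forward \<Longrightarrow> t \<in> anc G C"
    using ne e by (auto simp: unblocked_Cons)
  have tC: "t \<notin> anc G C" "(t, w) \<notin> (directed G)\<^sup>*" using t by (auto simp: anc_def)
  then have "kind (hd qs) = Forward" using uq(2) by blast
  from forward_walk_meets[OF wq ne this uq(1) parent_closed_anc] tC walk_all_forward[OF wq]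
  show False by blast
qed

end

section \<open>Treks\<close>

definition chain :: "(nat \<Rightarrow> 'v) \<Rightarrow> nat \<Rightarrow> nat \<Rightarrow> 'v step list" where
  "chain f i j = map (\<lambda>k. (f k, Forward, f (Suc k))) [i..<j]"

text \<open>
  Stronger than separation by paths in form only: open walks shorten to open paths.
\<close>

definition walk_separated :: "('v, 'z) mixed_graph_scheme \<Rightarrow> 'v set \<Rightarrow> 'v \<Rightarrow> 'v \<Rightarrow> bool" where
  "walk_separated G C u v \<longleftrightarrow> (\<forall>ss. walk G u ss v \<longrightarrow> \<not> unblocked (anc G C) C ss)"

lemma chain_append: "i \<le> j \<Longrightarrow> j \<le> k \<Longrightarrow> chain f i k = chain f i j @ chain f j k"
  unfolding chain_def map_append[symmetric] using upt_add_eq_append[of i j "k - j"] by simp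

lemma chain_Nil [simp]: "chain f i i = []"
  by (simp add: chain_def)

lemma chain_Suc: "i \<le> j \<Longrightarrow> chain f i (Suc j) = chain f i j @ [(f j, Forward, f (Suc j))]"
  by (simp add: chain_def)

lemma chain_eq_Nil_iff [simp]: "chain f i j = [] \<longleftrightarrow> j \<le> i"
  by (auto simp: chain_def)

lemma hd_chain: "i < j \<Longrightarrow> hd (chain f i j) = (f i, Forward, f (Suc i))"
  by (simp add: chain_def hd_map)

lemma last_chain: "i < j \<Longrightarrow> last (chain f i j) = (f (j - 1), Forward, f j)"
  by (cases j) (simp_all add: chain_Suc)

lemma set_chain: "set (chain f i j) = {(f k, Forward, f (Suc k)) | k. i \<le> k \<and> k < j}"
  by (auto simp: chain_def)

lemma chain_walk:
  assumes "\<And>k. i \<le> k \<Longrightarrow> k < j \<Longrightarrow> (f k, f (Suc k)) \<in> directed G" "i \<le> j"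
  shows "walk G (f i) (chain f i j) (f j)"
  using assms(2,1)
proof (induction j rule: dec_induct)
  case (step j)
  then show ?case by (auto simp: chain_Suc walk_append)
qed simp

lemma mem_reversed_iff:
  "(x, Forward, y) \<in> set (reversed p) \<longleftrightarrow> (y, Backward, x) \<in> set p"
  "(x, Backward, y) \<in> set (reversed p) \<longleftrightarrow> (y, Forward, x) \<in> set p"
proof -
  have *: "s \<in> set (reversed q)" if "flip_step s \<in> set q" for s :: "'a step" and q
    using imageI[OF that, of flip_step] by simp
  have **: "flip_step s \<in> set q" if "s \<in> set (reversed q)" for s :: "'a step" and q
    using *[of "flip_step s" "reversed q"] that by simp
  show "(x, Forward, y) \<in> set (reversed p) \<longleftrightarrow> (y, Backward, x) \<in> set p"
    using *[of "(x, Forward, y)" p] **[of "(x, Forward, y)" p] by auto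
  show "(x, Backward, y) \<in> set (reversed p) \<longleftrightarrow> (y, Forward, x) \<in> set p"
    using *[of "(x, Backward, y)" p] **[of "(x, Backward, y)" p] by auto
qed

lemma reversed_append [simp]: "reversed (p @ q) = reversed q @ reversed p"
  by (simp add: reversed_def)

lemma open_walks_reverse_eq:
  assumes "sym (bidirected G)"
  shows "open_walks G Z v u = reversed ` open_walks G Z u v"
proof (intro set_eqI iffI)
  fix p assume "p \<in> open_walks G Z v u"
  then show "p \<in> reversed ` open_walks G Z u v"
    using open_walks_reversed[OF assms] by (intro image_eqI[of _ _ "reversed p"]) simp_all
next
  fix p assume "p \<in> reversed ` open_walks G Z u v"
  then show "p \<in> open_walks G Z v u" using open_walks_reversed[OF assms] by auto
qed

lemma path_nodes_sym:
  assumes "sym (bidirected G)"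
  shows "path_nodes G Z v u = path_nodes G Z u v"
proof -
  have "set (visited v (reversed p)) = set (visited u p)" if "p \<in> open_walks G Z u v" for p
    using visited_reversed[of G u p v] that by (simp add: open_walks_def)
  then show ?thesis unfolding path_nodes_def open_walks_reverse_eq[OF assms, of Z v u] by auto
qed

text \<open>
  Two directed branches \<open>a\<close> and \<open>b\<close> leave a common source, towards \<open>X\<close> and \<open>Y\<close> respectively. The conditions on \<open>l\<close> and
  \<open>r\<close> say that the paths in \<open>P\<close> have no arrowhead at the ends of the branches from outside. Either branch may be
  trivial, which makes the locale symmetric (see \<open>mirror\<close>), so that it suffices to analyse the
  branch \<open>b\<close>.
\<close>

locale trek = conditioned_graph G Z for G :: "('v, 'z) mixed_graph_scheme" and Z +
  fixes X Y :: 'v and a b :: "nat \<Rightarrow> 'v" and La Lb :: nat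
  assumes ends: "X \<noteq> Y" "X \<notin> Z" "Y \<notin> Z"
    and connected: "open_walks G Z X Y \<noteq> {}"
    and no_colliders: "p \<in> open_walks G Z X Y \<Longrightarrow> unblocked {} {} p"
    and source: "a 0 = b 0" and nontrivial: "0 < La + Lb"
    and shape: "p \<in> open_walks G Z X Y \<Longrightarrow>
      \<exists>l r. p = l @ reversed (chain a 0 La) @ chain b 0 Lb @ r \<and>
        (l = [] \<or> kind (last l) = Backward) \<and> (r = [] \<or> kind (hd r) = Forward)"
begin

abbreviation "P \<equiv> open_walks G Z X Y"
abbreviation "N \<equiv> path_nodes G Z X Y"

lemma mirror: "trek G Z Y X b a Lb La"
proof unfold_locales
  show "Y \<noteq> X" "Y \<notin> Z" "X \<notin> Z" using ends by auto
  show "open_walks G Z Y X \<noteq> {}"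
    using connected by (simp add: open_walks_reverse_eq[OF sym_edges, of Z Y X])
  show "b 0 = a 0" using source by simp
  show "0 < Lb + La" using nontrivial by linarith
  fix q assume "q \<in> open_walks G Z Y X"
  then obtain p where p: "p \<in> P" "q = reversed p"
    unfolding open_walks_reverse_eq[OF sym_edges, of Z Y X] by blast
  then have w: "walk G X p Y" by (simp add: open_walks_def)
  show "unblocked {} {} q" using no_colliders[OF p(1)] unblocked_reversed[OF w] p(2) by simp
  obtain l r where lr: "p = l @ reversed (chain a 0 La) @ chain b 0 Lb @ r"
    "l = [] \<or> kind (last l) = Backward" "r = [] \<or> kind (hd r) = Forward"
    using shape[OF p(1)] by blast
  have rl: "reversed r = [] \<or> kind (last (reversed r)) = Backward"
    "reversed l = [] \<or> kind (hd (reversed l)) = Forward"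
    using lr(2,3) by (cases "r = []"; cases "l = []"; simp)+
  show "\<exists>l r. q = l @ reversed (chain b 0 Lb) @ chain a 0 La @ r \<and>
        (l = [] \<or> kind (last l) = Backward) \<and> (r = [] \<or> kind (hd r) = Forward)"
    by (rule exI[of _ "reversed r"], rule exI[of _ "reversed l"]) (use lr(1) p(2) rl in simp)
qed

lemma branch_steps:
  assumes "p \<in> P"
  shows "k < Lb \<Longrightarrow> (b k, Forward, b (Suc k)) \<in> set p"
    and "k < La \<Longrightarrow> (a (Suc k), Backward, a k) \<in> set p"
proof -
  obtain l r where p: "p = l @ reversed (chain a 0 La) @ chain b 0 Lb @ r" using shape[OF assms] by blast
  show "k < Lb \<Longrightarrow> (b k, Forward, b (Suc k)) \<in> set p" unfolding p by (auto simp: set_chain)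
  assume "k < La"
  then have "(a (Suc k), Backward, a k) \<in> set (reversed (chain a 0 La))"
    unfolding mem_reversed_iff by (auto simp: set_chain)
  then show "(a (Suc k), Backward, a k) \<in> set p" unfolding p by simp
qed

lemma P_walk: "p \<in> P \<Longrightarrow> walk G X p Y" "p \<in> P \<Longrightarrow> distinct (visited X p)"
  by (simp_all add: open_walks_def)

lemma some_path: obtains p where "p \<in> P"
  using connected by blast

lemma branch_edges: "k < Lb \<Longrightarrow> (b k, b (Suc k)) \<in> directed G" "k < La \<Longrightarrow> (a k, a (Suc k)) \<in> directed G"
proof -
  obtain p where p: "p \<in> P" using some_path by blast
  show "k < Lb \<Longrightarrow> (b k, b (Suc k)) \<in> directed G"
    using walk_steps(1)[OF P_walk(1)[OF p] branch_steps(1)[OF p]] by simp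
  show "k < La \<Longrightarrow> (a k, a (Suc k)) \<in> directed G"
    using walk_steps(1)[OF P_walk(1)[OF p] branch_steps(2)[OF p]] by simp
qed

lemma enters_right:
  assumes "1 \<le> k" "k \<le> Lb" "p \<in> P"
  shows "\<exists>c. (c, Forward, b k) \<in> set p"
proof -
  have "k - 1 < Lb" "Suc (k - 1) = k" using assms(1,2) by linarith+
  then show ?thesis using branch_steps(1)[OF assms(3), of "k - 1"] by auto
qed

lemma visits_right:
  assumes "p \<in> P" "k \<le> Lb"
  shows "b k \<in> set (visited X p)"
proof -
  consider "k < Lb" | "k = Lb" "0 < Lb" | "k = 0" "0 < La" using assms(2) nontrivial by linarith
  then show ?thesis
  proof cases
    case 1
    then show ?thesis using walk_steps(2)[OF P_walk(1)[OF assms(1)] branch_steps(1)[OF assms(1)]] by blast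
  next
    case 2
    then show ?thesis
      using walk_steps(3)[OF P_walk(1)[OF assms(1)] branch_steps(1)[OF assms(1), of "Lb - 1"]] by simp
  next
    case 3
    then show ?thesis
      using walk_steps(3)[OF P_walk(1)[OF assms(1)] branch_steps(2)[OF assms(1), of 0]] source by simp
  qed
qed

lemma relay_right: "k \<le> Lb \<Longrightarrow> relay G Z X Y (b k)"
  using ends connected no_colliders visits_right by unfold_locales

lemma relay_right_mirror:
  assumes "k \<le> Lb"
  shows "relay G Z Y X (b k)"
proof -
  interpret M: trek G Z Y X b a Lb La by (rule mirror)
  have "b k \<in> set (visited Y q)" if "q \<in> open_walks G Z Y X" for q
  proof -
    obtain p where p: "p \<in> P" "q = reversed p"
      using \<open>q \<in> open_walks G Z Y X\<close> unfolding open_walks_reverse_eq[OF sym_edges, of Z Y X] by blast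
    then show ?thesis
      using visits_right[OF p(1) assms] visited_reversed[OF P_walk(1)[OF p(1)]] by simp
  qed
  then show ?thesis using M.ends M.connected M.no_colliders by unfold_locales
qed

lemma leaves_right:
  assumes "k \<le> Lb"
  shows "b k = Y \<or> (\<forall>p\<in>P. \<exists>c. (b k, Forward, c) \<in> set p)"
proof (cases "k < Lb")
  case True
  then show ?thesis using branch_steps(1) by blast
next
  case False
  then have k: "k = Lb" using assms by simp
  have "\<exists>c. (b k, Forward, c) \<in> set p" if p: "p \<in> P" and nY: "b k \<noteq> Y" for p
  proof -
    obtain l r where d: "p = l @ reversed (chain a 0 La) @ chain b 0 Lb @ r"
      "r = [] \<or> kind (hd r) = Forward" using shape[OF p] by blast
    let ?s = "l @ reversed (chain a 0 La) @ chain b 0 Lb"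
    have w: "walk G X (?s @ r) Y" using P_walk(1)[OF p] d(1) by simp
    then obtain w where w: "walk G X ?s w" "walk G w r Y" unfolding walk_append[of G X ?s] by blast
    have "target (last ?s) = b Lb"
    proof (cases "Lb = 0")
      case True
      then show ?thesis using nontrivial source by (simp add: hd_chain)
    qed (simp add: last_chain)
    moreover have "?s \<noteq> []" using nontrivial by auto
    ultimately have "w = b k" using walk_ends(2)[OF w(1)] k by simp
    then have "r \<noteq> []" using w(2) nY by auto
    then have "hd r = (b k, Forward, target (hd r))"
      using d(2) walk_ends(1)[OF w(2)] \<open>w = b k\<close> by (metis prod.collapse)
    then have "(b k, Forward, target (hd r)) \<in> set p"
      using d(1) \<open>r \<noteq> []\<close> hd_in_set[of r] by simp
    then show ?thesis by blast
  qed
  then show ?thesis by blast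
qed

lemma mirror_leaves:
  "(\<forall>q\<in>open_walks G Z Y X. \<exists>c. (t, Forward, c) \<in> set q) \<longleftrightarrow> (\<forall>p\<in>P. \<exists>c. (c, Backward, t) \<in> set p)"
  "(\<forall>q\<in>open_walks G Z Y X. \<exists>c. (c, Backward, t) \<in> set q) \<longleftrightarrow> (\<forall>p\<in>P. \<exists>c. (t, Forward, c) \<in> set p)"
  unfolding open_walks_reverse_eq[OF sym_edges, of Z Y X] by (simp_all add: mem_reversed_iff ball_simps del: set_reversed)

lemma right_upper_separated:
  assumes k: "1 \<le> k" "k \<le> Lb" and C: "C \<subseteq> Z" and w: "w \<in> Z"
    and r: "r \<in> open_walks G C w (b k)" "set (visited w r) \<inter> N \<subseteq> {b k}"
    and t: "b k \<notin> anc G (insert w C)"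
  shows "walk_separated G C X w"
proof -
  interpret R: relay G Z X Y "b k" by (rule relay_right[OF k(2)])
  have "R.enters Forward" unfolding R.enters_def using enters_right[OF k] by blast
  moreover have "b k = Y \<or> R.leaves Forward" unfolding R.leaves_def by (rule leaves_right[OF k(2)])
  ultimately show ?thesis
    using R.collider_separates_upper_attachment[OF _ _ C w r t] unfolding walk_separated_def by blast
qed

lemma right_lower_separated:
  assumes k: "1 \<le> k" "k \<le> Lb" and C: "C \<subseteq> Z" and w: "w \<in> Z" and nr: "no_return (b k)"
    and r: "r \<in> open_walks G C w (b k)" "set (visited w r) \<inter> N \<subseteq> {b k}" "kind (last r) = Backward"
  shows "b k \<noteq> Y \<Longrightarrow> walk_separated G (insert (b k) C) X Y"
    and "walk_separated G (insert (b k) C) X w"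
    and "b k \<noteq> Y \<Longrightarrow> walk_separated G (insert (b k) C) Y w"
proof -
  interpret R: relay G Z X Y "b k" by (rule relay_right[OF k(2)])
  interpret M: relay G Z Y X "b k" by (rule relay_right_mirror[OF k(2)])
  have enters: "R.enters Forward" unfolding R.enters_def using enters_right[OF k] by blast
  obtain p where p: "p \<in> P" using some_path by blast
  have "(b (k - 1), Forward, b k) \<in> set p" using branch_steps(1)[OF p, of "k - 1"] k by simp
  then have nX: "b k \<noteq> X" using distinct_targets(1)[OF P_walk(2)[OF p]] by blast
  note r' = R.open_walkD[OF r(1) C]
  have rr: "walk G (b k) (reversed r) w" by (rule walk_reversed[OF sym_edges r'(1)])
  have "unblocked (anc G C) C (reversed r)"
    using r(1) unblocked_reversed[OF r'(1)] by (simp add: open_walks_def)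
  from forward_walk_meets[OF rr _ _ this parent_closed_anc] r'(4) r(3)
  have "b k \<in> anc G C \<or> (b k, w) \<in> (directed G)\<^sup>*" using walk_all_forward[OF rr] by auto
  then have t: "b k \<in> anc G Z"
    using anc_mono[OF C, of G] w by (auto simp: anc_def)
  show "walk_separated G (insert (b k) C) X w"
    using R.relay_separates_lower_attachment[OF nX[symmetric] C t _ w r] enters nr unfolding walk_separated_def by blast
  assume nY: "b k \<noteq> Y"
  have l: "R.leaves Forward" using leaves_right[OF k(2)] nY unfolding R.leaves_def by blast
  show "walk_separated G (insert (b k) C) X Y"
    using R.relay_with_descendant_separates_ends[OF nX[symmetric] C t _ _ _ nY] l unfolding walk_separated_def by blast
  have e: "M.enters Backward" unfolding M.enters_def mirror_leaves using l unfolding R.leaves_def .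
  have rN: "set (visited w r) \<inter> path_nodes G Z Y X \<subseteq> {b k}"
    unfolding path_nodes_sym[OF sym_edges, of Z Y X] by (rule r(2))
  show "walk_separated G (insert (b k) C) Y w"
    using M.relay_separates_lower_attachment[OF nY[symmetric] C t _ w r(1) rN r(3)] e
    unfolding walk_separated_def by blast
qed

lemma source_separated:
  assumes C: "C \<subseteq> Z" and w: "w \<in> Z"
    and r: "r \<in> open_walks G C w (b 0)" "set (visited w r) \<inter> N \<subseteq> {b 0}"
  shows "b 0 \<noteq> X \<Longrightarrow> b 0 \<noteq> Y \<Longrightarrow> walk_separated G (insert (b 0) C) X Y"
    and "b 0 \<noteq> X \<Longrightarrow> walk_separated G (insert (b 0) C) X w"
    and "b 0 \<noteq> Y \<Longrightarrow> walk_separated G (insert (b 0) C) Y w"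
proof -
  interpret R: relay G Z X Y "b 0" by (rule relay_right) simp
  interpret M: relay G Z Y X "b 0" by (rule relay_right_mirror) simp
  interpret T: trek G Z Y X b a Lb La by (rule mirror)
  have lv: "b 0 = Y \<or> R.leaves Forward" unfolding R.leaves_def by (rule leaves_right) simp
  have mlv: "b 0 = X \<or> M.leaves Forward"
    unfolding M.leaves_def using T.leaves_right[of 0] source by simp
  have en: "b 0 \<noteq> X \<Longrightarrow> R.enters Backward"
    using mlv unfolding M.leaves_def mirror_leaves R.enters_def by blast
  have men: "b 0 \<noteq> Y \<Longrightarrow> M.enters Backward"
    using lv unfolding M.enters_def mirror_leaves R.leaves_def by blast
  have rN: "set (visited w r) \<inter> path_nodes G Z Y X \<subseteq> {b 0}"
    unfolding path_nodes_sym[OF sym_edges, of Z Y X] by (rule r(2))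
  show "b 0 \<noteq> X \<Longrightarrow> b 0 \<noteq> Y \<Longrightarrow> walk_separated G (insert (b 0) C) X Y"
    using R.source_separates_ends[OF _ _ _ C] en lv unfolding walk_separated_def by blast
  show "b 0 \<noteq> X \<Longrightarrow> walk_separated G (insert (b 0) C) X w"
    using R.source_separates_attachment[OF _ _ lv C w r] en unfolding walk_separated_def by blast
  show "b 0 \<noteq> Y \<Longrightarrow> walk_separated G (insert (b 0) C) Y w"
    using M.source_separates_attachment[OF _ _ mlv C w r(1) rN] men unfolding walk_separated_def by blast
qed

lemma right_notin_Z: "k \<le> Lb \<Longrightarrow> b k \<notin> Z"
  using relay.t_notin_Z[OF relay_right] .

lemma proper_descent:
  assumes "b k \<in> anc G {z}" "z \<in> Z" "k \<le> Lb"
  obtains ds where "walk G (b k) ds z" "ds \<noteq> []" "\<forall>s\<in>set ds. kind s = Forward"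
    "unblocked (anc G Z) {} ds" "\<And>c. (z, c) \<notin> directed G"
proof -
  have "(b k, z) \<in> (directed G)\<^sup>*" using assms(1) by (auto simp: anc_def)
  then obtain ds where ds: "walk G (b k) ds z" "\<And>s. s \<in> set ds \<Longrightarrow> kind s = Forward \<and> fst s \<noteq> z"
    by (rule directed_walk) blast
  have "b k \<noteq> z" using right_notin_Z[OF assms(3)] assms(2) by blast
  then have ne: "ds \<noteq> []" using ds(1) by auto
  have fw: "\<forall>s\<in>set ds. kind s = Forward" using ds(2) by blast
  have "(fst (last ds), z) \<in> directed G"
    using forward_walk_nodes(5)[OF ds(1) fw, of "last ds"] walk_ends(2)[OF ds(1) ne] ne by simp
  then have "\<And>c. (z, c) \<notin> directed G" using no_proper_children[OF assms(2)] by blast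
  then show ?thesis using that ds(1) ne fw unblocked_forward[OF fw] by simp
qed

text \<open>
  From \<open>b k\<close> down to \<open>z\<close> and back along the connection of \<open>z\<close>, which arrives with an arrowhead, is a forbidden
  return.
\<close>

lemma no_descent_to_upper:
  assumes k: "k \<le> Lb" and nr: "no_return (b k)" and z: "z \<in> Z" and C: "C \<subseteq> Z"
    and r: "r \<in> open_walks G C z (b k)" "kind (last r) \<noteq> Backward"
  shows "b k \<notin> anc G {z}"
proof
  assume "b k \<in> anc G {z}"
  then obtain ds where ds: "walk G (b k) ds z" "ds \<noteq> []" "\<forall>s\<in>set ds. kind s = Forward"
    "unblocked (anc G Z) {} ds" "\<And>c. (z, c) \<notin> directed G"
    using proper_descent z k by metis
  interpret R: relay G Z X Y "b k" by (rule relay_right[OF k])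
  note r' = R.open_walkD[OF r(1) C]
  have tz: "target (last ds) = z" "z \<in> anc G Z"
    using walk_ends(2)[OF ds(1,2)] z by (auto simp: anc_def)
  have "unblocked (anc G Z) {} (ds @ r)"
    unfolding unblocked_append[of _ _ ds] tz(1) using ds(4) r'(2) tz(2) by simp
  moreover have "walk G (b k) (ds @ r) (b k)" unfolding walk_append using ds(1) r'(1) by blast
  moreover have "kind (hd (ds @ r)) = Forward" using ds(2,3) by simp
  moreover have "kind (last (ds @ r)) \<noteq> Backward" using r(2) r'(4) by simp
  moreover have "fst (last (ds @ r)) \<notin> Z" if fwd: "kind (last (ds @ r)) = Forward"
  proof -
    have l: "kind (last r) = Forward" using fwd r'(4) by simp
    have d: "r = butlast r @ [last r]" using r'(4) by simp
    show ?thesis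
    proof (cases "butlast r = []")
      case True
      then have "r = [last r]" using d by simp
      then have "walk G z [last r] (b k)" using r'(1) by simp
      then have "(z, b k) \<in> directed G" using l by (cases "last r") auto
      then show ?thesis using ds(5) by blast
    next
      case False
      obtain c where c: "walk G z (butlast r) c" "walk G c [last r] (b k)"
        using r'(1) d unfolding walk_append[of G z "butlast r" "[last r]", symmetric] by (metis walk_append)
      have "unblocked (anc G Z) Z (butlast r @ [last r])"
        using path_avoids_Z[OF r'(1,3,2)] d by simp
      then have "target (last (butlast r)) \<notin> Z"
        unfolding unblocked_append[of _ _ "butlast r"] using l False by simp
      then have "c \<notin> Z" using walk_ends(2)[OF c(1) False] by simp
      then show ?thesis using c(2) r'(4) by (cases "last r") simp
    qed
  qed
  ultimately show False using no_returnD[OF nr, of "ds @ r"] ds(2) by blast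
qed

lemma right_chain_return:
  assumes "j < k" "k \<le> Lb" and nr: "no_return (b k)"
    and ds: "walk G (b k) ds (b j)" "unblocked (anc G Z) {} ds" "ds = [] \<or> kind (hd ds) = Forward"
  shows False
proof -
  have ch: "walk G (b j) (chain b j k) (b k)"
    using branch_edges(1) assms(1,2) by (intro chain_walk) auto
  have uch: "unblocked (anc G Z) {} (chain b j k)"
    by (rule unblocked_forward) (auto simp: set_chain)
  have "unblocked (anc G Z) {} (ds @ chain b j k)"
    unfolding unblocked_append[of _ _ ds] using ds(2) uch hd_chain[OF assms(1), of b] by simp
  moreover have "walk G (b k) (ds @ chain b j k) (b k)" unfolding walk_append using ds(1) ch by blast
  moreover have "ds @ chain b j k \<noteq> []" using assms(1) by simp
  moreover have "kind (hd (ds @ chain b j k)) = Forward"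
    using ds(3) hd_chain[OF assms(1), of b] by (cases ds) auto
  moreover have "kind (last (ds @ chain b j k)) \<noteq> Backward" "fst (last (ds @ chain b j k)) \<notin> Z"
    using last_chain[OF assms(1), of b] assms(1,2) right_notin_Z[of "k - 1"] by simp_all
  ultimately show False using no_returnD[OF nr, of "ds @ chain b j k"] by blast
qed

text \<open>
  From \<open>b k\<close> down to \<open>z\<close>, back to \<open>b j\<close> along the connection of \<open>z\<close> and down the branch is a forbidden return.
\<close>

lemma no_descent_to_earlier:
  assumes jk: "j < k" "k \<le> Lb" and nr: "no_return (b k)" and z: "z \<in> Z" and C: "C \<subseteq> Z"
    and r: "r \<in> open_walks G C z (b j)"
  shows "b k \<notin> anc G {z}"
proof
  assume "b k \<in> anc G {z}"
  then obtain ds where ds: "walk G (b k) ds z" "ds \<noteq> []" "\<forall>s\<in>set ds. kind s = Forward"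
    "unblocked (anc G Z) {} ds" using proper_descent z jk(2) by metis
  interpret R: relay G Z X Y "b k" by (rule relay_right[OF jk(2)])
  note r' = R.open_walkD[OF r(1) C]
  have tz: "target (last ds) = z" "z \<in> anc G Z"
    using walk_ends(2)[OF ds(1,2)] z by (auto simp: anc_def)
  have "unblocked (anc G Z) {} (ds @ r)"
    unfolding unblocked_append[of _ _ ds] tz(1) using ds(4) r'(2) tz(2) by simp
  moreover have "walk G (b k) (ds @ r) (b j)" unfolding walk_append using ds(1) r'(1) by blast
  moreover have "kind (hd (ds @ r)) = Forward" using ds(2,3) by simp
  ultimately show False using right_chain_return[OF jk nr] by blast
qed

text \<open>
  If \<open>z\<close> is attached to the other branch, follow a path in \<open>P\<close> from \<open>X\<close> to \<open>a j\<close>, the connection to \<open>z\<close>, the directed path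
  up to \<open>b k\<close>, and the path in \<open>P\<close> on to \<open>Y\<close>. This bypasses the source of the trek, while the element of \<open>P\<close> obtained
  from it must visit the source. So the source lies on the directed path from \<open>b k\<close> to \<open>z\<close>, and \<open>b k\<close> is on a
  directed cycle.
\<close>

lemma no_descent_across:
  assumes k: "1 \<le> k" "k \<le> Lb" and j: "1 \<le> j" "j \<le> La" and nr: "no_return (b k)"
    and z: "z \<in> Z" and C: "C \<subseteq> Z"
    and r: "r \<in> open_walks G C z (a j)" "set (visited z r) \<inter> N \<subseteq> {a j}"
  shows "b k \<notin> anc G {z}"
proof
  assume "b k \<in> anc G {z}"
  then obtain ds where ds: "walk G (b k) ds z" "ds \<noteq> []" "\<forall>s\<in>set ds. kind s = Forward"
    "unblocked (anc G Z) {} ds" using proper_descent z k(2) by metis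
  interpret R: relay G Z X Y "b k" by (rule relay_right[OF k(2)])
  note r' = R.open_walkD[OF r(1) C]
  obtain p0 where p0: "p0 \<in> P" using some_path by blast
  obtain l e where d: "p0 = l @ reversed (chain a 0 La) @ chain b 0 Lb @ e"
    "l = [] \<or> kind (last l) = Backward" using shape[OF p0] by blast
  define p1 where "p1 = l @ reversed (chain a j La)"
  define pm where "pm = reversed (chain a 0 j) @ chain b 0 k"
  define p2 where "p2 = chain b k Lb @ e"
  have d': "p0 = p1 @ pm @ p2"
    unfolding d(1) p1_def pm_def p2_def
    using chain_append[of 0 j La a] chain_append[of 0 k Lb b] j k by simp
  have ch: "walk G (a j) (reversed (chain a 0 j)) (a 0)" "walk G (b 0) (chain b 0 k) (b k)"
    using branch_edges j k by (auto intro!: walk_reversed[OF sym_edges] chain_walk)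
  have m: "walk G (a j) pm (b k)"
    unfolding pm_def walk_append using ch source by auto
  have pm: "pm \<noteq> []" "fst (hd pm) = a j" "target (last pm) = b k"
    using walk_ends[OF m] k unfolding pm_def by auto
  obtain x y where xy: "walk G X p1 x" "walk G x pm y" "walk G y p2 Y"
    using P_walk(1)[OF p0] unfolding d' walk_append by blast
  have "x = a j" "y = b k" using walk_ends[OF xy(2) pm(1)] pm by simp_all
  then have w: "walk G X p1 (a j)" "walk G (b k) p2 Y" using xy by simp_all
  have a0: "a 0 \<in> target ` set (reversed (chain a 0 j))"
  proof -
    have "(a 1, Backward, a 0) \<in> set (reversed (chain a 0 j))"
      unfolding mem_reversed_iff using j(1) by (auto simp: set_chain)
    then show ?thesis by (rule rev_image_eqI) simp
  qed
  have dis: "distinct (visited X p1 @ map target pm @ map target p2)"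
    using P_walk(2)[OF p0] unfolding d' visited_append[OF w(1)] by simp
  have "a 0 \<in> set (map target pm)" using a0 by (auto simp: pm_def)
  then have a0': "a 0 \<notin> set (visited X p1)" "a 0 \<notin> set (map target p2)" using dis by auto
  have ok: "unblocked (anc G Z) {} p1" "unblocked (anc G Z) {} p2"
  proof -
    have "unblocked (anc G Z) {} p0" by (rule unblocked_mono[OF no_colliders[OF p0]]) simp_all
    then show "unblocked (anc G Z) {} p1" "unblocked (anc G Z) {} p2"
      unfolding d' unblocked_append[of _ _ p1] unblocked_append[of _ _ pm] by blast+
  qed
  have last_p1: "p1 = [] \<or> kind (last p1) = Backward"
    using d(2) by (cases "j < La") (auto simp: p1_def hd_chain)
  have rr: "walk G (a j) (reversed r) z" "walk G z (reversed ds) (b k)"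
    using walk_reversed[OF sym_edges] r'(1) ds(1) by blast+
  have t1: "target (last (reversed r)) = z" "target (last (reversed ds)) = b k"
    using walk_ends(2)[OF rr(1)] walk_ends(2)[OF rr(2)] r'(4) ds(2) by simp_all
  have "z \<in> anc G Z" using z by (auto simp: anc_def)
  have "unblocked (anc G Z) {} (reversed ds @ p2)"
    unfolding unblocked_append[of _ _ "reversed ds"]
    using ok(2) unblocked_reversed[OF ds(1)] ds(2,3,4) by simp
  then have "unblocked (anc G Z) {} (reversed r @ reversed ds @ p2)"
    unfolding unblocked_append[of _ _ "reversed r"] t1
    using unblocked_reversed[OF r'(1)] r'(2) \<open>z \<in> anc G Z\<close> by simp
  then have "unblocked (anc G Z) {} (p1 @ reversed r @ reversed ds @ p2)"
    unfolding unblocked_append[of _ _ p1] using ok(1) last_p1 by auto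
  moreover have "walk G X (p1 @ reversed r @ reversed ds @ p2) Y"
    using w rr by (auto simp: walk_append)
  ultimately obtain p where p: "p \<in> P" "set p \<subseteq> set (p1 @ reversed r @ reversed ds @ p2)"
    using R.in_P_if_connected by metis
  have s: "(a 1, Backward, a 0) \<in> set p" using branch_steps(2)[OF p(1), of 0] j by simp
  have "(a 1, Backward, a 0) \<notin> set p1" using walk_steps(3)[OF w(1)] a0'(1) by blast
  moreover have "(a 1, Backward, a 0) \<notin> set p2" using a0'(2) by force
  moreover have "(a 1, Backward, a 0) \<notin> set (reversed r)"
  proof
    assume "(a 1, Backward, a 0) \<in> set (reversed r)"
    then have "(a 0, Forward, a 1) \<in> set r" unfolding mem_reversed_iff .
    then have "a 0 \<in> set (visited z r)" using walk_steps(2)[OF r'(1)] by blast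
    then have "a 0 \<in> {a j}" using R.visited_in_P(2)[OF p(1) s] by (intro subsetD[OF r(2)] IntI)
    moreover have "a j \<in> set (visited X p1)" by (rule walk_end_visited[OF w(1)])
    ultimately show False using a0'(1) by simp
  qed
  ultimately have "(a 1, Backward, a 0) \<in> set (reversed ds)" using p(2) s by auto
  then have "(a 0, Forward, a 1) \<in> set ds" unfolding mem_reversed_iff .
  then have "(b k, b 0) \<in> (directed G)\<^sup>*"
    using forward_walk_nodes(1)[OF ds(1,3)] source by fastforce
  then obtain cs where cs: "walk G (b k) cs (b 0)" "\<And>s. s \<in> set cs \<Longrightarrow> kind s = Forward \<and> fst s \<noteq> b 0"
    by (rule directed_walk) blast
  have fw: "\<forall>s\<in>set cs. kind s = Forward" using cs(2) by blast
  have "cs = [] \<or> kind (hd cs) = Forward" using fw by (cases cs) auto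
  then show False
    using right_chain_return[OF _ k(2) nr cs(1) unblocked_forward[OF fw]] k(1) by simp
qed

end

section \<open>Adding one variable to the conditioning set\<close>

lemma walk_separated_sym:
  assumes "sym (bidirected G)" "walk_separated G C u v"
  shows "walk_separated G C v u"
  unfolding walk_separated_def
proof (intro allI impI)
  fix ss assume w: "walk G v ss u"
  show "\<not> unblocked (anc G C) C ss"
    using assms(2) walk_reversed[OF assms(1) w] unblocked_reversed[OF w]
    unfolding walk_separated_def by blast
qed

lemma separated_imp_walk_separated:
  assumes "mixed_graph G" "separated G u v C" "u \<noteq> v" "u \<notin> C" "v \<notin> C"
  shows "walk_separated G C u v"
  unfolding walk_separated_def
proof (intro allI impI notI)
  fix ss assume "walk G u ss v" "unblocked (anc G C) C ss"
  from open_walk_exists[OF this assms(3-5)] have "open_walks G C u v \<noteq> {}" by blast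
  then show False using assms(2) unfolding separated_def open_paths_eq[OF assms(1)] by simp
qed

context sem
begin

lemma pcov_self: "C \<subseteq> V \<Longrightarrow> t \<in> V \<Longrightarrow> t \<notin> C \<Longrightarrow> pcov (insert t C) t z = 0"
  using pcov_insert[of C t t z] pcov_pos[of C t] pcov_sym[of C t z] by simp

text \<open>
  The correction term in the recursion for the partial covariance vanishes.
\<close>

lemma neutral_step:
  assumes C: "C \<subseteq> V" and w: "w \<in> V - C" and uv: "u \<in> V - C" "v \<in> V - C" "u \<noteq> w" "v \<noteq> w"
    and sep: "walk_separated D C u w \<or> walk_separated D C v w"
  shows "pcov (insert w C) u v = pcov C u v"
proof -
  have "pcov C u w = 0 \<or> pcov C v w = 0"
    using sep global_markov[OF C uv(1) w uv(3)] global_markov[OF C uv(2) w uv(4)]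
    unfolding walk_separated_def by blast
  then show ?thesis using pcov_insert[of C w u v] C w by auto
qed

text \<open>
  If \<open>C\<close> and \<open>t\<close> separate \<open>y\<close> from \<open>z\<close>, then \<open>\<sigma>(y, z | C) = \<sigma>(y, t | C) \<sigma>(t, z | C) / \<sigma>(t, t | C)\<close>. Insert
  this for the three pairs into the recursion. Where \<open>t\<close> is \<open>y\<close> or \<open>z\<close> this
  formula is trivial.
\<close>

lemma relay_step:
  assumes C: "C \<subseteq> V" and w: "w \<in> V - C" and uv: "u \<in> V - C" "v \<in> V - C" "u \<noteq> w" "v \<noteq> w" "u \<noteq> v"
    and t: "t \<in> V - C" "t \<noteq> w"
    and sep: "t \<noteq> u \<Longrightarrow> t \<noteq> v \<Longrightarrow> walk_separated D (insert t C) u v"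
      "t \<noteq> u \<Longrightarrow> walk_separated D (insert t C) u w"
      "t \<noteq> v \<Longrightarrow> walk_separated D (insert t C) v w"
  shows "pcov (insert w C) u v = pcov C u v * (pcov (insert w C) t t / pcov C t t)"
proof -
  have Ct: "insert t C \<subseteq> V" using C t by blast
  have markov: "pcov (insert t C) y z = 0"
    if "t \<noteq> y \<Longrightarrow> t \<noteq> z \<Longrightarrow> walk_separated D (insert t C) y z" "y \<in> V - C" "z \<in> V - C" "y \<noteq> z" for y z
  proof (cases "t = y \<or> t = z")
    case True
    then show ?thesis using pcov_self[of C t] C t pcov_sym[of "insert t C" y z] by auto
  next
    case False
    then show ?thesis using global_markov[OF Ct, of y z] that unfolding walk_separated_def by blast
  qed
  have t0: "pcov C t t > 0" using pcov_pos C t by blast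
  have w0: "pcov C w w > 0" using pcov_pos C w by blast
  have through: "pcov C y z = pcov C y t * pcov C z t / pcov C t t" if "pcov (insert t C) y z = 0" for y z
    using that pcov_insert[of C t y z] C t by simp
  have uv': "pcov C u v = pcov C u t * pcov C v t / pcov C t t"
    by (intro through markov) (use sep uv in auto)
  have uw: "pcov C u w = pcov C u t * pcov C w t / pcov C t t"
    by (intro through markov) (use sep uv w t in auto)
  have vw: "pcov C v w = pcov C v t * pcov C w t / pcov C t t"
    by (intro through markov) (use sep uv w t in auto)
  have "pcov (insert w C) u v = pcov C u v - pcov C u w * pcov C v w / pcov C w w"
    using pcov_insert[of C w u v] C w by simp
  also have "\<dots> = pcov C u v * ((pcov C t t - pcov C t w * pcov C t w / pcov C w w) / pcov C t t)"
    unfolding uv' uw vw pcov_sym[of C w t] using t0 w0 by (simp add: field_simps)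
  also have "pcov C t t - pcov C t w * pcov C t w / pcov C w w = pcov (insert w C) t t"
    using pcov_insert[of C w t t] C w by simp
  finally show ?thesis .
qed

end

text \<open>
  With \<open>g\<close> constant this also covers steps that leave \<open>f\<close> unchanged.
\<close>

lemma enumerable_telescope:
  fixes f g :: "'v set \<Rightarrow> real"
  assumes "enumerable_over B A Q" "A \<inter> B = {}"
    and step: "\<And>C w. B \<subseteq> C \<Longrightarrow> C \<subseteq> A \<union> B \<Longrightarrow> w \<in> A \<Longrightarrow> w \<notin> C \<Longrightarrow> Q C w \<Longrightarrow>
      f (insert w C) = f C * (g (insert w C) / g C)"
    and nonzero: "\<And>C. C \<subseteq> A \<union> B \<Longrightarrow> g C \<noteq> 0"
  shows "f (A \<union> B) = f B * (g (A \<union> B) / g B)"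
proof -
  obtain ws where ws: "distinct ws" "set ws = A" "\<forall>j<length ws. Q (B \<union> set (take j ws)) (ws ! j)"
    using assms(1) by (auto simp: enumerable_over_def)
  have "f (B \<union> set (take j ws)) = f B * (g (B \<union> set (take j ws)) / g B)" if "j \<le> length ws" for j
    using that
  proof (induction j)
    case 0
    then show ?case using nonzero[of B] by simp
  next
    case (Suc j)
    let ?C = "B \<union> set (take j ws)"
    have j: "j < length ws" using Suc by simp
    have sub: "?C \<subseteq> A \<union> B" using ws(2) set_take_subset[of j ws] by blast
    have new: "ws ! j \<notin> ?C"
    proof -
      have "ws ! j \<in> A" using ws(2) j by auto
      moreover have "ws ! j \<notin> set (take j ws)"
        using ws(1) j by (auto simp: in_set_conv_nth nth_eq_iff_index_eq)
      ultimately show ?thesis using assms(2) by blast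
    qed
    have ins: "B \<union> set (take (Suc j) ws) = insert (ws ! j) ?C"
      using j by (simp add: take_Suc_conv_app_nth)
    have "f (insert (ws ! j) ?C) = f ?C * (g (insert (ws ! j) ?C) / g ?C)"
      using ws j sub new by (intro step) auto
    then show ?case unfolding ins using Suc nonzero[OF sub] by simp
  qed
  from this[of "length ws"] ws(2) show ?thesis by (simp add: Un_commute)
qed

lemma enumerable_member:
  assumes "enumerable_over B A Q" "w \<in> A"
  obtains C where "C \<subseteq> A \<union> B" "Q C w"
proof -
  obtain ws where ws: "set ws = A" "\<forall>j<length ws. Q (B \<union> set (take j ws)) (ws ! j)"
    using assms(1) by (auto simp: enumerable_over_def)
  then obtain j where j: "j < length ws" "w = ws ! j" using assms(2) by (auto simp: in_set_conv_nth)
  then have "Q (B \<union> set (take j ws)) w" using ws by blast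
  moreover have "B \<union> set (take j ws) \<subseteq> A \<union> B" using ws(1) set_take_subset[of j ws] by blast
  ultimately show ?thesis using that by blast
qed

lemma connected_via_ch_walk:
  assumes "mixed_graph G"
  shows "connected_via_ch G N C w t \<longleftrightarrow>
    (\<exists>r\<in>open_walks G C w t. kind (last r) = Backward \<and> set (visited w r) \<inter> N \<subseteq> {t})"
proof -
  have "last (map kind r) = kind (last r)" if "r \<in> open_walks G C w t" for r
    using that by (simp add: open_walks_def last_map)
  then show ?thesis unfolding connected_via_ch_def open_paths_eq[OF assms] by auto
qed

lemma connected_via_pa_sp_walk:
  assumes "mixed_graph G"
  shows "connected_via_pa_sp G N C w t \<longleftrightarrow>
    (\<exists>r\<in>open_walks G C w t. kind (last r) \<noteq> Backward \<and> set (visited w r) \<inter> N \<subseteq> {t})"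
proof -
  have "last (map kind r) = kind (last r)" if "r \<in> open_walks G C w t" for r
    using that by (simp add: open_walks_def last_map)
  then show ?thesis unfolding connected_via_pa_sp_def open_paths_eq[OF assms] edge_type_not_Backward by auto
qed

section \<open>Conditioned diagrams and the shape of their open paths\<close>

lemma conditioning_graph:
  assumes "conditioning_of M D S D'"
  shows "conditioned_graph D' (Orig ` S \<union> new_nodes D S)"
proof
  show "mixed_graph D'" using assms by (auto simp: conditioning_of_def path_diagram_def)
  have dir: "directed D' = {(Orig a, Orig b) | a b. (a, b) \<in> directed D \<and> a \<notin> S} \<union>
      {(Copy a b, Orig b) | a b. (a, b) \<in> directed D \<and> a \<in> S}"
    and bi: "bidirected D' = {(Orig a, Orig b) | a b. (a, b) \<in> bidirected D}"
    using assms by (simp_all add: conditioning_of_def)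
  fix z assume "z \<in> Orig ` S \<union> new_nodes D S"
  then consider s where "z = Orig s" "s \<in> S" | a b where "z = Copy a b"
    by (auto simp: new_nodes_def)
  then show "(\<forall>b. (z, b) \<notin> directed D') \<or>
      ((\<forall>a. (a, z) \<notin> directed D' \<and> (a, z) \<notin> bidirected D') \<and>
       (\<exists>b. \<forall>c. (z, c) \<in> directed D' \<longrightarrow> c = b))"
  proof cases
    case 1
    then show ?thesis unfolding dir by auto
  next
    case 2
    then show ?thesis unfolding dir bi by auto
  qed
qed

lemma walk_sources:
  "walk G u p v \<Longrightarrow> i < length p \<Longrightarrow> fst (p ! i) = visited u p ! i"
proof (induction G u p v arbitrary: i rule: walk.induct)
  case (2 G u a e b ss v)
  then show ?case by (cases i) (auto simp: visited_def)
qed simp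

lemma subpath_steps:
  assumes "subpath_at k (qv, qe) (visited u p, map kind p)" "length qv = Suc (length qe)" "walk G u p v"
  shows "take (length qe) (drop k p) = steps_of qv qe"
proof -
  have v: "take (length qv) (drop k (visited u p)) = qv" and e: "take (length qe) (drop k (map kind p)) = qe"
    using assms(1) by (simp_all add: subpath_at_def)
  have len: "min (length p - k) (length qe) = length qe" using arg_cong[OF e, of length] by simp
  show ?thesis
  proof (rule nth_equalityI)
    show "length (take (length qe) (drop k p)) = length (steps_of qv qe)"
      using len assms(2) by (simp add: steps_of_def)
    fix i assume "i < length (take (length qe) (drop k p))"
    then have i: "i < length qe" "k + i < length p" using len by auto
    have qv: "qv ! j = visited u p ! (k + j)" if "j \<le> length qe" for j
    proof -
      have "qv ! j = take (length qv) (drop k (visited u p)) ! j" using v by simp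
      then show ?thesis using that assms(2) len i by (simp add: visited_def)
    qed
    have "qe ! i = take (length qe) (drop k (map kind p)) ! i" using e by simp
    then have qe: "qe ! i = kind (p ! (k + i))" using i by simp
    have "fst (p ! (k + i)) = qv ! i" using walk_sources[OF assms(3) i(2)] qv[of i] i by simp
    moreover have "target (p ! (k + i)) = qv ! Suc i" using qv[of "Suc i"] i by (simp add: visited_def)
    ultimately have "p ! (k + i) = (qv ! i, qe ! i, qv ! Suc i)" using qe by (metis prod.collapse)
    then show "take (length qe) (drop k p) ! i = steps_of qv qe ! i"
      using i assms(2) by (simp add: steps_of_def nth_tl)
  qed
qed

lemma length_chain: "length (chain f i j) = j - i"
  by (simp add: chain_def)

lemma trek_steps:
  assumes "m \<ge> 1"
  shows "steps_of (map x (rev [1..<m + 1] @ [m + 1..<m + n + 1])) (replicate (m - 1) Backward @ replicate n Forward) =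
    reversed (chain (\<lambda>k. x (k + 1)) 0 (m - 1)) @ chain (\<lambda>k. if k = 0 then x 1 else x (m + k)) 0 n"
    (is "steps_of ?qv ?qe = ?l @ ?r")
proof -
  have qv1: "?qv ! i = x (m - i)" if "i < m" for i
    using that by (simp add: nth_append rev_nth Suc_diff_Suc del: upt_Suc)
  have qv2: "?qv ! i = x (i + 1)" if "m \<le> i" "i < m + n" for i
    using that by (simp add: nth_append del: upt_Suc)
  have len: "length ?qv = m + n" "length ?qe = m - 1 + n" by simp_all
  show ?thesis
  proof (rule nth_equalityI)
    show "length (steps_of ?qv ?qe) = length (?l @ ?r)"
      using assms by (simp add: steps_of_def reversed_def chain_def)
    fix i assume "i < length (steps_of ?qv ?qe)"
    then have i: "i < m - 1 + n" using assms by (simp add: steps_of_def)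
    have s: "steps_of ?qv ?qe ! i = (?qv ! i, ?qe ! i, ?qv ! Suc i)"
      using i len assms by (simp add: steps_of_def nth_tl del: map_append)
    show "steps_of ?qv ?qe ! i = (?l @ ?r) ! i"
    proof (cases "i < m - 1")
      case True
      have "(?l @ ?r) ! i = flip_step (chain (\<lambda>k. x (k + 1)) 0 (m - 1) ! (m - 2 - i))"
        using True by (simp add: nth_append reversed_def rev_nth length_chain numeral_2_eq_2)
      also have "\<dots> = (x (m - i), Backward, x (m - Suc i))"
      proof -
        define q where "q = m - 2 - i"
        have "m - i = q + 1 + 1" "m - Suc i = q + 1" "q < m - 1" using True by (simp_all add: q_def)
        then show ?thesis unfolding q_def[symmetric] by (simp add: chain_def)
      qed
      finally have lr: "(?l @ ?r) ! i = (x (m - i), Backward, x (m - Suc i))" .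
      have qe: "?qe ! i = Backward" using True by (simp add: nth_append)
      have "i < m" "Suc i < m" using True by linarith+
      then show ?thesis unfolding s lr qe using qv1[OF \<open>i < m\<close>] qv1[OF \<open>Suc i < m\<close>] by metis
    next
      case False
      define k where "k = i - (m - 1)"
      have k: "i = m - 1 + k" "k < n" using False i by (simp_all add: k_def)
      have "(?l @ ?r) ! i = ?r ! k" using k by (simp add: nth_append reversed_def chain_def)
      also have "\<dots> = ((if k = 0 then x 1 else x (m + k)), Forward, x (m + Suc k))"
        using k by (simp add: chain_def)
      also have "(if k = 0 then x 1 else x (m + k)) = ?qv ! i"
      proof (cases "k = 0")
        case True
        then show ?thesis using qv1[of i] k assms by simp
      next
        case False
        then show ?thesis using qv2[of i] k assms by simp
      qed
      also have "x (m + Suc k) = ?qv ! Suc i" using qv2[of "Suc i"] k assms by simp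
      finally have lr: "(?l @ ?r) ! i = (?qv ! i, Forward, ?qv ! Suc i)" .
      have qe: "?qe ! i = Forward" using k by (simp add: nth_append)
      show ?thesis unfolding s lr qe by (rule refl)
    qed
  qed
qed

text \<open>
  The branches cannot be prolonged by edges with an arrowhead at their ends, for these would be colliders. Only
  at a trivial left branch this has to be part of the hypothesis.
\<close>

lemma trek_subpath_shape:
  assumes "has_trek_subpath x m n (visited u p, map kind p)" "m \<ge> 1" "n \<ge> 1"
    and w: "walk G u p v" and cf: "unblocked {} {} p"
  shows "\<exists>l r. p = l @ reversed (chain (\<lambda>k. x (k + 1)) 0 (m - 1)) @
      chain (\<lambda>k. if k = 0 then x 1 else x (m + k)) 0 n @ r \<and>
    (l = [] \<or> kind (last l) = Backward) \<and> (r = [] \<or> kind (hd r) = Forward)"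
proof -
  let ?l = "reversed (chain (\<lambda>k. x (k + 1)) 0 (m - 1))"
  let ?r = "chain (\<lambda>k. if k = 0 then x 1 else x (m + k)) 0 n"
  let ?qv = "map x (rev [1..<m + 1] @ [m + 1..<m + n + 1])"
  let ?qe = "replicate (m - 1) Backward @ replicate n Forward"
  obtain k where k: "subpath_at k (?qv, ?qe) (visited u p, map kind p)"
    "m = 1 \<longrightarrow> k = 0 \<or> map kind p ! (k - 1) = Backward"
    using assms(1) unfolding has_trek_subpath_def by auto
  have "take (length ?qe) (drop k p) = ?l @ ?r"
    using subpath_steps[OF k(1) _ w] trek_steps[OF assms(2), of x n] assms(2) by simp
  then have p: "p = take k p @ (?l @ ?r) @ drop (length ?qe) (drop k p)"
    by (metis append_take_drop_id)
  define l where "l = take k p"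
  define r where "r = drop (length ?qe) (drop k p)"
  have p': "p = l @ ?l @ ?r @ r" using p unfolding l_def r_def by simp
  have ne: "?r \<noteq> []" using assms(3) by simp
  have "kind (last ?r) = Forward" using assms(3) by (simp add: last_chain)
  then have "r = [] \<or> kind (hd r) = Forward"
    using cf ne unfolding p' unblocked_append[of _ _ l] unblocked_append[of _ _ ?l]
      unblocked_append[of _ _ ?r] by (auto split: if_splits)
  moreover have "l = [] \<or> kind (last l) = Backward"
  proof (cases "m = 1")
    case True
    show ?thesis
    proof (cases "k = 0")
      case True
      then show ?thesis by (simp add: l_def)
    next
      case False
      have "l \<noteq> [] \<Longrightarrow> k \<le> length p"
      proof (rule ccontr)
        assume "\<not> k \<le> length p"
        then have "drop k p = []" by simp
        then show False using \<open>take (length ?qe) (drop k p) = ?l @ ?r\<close> ne by simp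
      qed
      then have "l \<noteq> [] \<Longrightarrow> last l = p ! (k - 1) \<and> k - 1 < length p"
        using False by (auto simp: l_def last_conv_nth min_def)
      then show ?thesis using k(2) True False by (cases "l = []") auto
    qed
  next
    case False
    then have "?l \<noteq> []" "kind (hd ?l) \<noteq> Forward" using assms(2) by (simp_all add: last_chain)
    then have "l \<noteq> [] \<Longrightarrow> kind (last l) = Backward"
      using cf unfolding p' unblocked_append[of _ _ l] by (auto split: if_splits)
    then show ?thesis by blast
  qed
  ultimately show ?thesis using p' by blast
qed

text \<open>
  As \<open>x 1\<close> is the first node of the path, the subpath starts at position \<open>0\<close>.
\<close>

lemma directed_subpath_is_trek:
  assumes "has_directed_subpath x l (visited u p, map kind p)" "x 1 = u" "l \<ge> 1" "distinct (visited u p)"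
  shows "has_trek_subpath x 1 (l - 1) (visited u p, map kind p)"
proof -
  obtain k where k: "subpath_at k (map x [1..<l + 1], replicate (l - 1) Forward) (visited u p, map kind p)"
    using assms(1) by (auto simp: has_directed_subpath_def)
  have e: "map x [1..<l + 1] = map x (rev [1..<1 + 1] @ [1 + 1..<1 + (l - 1) + 1])"
  proof -
    have "[1..<l + 1] = 1 # [2..<l + 1]"
      using upt_conv_Cons[of 1 "l + 1"] assms(3) by (simp add: numeral_2_eq_2 del: upt_Suc)
    moreover have "rev [1..<1 + 1] @ [1 + 1..<1 + (l - 1) + 1] = 1 # [2..<l + 1]"
      using assms(3) by (simp add: upt_conv_Cons numeral_2_eq_2)
    ultimately show ?thesis by simp
  qed
  have "take l (drop k (visited u p)) = map x [1..<l + 1]" using k by (simp add: subpath_at_def del: upt_Suc)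
  then have *: "take l (drop k (visited u p)) ! 0 = x 1" "length (take l (drop k (visited u p))) = l"
    using assms(3) by (simp_all del: upt_Suc)
  then have "k < length (visited u p)" "visited u p ! k = visited u p ! 0"
    using assms(2,3) by (simp_all add: visited_def)
  then have "k = 0" using nth_eq_iff_index_eq[OF assms(4), of k 0] by (simp add: visited_def)
  then show ?thesis using k e unfolding has_trek_subpath_def by (intro exI[of _ k]) simp
qed

section \<open>The factorisation\<close>

lemma cumulative_Suc:
  "cumulative Zlo Zup k (Suc k) = Zup (Suc k) \<union> cumulative Zlo Zup k k"
  "cumulative Zlo Zup (Suc k) (Suc k) = Zlo (Suc k) \<union> cumulative Zlo Zup k (Suc k)"
  by (auto simp: cumulative_def atLeastAtMostSuc_conv)

lemma cumulative_0: "cumulative Zlo Zup 0 0 = {}"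
  by (simp add: cumulative_def)

text \<open>
  The case of a trek and a nonempty set of open paths. What is left is bookkeeping: \<open>x i\<close> with \<open>i \<le> m\<close> is the node
  \<open>i - 1\<close> of the left branch, \<open>x i\<close> with \<open>i > m\<close> the node \<open>i - m\<close> of the right branch, and left branches are
  treated in the mirrored trek.
\<close>

lemma trek_factorisation:
  fixes D :: "('w, 'a) path_diagram" and x :: "nat \<Rightarrow> 'w"
  assumes sem: "sem M D" and cg: "conditioned_graph D Z" and ZV: "Z \<subseteq> nodes D"
    and X: "X \<in> nodes D - Z" and Y: "Y \<in> nodes D - Z" and XY: "X \<noteq> Y"
    and connected: "open_walks D Z X Y \<noteq> {}"
    and no_colliders: "\<And>p. p \<in> open_walks D Z X Y \<Longrightarrow> unblocked {} {} p"
    and N: "N = path_nodes D Z X Y"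
    and mn: "m \<ge> 1" "n \<ge> 1"
    and x_nodes: "\<forall>i\<in>{1..m + n}. x i \<in> nodes D"
    and treks: "\<And>p. p \<in> open_walks D Z X Y \<Longrightarrow> has_trek_subpath x m n (visited X p, map kind p)"
    and no_routes: "\<forall>i\<in>{2..m + n}. \<not> (\<exists>vs es. open_route D Z vs es \<and>
        hd vs = x i \<and> last vs = x i \<and> hd es = Forward \<and> last es \<in> {Forward, Bidirected})"
    and upper: "\<forall>i\<in>{1..m + n}.
        Zup i \<subseteq> Z - cumulative Zlo Zup (i - 1) (i - 1) \<and>
        enumerable_over (cumulative Zlo Zup (i - 1) (i - 1)) (Zup i)
          (\<lambda>C w. connected_via_pa_sp D N C w (x i))"
    and lower: "\<forall>i\<in>{1..m + n}.
        Zlo i \<subseteq> Z - cumulative Zlo Zup (i - 1) i \<and>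
        enumerable_over (cumulative Zlo Zup (i - 1) i) (Zlo i)
          (\<lambda>C w. connected_via_ch D N C w (x i))"
    and rest: "enumerable_over (cumulative Zlo Zup (m + n) (m + n))
        (Z - cumulative Zlo Zup (m + n) (m + n))
        (\<lambda>C w. separated D X w C \<or> separated D Y w C)"
  shows "partial_cov M (rv D) X Y Z =
     partial_cov M (rv D) X Y {} *
     (partial_var M (rv D) (x 1) (Zlo 1 \<union> Zup 1) / partial_var M (rv D) (x 1) {}) *
     (\<Prod>i = 2..m + n.
        partial_var M (rv D) (x i) (cumulative Zlo Zup i i) /
        partial_var M (rv D) (x i) (cumulative Zlo Zup (i - 1) i))"
proof -
  interpret S: sem M D by (rule sem)
  interpret CG: conditioned_graph D Z by (rule cg)
  define a where "a k = x (k + 1)" for k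
  define b where "b k = (if k = 0 then x 1 else x (m + k))" for k
  interpret T: trek D Z X Y a b "m - 1" n
  proof unfold_locales
    show "X \<noteq> Y" "X \<notin> Z" "Y \<notin> Z" using X Y XY by auto
    show "a 0 = b 0" by (simp add: a_def b_def)
    show "0 < m - 1 + n" using mn by simp
    fix p assume p: "p \<in> open_walks D Z X Y"
    then have w: "walk D X p Y" by (simp add: open_walks_def)
    show "\<exists>l r. p = l @ reversed (chain a 0 (m - 1)) @ chain b 0 n @ r \<and>
        (l = [] \<or> kind (last l) = Backward) \<and> (r = [] \<or> kind (hd r) = Forward)"
      using trek_subpath_shape[OF treks[OF p] mn w no_colliders[OF p]]
      unfolding a_def[abs_def] b_def[abs_def] .
  qed (use connected no_colliders in auto)
  interpret L: trek D Z Y X b a n "m - 1" by (rule T.mirror)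
  let ?C = "cumulative Zlo Zup"
  have mixed: "mixed_graph D" by (rule CG.mixed)
  have NL: "N = path_nodes D Z Y X" unfolding N by (rule path_nodes_sym[OF CG.sym_edges, symmetric])
  have xb: "x i = b (i - m)" "1 \<le> i - m" "i - m \<le> n" if "m < i" "i \<le> m + n" for i
    using that by (auto simp: b_def)
  have xa: "x i = a (i - 1)" "i - 1 \<le> m - 1" if "1 \<le> i" "i \<le> m" for i
    using that by (auto simp: a_def)
  have x1: "x 1 = b 0" by (simp add: b_def)
  have xZ: "x i \<notin> Z" if "i \<in> {1..m + n}" for i
  proof (cases "m < i")
    case True
    then show ?thesis using xb[of i] T.right_notin_Z[of "i - m"] that by simp
  next
    case False
    then show ?thesis using xa[of i] L.right_notin_Z[of "i - 1"] that by simp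
  qed
  have nr: "CG.no_return (x i)" if "i \<in> {2..m + n}" for i
    using no_routes that xZ[of i] unfolding CG.no_return_def by auto

  have CZ: "?C k k \<subseteq> Z" if "k \<le> m + n" for k
    using that
  proof (induction k)
    case (Suc k)
    then show ?case using upper[rule_format, of "Suc k"] lower[rule_format, of "Suc k"]
      unfolding cumulative_Suc by auto
  qed (simp add: cumulative_0)
  have CZm: "?C (i - 1) (i - 1) \<subseteq> Z" if "i \<in> {1..m + n}" for i
    by (rule CZ) (use that in auto)
  have CZ': "?C (i - 1) i \<subseteq> Z" if "i \<in> {1..m + n}" for i
    using that CZm[OF that] upper[rule_format, of i] cumulative_Suc(1)[of Zlo Zup "i - 1"] by auto

  have ups: "\<exists>C r. C \<subseteq> Z \<and> r \<in> open_walks D C z (x i) \<and> kind (last r) \<noteq> Backward \<and>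
      set (visited z r) \<inter> N \<subseteq> {x i}" if z: "z \<in> Zup i" and i: "i \<in> {1..m + n}" for z i
  proof -
    obtain C where C: "C \<subseteq> Zup i \<union> ?C (i - 1) (i - 1)" "connected_via_pa_sp D N C z (x i)"
      using enumerable_member[OF conjunct2[OF upper[rule_format, OF i]] z] by blast
    have "C \<subseteq> Z" using C(1) CZm[OF i] upper[rule_format, OF i] by auto
    then show ?thesis using C(2) unfolding connected_via_pa_sp_walk[OF mixed] by blast
  qed
  have los: "\<exists>C r. C \<subseteq> Z \<and> r \<in> open_walks D C z (x i) \<and> set (visited z r) \<inter> N \<subseteq> {x i}"
    if z: "z \<in> Zlo i" and i: "i \<in> {1..m + n}" for z i
  proof -
    obtain C where C: "C \<subseteq> Zlo i \<union> ?C (i - 1) i" "connected_via_ch D N C z (x i)"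
      using enumerable_member[OF conjunct2[OF lower[rule_format, OF i]] z] by blast
    have "C \<subseteq> Z" using C(1) CZ'[OF i] lower[rule_format, OF i] by auto
    then show ?thesis using C(2) unfolding connected_via_ch_walk[OF mixed] by blast
  qed

  \<comment> \<open>Every element of the sets treated before is connected to \<open>x i\<close> through a parent or spouse, to a
    node above \<open>x i\<close> on its branch, or to the other branch.\<close>
  have no_descent: "x i \<notin> anc D {z}" if i: "i \<in> {2..m + n}" and z: "z \<in> ?C (i - 1) i" for i z
  proof -
    have zZ: "z \<in> Z" using z CZ'[of i] i by auto
    have inr: "CG.no_return (x i)" by (rule nr[OF i])
    consider "z \<in> Zup i" | j where "j \<in> {1..i - 1}" "z \<in> Zup j \<or> z \<in> Zlo j"
    proof -
      have "{1..i} = insert i {1..i - 1}" using i by auto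
      then show ?thesis using z that unfolding cumulative_def by auto
    qed
    then show ?thesis
    proof cases
      case 1
      then obtain C r where r: "C \<subseteq> Z" "r \<in> open_walks D C z (x i)" "kind (last r) \<noteq> Backward"
        using ups[of z i] i by auto
      show ?thesis
      proof (cases "m < i")
        case True
        then show ?thesis
          using T.no_descent_to_upper[of "i - m" z C r] xb[of i] i inr zZ r by simp
      next
        case False
        then show ?thesis
          using L.no_descent_to_upper[of "i - 1" z C r] xa[of i] i inr zZ r by simp
      qed
    next
      case 2
      then have j: "j \<in> {1..m + n}" "j < i" using i by auto
      obtain C r where r: "C \<subseteq> Z" "r \<in> open_walks D C z (x j)" "set (visited z r) \<inter> N \<subseteq> {x j}"
        using ups[of z j] los[of z j] 2(2) j(1) by blast
      consider "m < j" | "j = 1" "m < i" | "2 \<le> j" "j \<le> m" "m < i" | "i \<le> m" using j by fastforce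
      then show ?thesis
      proof cases
        case 1
        then show ?thesis
          using T.no_descent_to_earlier[of "j - m" "i - m" z C r] xb[of i] xb[of j] i j inr zZ r by simp
      next
        case 2
        then show ?thesis
          using T.no_descent_to_earlier[of 0 "i - m" z C r] xb[of i] x1 i inr zZ r by simp
      next
        case 3
        then show ?thesis
          using T.no_descent_across[of "i - m" "j - 1" z C r] xb[of i] xa[of j] i inr zZ r N by simp
      next
        case 4
        then show ?thesis
          using L.no_descent_to_earlier[of "j - 1" "i - 1" z C r] xa[of i] xa[of j] i j inr zZ r by simp
      qed
    qed
  qed

  have upper_sep: "walk_separated D C X w \<or> walk_separated D C Y w"
    if i: "i \<in> {2..m + n}" and C: "insert w C \<subseteq> ?C (i - 1) i" and con: "connected_via_pa_sp D N C w (x i)"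
    for i C w
  proof -
    have CZi: "insert w C \<subseteq> Z" using C CZ'[of i] i by auto
    then have cz: "C \<subseteq> Z" "w \<in> Z" by auto
    obtain r where r: "r \<in> open_walks D C w (x i)" "set (visited w r) \<inter> N \<subseteq> {x i}"
      using con unfolding connected_via_pa_sp_walk[OF mixed] by blast
    have t: "x i \<notin> anc D (insert w C)"
    proof
      assume "x i \<in> anc D (insert w C)"
      then obtain z where "z \<in> insert w C" "x i \<in> anc D {z}" by (auto simp: anc_def)
      then show False using no_descent[OF i, of z] C by blast
    qed
    show ?thesis
    proof (cases "m < i")
      case True
      then have "x i = b (i - m)" "1 \<le> i - m" "i - m \<le> n" using xb i by auto
      then show ?thesis
        using T.right_upper_separated[of "i - m" C w r] cz r t unfolding N by simp
    next
      case False
      then have "x i = a (i - 1)" "1 \<le> i - 1" "i - 1 \<le> m - 1" using xa i by auto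
      then show ?thesis
        using L.right_upper_separated[of "i - 1" C w r] cz r t unfolding NL by simp
    qed
  qed

  have lower_sep: "x i \<noteq> X \<Longrightarrow> x i \<noteq> Y \<Longrightarrow> walk_separated D (insert (x i) C) X Y"
      "x i \<noteq> X \<Longrightarrow> walk_separated D (insert (x i) C) X w"
      "x i \<noteq> Y \<Longrightarrow> walk_separated D (insert (x i) C) Y w"
    if i: "i \<in> {2..m + n}" and C: "C \<subseteq> Z" "w \<in> Z" and con: "connected_via_ch D N C w (x i)" for i C w
  proof -
    obtain r where r: "r \<in> open_walks D C w (x i)" "set (visited w r) \<inter> N \<subseteq> {x i}" "kind (last r) = Backward"
      using con unfolding connected_via_ch_walk[OF mixed] by blast
    have inr: "CG.no_return (x i)" by (rule nr[OF i])
    have "(x i \<noteq> X \<longrightarrow> x i \<noteq> Y \<longrightarrow> walk_separated D (insert (x i) C) X Y) \<and>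
      (x i \<noteq> X \<longrightarrow> walk_separated D (insert (x i) C) X w) \<and>
      (x i \<noteq> Y \<longrightarrow> walk_separated D (insert (x i) C) Y w)"
    proof (cases "m < i")
      case True
      then have e: "x i = b (i - m)" "1 \<le> i - m" "i - m \<le> n" using xb i by auto
      show ?thesis
        using T.right_lower_separated[OF e(2,3) C, of r] inr r unfolding N e(1) by simp
    next
      case False
      then have e: "x i = a (i - 1)" "1 \<le> i - 1" "i - 1 \<le> m - 1" using xa i by auto
      show ?thesis
        using L.right_lower_separated[OF e(2,3) C, of r] inr r walk_separated_sym[OF CG.sym_edges, of _ Y X]
        unfolding NL e(1) by simp
    qed
    then show "x i \<noteq> X \<Longrightarrow> x i \<noteq> Y \<Longrightarrow> walk_separated D (insert (x i) C) X Y"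
      "x i \<noteq> X \<Longrightarrow> walk_separated D (insert (x i) C) X w"
      "x i \<noteq> Y \<Longrightarrow> walk_separated D (insert (x i) C) Y w" by blast+
  qed

  have source_sep: "x 1 \<noteq> X \<Longrightarrow> x 1 \<noteq> Y \<Longrightarrow> walk_separated D (insert (x 1) C) X Y"
      "x 1 \<noteq> X \<Longrightarrow> walk_separated D (insert (x 1) C) X w"
      "x 1 \<noteq> Y \<Longrightarrow> walk_separated D (insert (x 1) C) Y w"
    if C: "C \<subseteq> Z" "w \<in> Z"
      and con: "connected_via_pa_sp D N C w (x 1) \<or> connected_via_ch D N C w (x 1)" for C w
  proof -
    obtain r where r: "r \<in> open_walks D C w (x 1)" "set (visited w r) \<inter> N \<subseteq> {x 1}"
      using con unfolding connected_via_ch_walk[OF mixed] connected_via_pa_sp_walk[OF mixed] by blast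
    note s = T.source_separated[OF C, of r, folded N x1, OF r]
    show "x 1 \<noteq> X \<Longrightarrow> x 1 \<noteq> Y \<Longrightarrow> walk_separated D (insert (x 1) C) X Y"
      "x 1 \<noteq> X \<Longrightarrow> walk_separated D (insert (x 1) C) X w"
      "x 1 \<noteq> Y \<Longrightarrow> walk_separated D (insert (x 1) C) Y w" using s by blast+
  qed

  \<comment> \<open>The covariance to be followed and the variances that make up its factors, as functions of the
    conditioning set.\<close>
  define f where "f C = S.pcov C X Y" for C
  define g where "g i C = S.pcov C (x i) (x i)" for i C
  have g0: "g i C \<noteq> 0" if "i \<in> {1..m + n}" "C \<subseteq> Z" for i C
    using S.pcov_pos[of C "x i"] that x_nodes xZ[of i] ZV unfolding g_def by fastforce
  have rstep: "f (insert w C) = f C * (g i (insert w C) / g i C)"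
    if i: "i \<in> {1..m + n}" and C: "C \<subseteq> Z" "w \<in> Z" "w \<notin> C"
      and sep: "x i \<noteq> X \<Longrightarrow> x i \<noteq> Y \<Longrightarrow> walk_separated D (insert (x i) C) X Y"
        "x i \<noteq> X \<Longrightarrow> walk_separated D (insert (x i) C) X w"
        "x i \<noteq> Y \<Longrightarrow> walk_separated D (insert (x i) C) Y w" for i C w
    unfolding f_def g_def
  proof (rule S.relay_step)
    show "C \<subseteq> nodes D" "w \<in> nodes D - C" "X \<in> nodes D - C" "Y \<in> nodes D - C" "X \<noteq> w" "Y \<noteq> w"
      using C ZV X Y by auto
    show "x i \<in> nodes D - C" "x i \<noteq> w" using x_nodes xZ[OF i] i C by auto
  qed (use sep XY in auto)
  have nstep: "f (insert w C) = f C"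
    if C: "C \<subseteq> Z" "w \<in> Z" "w \<notin> C" and sep: "walk_separated D C X w \<or> walk_separated D C Y w" for C w
    unfolding f_def by (rule S.neutral_step[OF _ _ _ _ _ _ sep]) (use C ZV X Y in auto)

  have low: "f (?C i i) = f (?C (i - 1) i) * (g i (?C i i) / g i (?C (i - 1) i))"
    if i: "i \<in> {1..m + n}" for i
  proof -
    have e: "?C i i = Zlo i \<union> ?C (i - 1) i" using cumulative_Suc(2)[of Zlo Zup "i - 1"] i by simp
    have l: "Zlo i \<subseteq> Z - ?C (i - 1) i" "enumerable_over (?C (i - 1) i) (Zlo i)
        (\<lambda>C w. connected_via_ch D N C w (x i))" using lower i by blast+
    have sub: "Zlo i \<union> ?C (i - 1) i \<subseteq> Z" using l(1) CZ'[OF i] by auto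
    show ?thesis unfolding e
    proof (rule enumerable_telescope[OF l(2)])
      show "Zlo i \<inter> ?C (i - 1) i = {}" using l(1) by blast
      show "g i C \<noteq> 0" if "C \<subseteq> Zlo i \<union> ?C (i - 1) i" for C
        using g0[OF i] that sub by blast
      fix C w assume C: "?C (i - 1) i \<subseteq> C" "C \<subseteq> Zlo i \<union> ?C (i - 1) i" "w \<in> Zlo i" "w \<notin> C"
        and con: "connected_via_ch D N C w (x i)"
      have cz: "C \<subseteq> Z" "w \<in> Z" using C sub by auto
      show "f (insert w C) = f C * (g i (insert w C) / g i C)"
      proof (cases "i = 1")
        case True
        show ?thesis using rstep[OF i cz C(4)] source_sep[OF cz] con unfolding True by blast
      next
        case False
        then have i2: "i \<in> {2..m + n}" using i by auto
        show ?thesis by (rule rstep[OF i cz C(4) lower_sep[OF i2 cz con]])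
      qed
    qed
  qed

  \<comment> \<open>At the source also the elements attached through parents and spouses contribute a factor.\<close>
  have up1: "f (?C 0 1) = f {} * (g 1 (?C 0 1) / g 1 {})"
  proof -
    have i: "1 \<in> {1..m + n}" using mn by simp
    have e: "?C 0 1 = Zup 1 \<union> ?C 0 0" using cumulative_Suc(1)[of Zlo Zup 0] by simp
    have u: "Zup 1 \<subseteq> Z - ?C 0 0" "enumerable_over (?C 0 0) (Zup 1)
        (\<lambda>C w. connected_via_pa_sp D N C w (x 1))" using upper[rule_format, OF i] by simp_all
    have sub: "Zup 1 \<union> ?C 0 0 \<subseteq> Z" using u(1) by (auto simp: cumulative_0)
    have "f (Zup 1 \<union> ?C 0 0) = f (?C 0 0) * (g 1 (Zup 1 \<union> ?C 0 0) / g 1 (?C 0 0))"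
    proof (rule enumerable_telescope[OF u(2)])
      show "Zup 1 \<inter> ?C 0 0 = {}" using u(1) by blast
      show "g 1 C \<noteq> 0" if "C \<subseteq> Zup 1 \<union> ?C 0 0" for C
        using g0[OF i] that sub by blast
      fix C w assume C: "?C 0 0 \<subseteq> C" "C \<subseteq> Zup 1 \<union> ?C 0 0" "w \<in> Zup 1" "w \<notin> C"
        and con: "connected_via_pa_sp D N C w (x 1)"
      have cz: "C \<subseteq> Z" "w \<in> Z" using C sub by auto
      show "f (insert w C) = f C * (g 1 (insert w C) / g 1 C)"
        using rstep[OF i cz C(4)] source_sep[OF cz] con by blast
    qed
    then show ?thesis unfolding e cumulative_0 .
  qed

  have up2: "f (?C (i - 1) i) = f (?C (i - 1) (i - 1))" if i: "i \<in> {2..m + n}" for i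
  proof -
    have i1: "i \<in> {1..m + n}" using i by auto
    have e: "?C (i - 1) i = Zup i \<union> ?C (i - 1) (i - 1)"
      using cumulative_Suc(1)[of Zlo Zup "i - 1"] i by simp
    have u: "Zup i \<subseteq> Z - ?C (i - 1) (i - 1)" "enumerable_over (?C (i - 1) (i - 1)) (Zup i)
        (\<lambda>C w. connected_via_pa_sp D N C w (x i))" using upper i1 by blast+
    have sub: "Zup i \<union> ?C (i - 1) (i - 1) \<subseteq> Z" using CZ'[OF i1] unfolding e .
    have "f (Zup i \<union> ?C (i - 1) (i - 1)) = f (?C (i - 1) (i - 1)) * (1 / 1)"
    proof (rule enumerable_telescope[OF u(2), where g = "\<lambda>_. 1"])
      show "Zup i \<inter> ?C (i - 1) (i - 1) = {}" using u(1) by blast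
      fix C w assume C: "?C (i - 1) (i - 1) \<subseteq> C" "C \<subseteq> Zup i \<union> ?C (i - 1) (i - 1)" "w \<in> Zup i" "w \<notin> C"
        and con: "connected_via_pa_sp D N C w (x i)"
      have cz: "C \<subseteq> Z" "w \<in> Z" using C sub by auto
      have "insert w C \<subseteq> ?C (i - 1) i" unfolding e using C by blast
      from nstep[OF cz C(4) upper_sep[OF i this con]]
      show "f (insert w C) = f C * (1 / 1)" by simp
    qed simp
    then show ?thesis unfolding e by simp
  qed

  have "f (?C k k) = f {} * (g 1 (?C 1 1) / g 1 {}) *
      (\<Prod>i = 2..k. g i (?C i i) / g i (?C (i - 1) i))" if "1 \<le> k" "k \<le> m + n" for k
    using that
  proof (induction k rule: dec_induct)
    case base
    have "1 \<in> {1..m + n}" using mn by simp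
    from low[OF this] up1 g0[OF this CZ'[OF this]] show ?case by simp
  next
    case (step k)
    have k: "Suc k \<in> {2..m + n}" "Suc k \<in> {1..m + n}" using step by auto
    have "{2..Suc k} = insert (Suc k) {2..k}" using step by auto
    then have "(\<Prod>i = 2..Suc k. g i (?C i i) / g i (?C (i - 1) i)) =
        (g (Suc k) (?C (Suc k) (Suc k)) / g (Suc k) (?C k (Suc k))) *
        (\<Prod>i = 2..k. g i (?C i i) / g i (?C (i - 1) i))" by simp
    then show ?case using low[OF k(2)] up2[OF k(1)] step by simp
  qed
  from this[of "m + n"] mn have total: "f (?C (m + n) (m + n)) = f {} * (g 1 (?C 1 1) / g 1 {}) *
      (\<Prod>i = 2..m + n. g i (?C i i) / g i (?C (i - 1) i))" by simp

  let ?T = "?C (m + n) (m + n)"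
  have TZ: "?T \<subseteq> Z" by (rule CZ) simp
  have "f ((Z - ?T) \<union> ?T) = f ?T * (1 / 1)"
  proof (rule enumerable_telescope[OF rest, where g = "\<lambda>_. 1"])
    fix C w assume C: "?T \<subseteq> C" "C \<subseteq> (Z - ?T) \<union> ?T" "w \<in> Z - ?T" "w \<notin> C"
      and s: "separated D X w C \<or> separated D Y w C"
    have cz: "C \<subseteq> Z" "w \<in> Z" using C TZ by auto
    have "walk_separated D C X w \<or> walk_separated D C Y w"
      using s separated_imp_walk_separated[OF mixed, of X w C]
        separated_imp_walk_separated[OF mixed, of Y w C] C cz X Y by blast
    from nstep[OF cz C(4) this] show "f (insert w C) = f C * (1 / 1)" by simp
  qed auto
  moreover have "(Z - ?T) \<union> ?T = Z" using TZ by blast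
  ultimately have fZ: "f Z = f ?T" by simp

  have pX: "partial_cov M (rv D) X Y C = f C" if "C \<subseteq> Z" for C
    unfolding f_def using S.partial_cov_eq_pcov[of C X Y] that ZV X Y by auto
  have pv: "partial_var M (rv D) (x i) C = g i C" if "C \<subseteq> Z" "i \<in> {1..m + n}" for C i
    unfolding g_def using S.partial_cov_eq_pcov[of C "x i" "x i"] that ZV x_nodes by auto
  have c1: "?C 1 1 = Zlo 1 \<union> Zup 1" by (simp add: cumulative_def)
  have i1: "1 \<in> {1..m + n}" using mn by simp
  have "(\<Prod>i = 2..m + n. partial_var M (rv D) (x i) (?C i i) / partial_var M (rv D) (x i) (?C (i - 1) i)) =
      (\<Prod>i = 2..m + n. g i (?C i i) / g i (?C (i - 1) i))"
    using pv CZ CZ' by (intro prod.cong refl) auto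
  moreover have "partial_var M (rv D) (x 1) (Zlo 1 \<union> Zup 1) = g 1 (?C 1 1)"
    unfolding c1[symmetric] by (rule pv[OF CZ i1]) (use mn in simp)
  moreover have "partial_var M (rv D) (x 1) {} = g 1 {}" by (rule pv[OF _ i1]) simp
  ultimately show ?thesis using total fZ pX[of Z] pX[of "{}"] by simp
qed

theorem theorem1:
  fixes M :: "'a measure"
    and D :: "('v, 'a) path_diagram"
    and D' :: "('v cnode, 'a) path_diagram"
    and S :: "'v set"
    and Z N :: "'v cnode set"
    and X Y :: 'v
    and x :: "nat \<Rightarrow> 'v cnode"
    and m n :: nat
    and Zlo Zup :: "nat \<Rightarrow> 'v cnode set"
    and P :: "('v cnode list \<times> edge_type list) set"
  assumes cond: "conditioning_of M D S D'"
    and Z_def: "Z = Orig ` S \<union> new_nodes D S"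
    and X: "X \<in> nodes D - S" and Y: "Y \<in> nodes D - S" and XY: "X \<noteq> Y"
    and P_def: "P = open_paths D' Z (Orig X) (Orig Y)"
    and N_def: "N = (\<Union>(vs, es)\<in>P. set vs)"
    and no_colliders: "\<forall>(vs, es)\<in>P. \<forall>i. \<not> collider_at es i"
    and mn: "m \<ge> 1" "n \<ge> 1"
    and x_nodes: "\<forall>i\<in>{1..m + n}. x i \<in> nodes D'"
    and subpaths: "\<forall>p\<in>P.
        has_trek_subpath x m n p \<or>
        (x 1 = Orig X \<and> has_directed_subpath x (m + n) p)"
    and no_routes: "\<forall>i\<in>{2..m + n}. \<not> (\<exists>vs es. open_route D' Z vs es \<and>
        hd vs = x i \<and> last vs = x i \<and> hd es = Forward \<and> last es \<in> {Forward, Bidirected})"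
    and upper: "\<forall>i\<in>{1..m + n}.
        Zup i \<subseteq> Z - cumulative Zlo Zup (i - 1) (i - 1) \<and>
        enumerable_over (cumulative Zlo Zup (i - 1) (i - 1)) (Zup i)
          (\<lambda>C w. connected_via_pa_sp D' N C w (x i))"
    and lower: "\<forall>i\<in>{1..m + n}.
        Zlo i \<subseteq> Z - cumulative Zlo Zup (i - 1) i \<and>
        enumerable_over (cumulative Zlo Zup (i - 1) i) (Zlo i)
          (\<lambda>C w. connected_via_ch D' N C w (x i))"
    and rest: "enumerable_over (cumulative Zlo Zup (m + n) (m + n))
        (Z - cumulative Zlo Zup (m + n) (m + n))
        (\<lambda>C w. separated D' (Orig X) w C \<or> separated D' (Orig Y) w C)"
  shows "partial_cov M (rv D') (Orig X) (Orig Y) Z =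
     partial_cov M (rv D') (Orig X) (Orig Y) {} *
     (partial_var M (rv D') (x 1) (Zlo 1 \<union> Zup 1) / partial_var M (rv D') (x 1) {}) *
     (\<Prod>i = 2..m + n.
        partial_var M (rv D') (x i) (cumulative Zlo Zup i i) /
        partial_var M (rv D') (x i) (cumulative Zlo Zup (i - 1) i))"
proof -
  have sem: "sem M D'" using cond by (simp add: sem_def conditioning_of_def)
  interpret S: sem M D' by (rule sem)
  have cg: "conditioned_graph D' Z" unfolding Z_def by (rule conditioning_graph[OF cond])
  interpret CG: conditioned_graph D' Z by (rule cg)
  have nodes: "nodes D' = Orig ` nodes D \<union> new_nodes D S" and SV: "S \<subseteq> nodes D"
    using cond by (simp_all add: conditioning_of_def)
  have ZV: "Z \<subseteq> nodes D'" unfolding Z_def nodes using SV by blast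
  have XY': "Orig X \<in> nodes D' - Z" "Orig Y \<in> nodes D' - Z" "Orig X \<noteq> Orig Y"
    using X Y XY unfolding Z_def nodes by (auto simp: new_nodes_def)
  let ?W = "open_walks D' Z (Orig X) (Orig Y)"
  have P: "P = (\<lambda>ss. (visited (Orig X) ss, map kind ss)) ` ?W"
    unfolding P_def by (rule open_paths_eq[OF CG.mixed])
  show ?thesis
  proof (cases "?W = {}")
    case True
    \<comment> \<open>Without open paths both covariances of \<open>X\<close> and \<open>Y\<close> vanish, as no subset of \<open>Z\<close> connects them.\<close>
    have no: "\<not> unblocked (anc D' Z) {} ss" if "walk D' (Orig X) ss (Orig Y)" for ss
      using CG.open_walk_from_walk[OF that] XY' True by auto
    have "S.pcov C (Orig X) (Orig Y) = 0" if C: "C \<subseteq> Z" for C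
    proof (rule S.global_markov)
      show "C \<subseteq> nodes D'" "Orig X \<in> nodes D' - C" "Orig Y \<in> nodes D' - C" "Orig X \<noteq> Orig Y"
        using C ZV XY' by auto
      show "\<not> unblocked (anc D' C) C ss" if "walk D' (Orig X) ss (Orig Y)" for ss
        using no[OF that] unblocked_mono[of "anc D' C" C ss "anc D' Z" "{}"] anc_mono[OF C, of D'] by auto
    qed
    then have "partial_cov M (rv D') (Orig X) (Orig Y) C = 0" if "C \<subseteq> Z" for C
      using S.partial_cov_eq_pcov[of C "Orig X" "Orig Y"] that ZV XY' by auto
    then show ?thesis by simp
  next
    case False
    have cf: "unblocked {} {} p" if p: "p \<in> ?W" for p
    proof -
      have "\<forall>i. \<not> collider_at (map kind p) i" using no_colliders p unfolding P by auto
      moreover have w: "walk D' (Orig X) p (Orig Y)" "p \<noteq> []" using p by (simp_all add: open_walks_def)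
      ultimately show ?thesis using openness_iff[OF w, of "{}" "{}"] by simp
    qed
    obtain m' n' where mn': "m' \<ge> 1" "n' \<ge> 1" "m' + n' = m + n"
      "\<And>p. p \<in> ?W \<Longrightarrow> has_trek_subpath x m' n' (visited (Orig X) p, map kind p)"
    proof (cases "x 1 = Orig X")
      case True
      have "has_trek_subpath x 1 (m + n - 1) (visited (Orig X) p, map kind p)" if p: "p \<in> ?W" for p
      proof -
        have w: "walk D' (Orig X) p (Orig Y)" and d: "distinct (visited (Orig X) p)"
          using p by (simp_all add: open_walks_def)
        have "has_trek_subpath x m n (visited (Orig X) p, map kind p) \<or>
          has_directed_subpath x (m + n) (visited (Orig X) p, map kind p)"
          using subpaths p unfolding P by blast
        then show ?thesis
        proof
          assume t: "has_trek_subpath x m n (visited (Orig X) p, map kind p)"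
          \<comment> \<open>A nontrivial left branch would enter \<open>X\<close>, the first node, from its left.\<close>
      have "m = 1"
          proof (rule ccontr)
            assume "m \<noteq> 1"
            then have m: "0 < m - 1" using mn by simp
            obtain l r where "p = l @ reversed (chain (\<lambda>k. x (k + 1)) 0 (m - 1)) @ r"
              using trek_subpath_shape[OF t mn w cf[OF p]] by blast
            moreover have "(x 2, Backward, x 1) \<in> set (reversed (chain (\<lambda>k. x (k + 1)) 0 (m - 1)))"
              unfolding mem_reversed_iff set_chain using m by (auto simp: numeral_2_eq_2)
            ultimately have "(x 2, Backward, x 1) \<in> set p" by simp
            then show False using distinct_targets(1)[OF d] True by blast
          qed
          then show ?thesis using t by simp
        next
          assume "has_directed_subpath x (m + n) (visited (Orig X) p, map kind p)"
          then show ?thesis using directed_subpath_is_trek[of x "m + n" "Orig X" p] True d mn by simp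
        qed
      qed
      then show ?thesis using that[of 1 "m + n - 1"] mn by simp
    next
      case False
      then show ?thesis using that[of m n] mn subpaths unfolding P by auto
    qed
    have N: "N = path_nodes D' Z (Orig X) (Orig Y)"
      unfolding N_def P path_nodes_def by auto
    show ?thesis
      using trek_factorisation[OF sem cg ZV XY' False cf N mn'(1,2), of x Zup Zlo] mn'(4)
        x_nodes no_routes upper lower rest unfolding mn'(3) by blast
  qed
qed

end
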